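(* Let $W$ be a Banach space and let $\mathcal M$ be a bounded symmetric subset of $W\setminus\{0\}$ radially homeomorphic to the unit sphere $S=\{u\in W:\|u\|=1\}$, with radial projection $\pi_{\mathcal M}:W\setminus\{0\}\to\mathcal M$. Let $A_0$ and $B_0$ be disjoint closed symmetric subsets of $\mathcal M$ such that $$i(A_0)=i(\mathcal M\setminus B_0)=k<\infty .$$ Let $w_0\in\mathcal M\setminus A_0$ and $0\le r<\rho<R$. Set $A_1=\{\pi_{\mathcal M}((1-s)v+sw_0):v\in A_0,\ 0\le s\le1\}$ (with $A_1=\{w_0\}$ if $A_0=\emptyset$) and $$A=\{ru:u\in A_1\}\cup\{tv:v\in A_0,\ r\le t\le R\}\cup\{Ru:u\in A_1\},\qquad B=\{\rho w:w\in B_0\}.$$ Then $A$ links $B$ cohomologically in dimension $k$.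
   Context: A set $A\subset W$ is symmetric if $-A=A$. That $\mathcal M$ is radially homeomorphic to $S$ means that the restriction to $\mathcal M$ of $\pi:W\setminus\{0\}\to S$, $u\mapsto u/\|u\|$, is a homeomorphism $\mathcal M\to S$; the radial projection onto $\mathcal M$ is $\pi_{\mathcal M}=(\pi|_{\mathcal M})^{-1}\circ\pi$. Cohomological linking: for disjoint nonempty subsets $A,B$ of $W$, $A$ links $B$ cohomologically in dimension $k\ge0$ if the inclusion $\iota:A\hookrightarrow W\setminus B$ induces a nontrivial homomorphism $\iota^\ast:\widetilde H^k(W\setminus B)\to\widetilde H^k(A)$ between reduced cohomology groups in dimension $k$ (Alexander–Spanier cohomology with $\mathbb Z_2$ coefficients). $\mathbb Z_2$-cohomological index (Fadell–Rabinowitz): for a symmetric set $A\subset W\setminus\{0\}$, let $\overline A=A/\mathbb Z_2$ be the quotient of $A$ with each $u$ and $-u$ identified, let $f:\overline A\to\mathbb{RP}^\infty$ be the classifying map, and let $f^\ast:H^\ast(\mathbb{RP}^\infty)\to H^\ast(\overline A)$ be the induced homomorphism of Alexander–Spanier cohomology rings with $\mathbb Z_2$ coefficients. Then $i(A)=0$ if $A=\emptyset$ and $i(A)=\sup\{m\ge1:f^\ast(\omega^{m-1})\ne0\}$ otherwise, where $\omega\in H^1(\mathbb{RP}^\infty)$ generates $H^\ast(\mathbb{RP}^\infty)=\mathbb Z_2[\omega]$. *)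

theory Defs
  imports "HOL-Homology.Homology" "HOL-Library.Z2" "HOL-Library.Extended_Nat"
begin

section \<open>Alexander--Spanier cohomology with \<open>\<int>\<^sub>2\<close> coefficients\<close>

text \<open>
  A \<open>(q+1)\<close>-tuple of points of \<open>X\<close> is a list of length \<open>q+1\<close>, and a \<open>q\<close>-cochain is an arbitrary
  function from these tuples to \<open>\<int>\<^sub>2\<close>, extended by \<open>0\<close> to all other lists.
\<close>

definition AS_tuples :: "nat \<Rightarrow> 'a topology \<Rightarrow> 'a list set" where
  "AS_tuples q X = {xs. length xs = Suc q \<and> set xs \<subseteq> topspace X}"

definition AS_cochains :: "nat \<Rightarrow> 'a topology \<Rightarrow> ('a list \<Rightarrow> bit) set" where
  "AS_cochains q X = {\<phi>. \<forall>xs. xs \<notin> AS_tuples q X \<longrightarrow> \<phi> xs = 0}"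

definition AS_locally_zero :: "nat \<Rightarrow> 'a topology \<Rightarrow> ('a list \<Rightarrow> bit) set" where
  "AS_locally_zero q X =
     {\<phi> \<in> AS_cochains q X.
        \<exists>\<U>. (\<forall>U\<in>\<U>. openin X U) \<and> \<Union>\<U> = topspace X \<and>
            (\<forall>U\<in>\<U>. \<forall>xs\<in>AS_tuples q X. set xs \<subseteq> U \<longrightarrow> \<phi> xs = 0)}"

text \<open>The coboundary \<open>C\<^sup>q(X) \<rightarrow> C\<^sup>q\<^sup>+\<^sup>1(X)\<close>; signs are irrelevant modulo \<open>2\<close>.\<close>

definition AS_coboundary :: "nat \<Rightarrow> 'a topology \<Rightarrow> ('a list \<Rightarrow> bit) \<Rightarrow> 'a list \<Rightarrow> bit" where
  "AS_coboundary q X \<phi> xs =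
     (if xs \<in> AS_tuples (Suc q) X then \<Sum>i\<le>Suc q. \<phi> (take i xs @ drop (Suc i) xs) else 0)"

text \<open>
  Alexander--Spanier cohomology is the cohomology of the quotient complex \<open>C\<^sup>*(X) / C\<^sup>*\<^sub>0(X)\<close> by the
  locally zero cochains. As HOL-Homology does for relative homology, cocycles and coboundaries of
  the quotient complex are represented by their preimages in \<open>C\<^sup>*(X)\<close>.
\<close>

definition AS_cocycles :: "nat \<Rightarrow> 'a topology \<Rightarrow> ('a list \<Rightarrow> bit) set" where
  "AS_cocycles q X = {\<phi> \<in> AS_cochains q X. AS_coboundary q X \<phi> \<in> AS_locally_zero (Suc q) X}"

definition AS_cocycle_group :: "nat \<Rightarrow> 'a topology \<Rightarrow> ('a list \<Rightarrow> bit) monoid" where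
  "AS_cocycle_group q X =
     \<lparr>carrier = AS_cocycles q X, mult = (\<lambda>\<phi> \<psi> xs. \<phi> xs + \<psi> xs), one = (\<lambda>_. 0)\<rparr>"

text \<open>The images of the incoming differential in the complex \<open>0 \<rightarrow> C\<^sup>0 \<rightarrow> C\<^sup>1 \<rightarrow> \<dots>\<close> and in the augmented
  complex \<open>\<int>\<^sub>2 \<rightarrow> C\<^sup>0 \<rightarrow> C\<^sup>1 \<rightarrow> \<dots>\<close>, whose first map sends \<open>c\<close> to the constant cochain \<open>c\<close>.\<close>

definition AS_const :: "'a topology \<Rightarrow> bit \<Rightarrow> 'a list \<Rightarrow> bit" where
  "AS_const X c xs = (if xs \<in> AS_tuples 0 X then c else 0)"

fun AS_image :: "nat \<Rightarrow> 'a topology \<Rightarrow> ('a list \<Rightarrow> bit) set" where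
  "AS_image 0 X = {\<lambda>_. 0}"
| "AS_image (Suc q) X = AS_coboundary q X ` AS_cochains q X"

fun AS_reduced_image :: "nat \<Rightarrow> 'a topology \<Rightarrow> ('a list \<Rightarrow> bit) set" where
  "AS_reduced_image 0 X = range (AS_const X)"
| "AS_reduced_image (Suc q) X = AS_coboundary q X ` AS_cochains q X"

definition AS_coboundaries :: "nat \<Rightarrow> 'a topology \<Rightarrow> ('a list \<Rightarrow> bit) set" where
  "AS_coboundaries q X = {\<lambda>xs. \<beta> xs + \<zeta> xs |\<beta> \<zeta>. \<beta> \<in> AS_image q X \<and> \<zeta> \<in> AS_locally_zero q X}"

definition AS_reduced_coboundaries :: "nat \<Rightarrow> 'a topology \<Rightarrow> ('a list \<Rightarrow> bit) set" where
  "AS_reduced_coboundaries q X =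
     {\<lambda>xs. \<beta> xs + \<zeta> xs |\<beta> \<zeta>. \<beta> \<in> AS_reduced_image q X \<and> \<zeta> \<in> AS_locally_zero q X}"

definition AS_cohomology_group :: "nat \<Rightarrow> 'a topology \<Rightarrow> ('a list \<Rightarrow> bit) set monoid" where
  "AS_cohomology_group q X = AS_cocycle_group q X Mod AS_coboundaries q X"

definition AS_reduced_cohomology_group :: "nat \<Rightarrow> 'a topology \<Rightarrow> ('a list \<Rightarrow> bit) set monoid" where
  "AS_reduced_cohomology_group q X = AS_cocycle_group q X Mod AS_reduced_coboundaries q X"

text \<open>
  Operations on cohomology classes are given on cosets: all representatives yield the same coset,
  so that the unions below are unions of equal sets.
\<close>

definition AS_pullback ::
    "nat \<Rightarrow> 'a topology \<Rightarrow> ('a \<Rightarrow> 'b) \<Rightarrow> ('b list \<Rightarrow> bit) \<Rightarrow> 'a list \<Rightarrow> bit" where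
  "AS_pullback q X f \<phi> xs = (if xs \<in> AS_tuples q X then \<phi> (map f xs) else 0)"

definition AS_induced ::
    "nat \<Rightarrow> 'a topology \<Rightarrow> ('a \<Rightarrow> 'b) \<Rightarrow> ('b list \<Rightarrow> bit) set \<Rightarrow> ('a list \<Rightarrow> bit) set" where
  "AS_induced q X f K =
     (\<Union>\<phi>\<in>K. AS_coboundaries q X #>\<^bsub>AS_cocycle_group q X\<^esub> AS_pullback q X f \<phi>)"

definition AS_reduced_induced ::
    "nat \<Rightarrow> 'a topology \<Rightarrow> ('a \<Rightarrow> 'b) \<Rightarrow> ('b list \<Rightarrow> bit) set \<Rightarrow> ('a list \<Rightarrow> bit) set" where
  "AS_reduced_induced q X f K =
     (\<Union>\<phi>\<in>K. AS_reduced_coboundaries q X #>\<^bsub>AS_cocycle_group q X\<^esub> AS_pullback q X f \<phi>)"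

definition AS_cup_cochain ::
    "nat \<Rightarrow> nat \<Rightarrow> 'a topology \<Rightarrow> ('a list \<Rightarrow> bit) \<Rightarrow> ('a list \<Rightarrow> bit) \<Rightarrow> 'a list \<Rightarrow> bit" where
  "AS_cup_cochain p q X \<phi> \<psi> xs =
     (if xs \<in> AS_tuples (p + q) X then \<phi> (take (Suc p) xs) * \<psi> (drop p xs) else 0)"

definition AS_cup ::
    "nat \<Rightarrow> nat \<Rightarrow> 'a topology \<Rightarrow> ('a list \<Rightarrow> bit) set \<Rightarrow> ('a list \<Rightarrow> bit) set \<Rightarrow> ('a list \<Rightarrow> bit) set" where
  "AS_cup p q X K L =
     (\<Union>\<phi>\<in>K. \<Union>\<psi>\<in>L. AS_coboundaries (p + q) X #>\<^bsub>AS_cocycle_group (p + q) X\<^esub>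
        AS_cup_cochain p q X \<phi> \<psi>)"

text \<open>Powers \<open>\<omega>\<^sup>n \<in> H\<^sup>n(X)\<close> of a class \<open>\<omega> \<in> H\<^sup>1(X)\<close>.\<close>

fun AS_cup_power :: "'a topology \<Rightarrow> ('a list \<Rightarrow> bit) set \<Rightarrow> nat \<Rightarrow> ('a list \<Rightarrow> bit) set" where
  "AS_cup_power X \<omega> 0 = AS_coboundaries 0 X #>\<^bsub>AS_cocycle_group 0 X\<^esub> AS_const X 1"
| "AS_cup_power X \<omega> (Suc n) = AS_cup n 1 X (AS_cup_power X \<omega> n) \<omega>"


section \<open>Infinite real projective space\<close>

definition orbit_pair :: "('a \<Rightarrow> 'a) \<Rightarrow> 'a \<Rightarrow> 'a set" where
  "orbit_pair \<tau> x = {x, \<tau> x}"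

text \<open>The quotient of \<open>X\<close> by an involution \<open>\<tau>\<close>, with the quotient topology.\<close>

definition orbit_space :: "('a \<Rightarrow> 'a) \<Rightarrow> 'a topology \<Rightarrow> 'a set topology" where
  "orbit_space \<tau> X = topology (\<lambda>U. U \<subseteq> orbit_pair \<tau> ` topspace X \<and>
     openin X {x \<in> topspace X. orbit_pair \<tau> x \<in> U})"

lemma openin_orbit_space:
  "openin (orbit_space \<tau> X) U \<longleftrightarrow>
     U \<subseteq> orbit_pair \<tau> ` topspace X \<and> openin X {x \<in> topspace X. orbit_pair \<tau> x \<in> U}"
proof -
  have "istopology (\<lambda>U. U \<subseteq> orbit_pair \<tau> ` topspace X \<and>
          openin X {x \<in> topspace X. orbit_pair \<tau> x \<in> U})"
    unfolding istopology_def
  proof (intro conjI allI impI)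
    fix S T
    assume S: "S \<subseteq> orbit_pair \<tau> ` topspace X \<and> openin X {x \<in> topspace X. orbit_pair \<tau> x \<in> S}"
      and T: "T \<subseteq> orbit_pair \<tau> ` topspace X \<and> openin X {x \<in> topspace X. orbit_pair \<tau> x \<in> T}"
    show "S \<inter> T \<subseteq> orbit_pair \<tau> ` topspace X" using S by blast
    have "{x \<in> topspace X. orbit_pair \<tau> x \<in> S \<inter> T} =
        {x \<in> topspace X. orbit_pair \<tau> x \<in> S} \<inter> {x \<in> topspace X. orbit_pair \<tau> x \<in> T}" by blast
    then show "openin X {x \<in> topspace X. orbit_pair \<tau> x \<in> S \<inter> T}"
      using S T by (simp add: openin_Int)
  next
    fix \<K>
    assume K: "\<forall>K\<in>\<K>. K \<subseteq> orbit_pair \<tau> ` topspace X \<and>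
      openin X {x \<in> topspace X. orbit_pair \<tau> x \<in> K}"
    show "\<Union>\<K> \<subseteq> orbit_pair \<tau> ` topspace X" using K by blast
    have "{x \<in> topspace X. orbit_pair \<tau> x \<in> \<Union>\<K>} =
        (\<Union>K\<in>\<K>. {x \<in> topspace X. orbit_pair \<tau> x \<in> K})" by blast
    then show "openin X {x \<in> topspace X. orbit_pair \<tau> x \<in> \<Union>\<K>}"
      using K by (auto intro: openin_Union)
  qed
  then show ?thesis
    unfolding orbit_space_def by (simp add: topology_inverse')
qed

text \<open>\<open>S\<^sup>\<infinity> = \<Union>\<^sub>n S\<^sup>n\<close> with the direct limit topology: a set is open iff it meets every \<open>S\<^sup>n\<close> in an
  open subset of \<open>S\<^sup>n\<close>.\<close>

definition infinite_sphere :: "(nat \<Rightarrow> real) topology" where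
  "infinite_sphere = topology (\<lambda>U. U \<subseteq> (\<Union>n. topspace (nsphere n)) \<and>
     (\<forall>n. openin (nsphere n) (U \<inter> topspace (nsphere n))))"

lemma openin_infinite_sphere:
  "openin infinite_sphere U \<longleftrightarrow> U \<subseteq> (\<Union>n. topspace (nsphere n)) \<and>
     (\<forall>n. openin (nsphere n) (U \<inter> topspace (nsphere n)))"
proof -
  have "istopology (\<lambda>U. U \<subseteq> (\<Union>n. topspace (nsphere n)) \<and>
          (\<forall>n. openin (nsphere n) (U \<inter> topspace (nsphere n))))"
    unfolding istopology_def
  proof (intro conjI allI impI)
    fix S T :: "(nat \<Rightarrow> real) set" and n
    assume S: "S \<subseteq> (\<Union>n. topspace (nsphere n)) \<and>
          (\<forall>n. openin (nsphere n) (S \<inter> topspace (nsphere n)))"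
      and T: "T \<subseteq> (\<Union>n. topspace (nsphere n)) \<and>
          (\<forall>n. openin (nsphere n) (T \<inter> topspace (nsphere n)))"
    show "S \<inter> T \<subseteq> (\<Union>n. topspace (nsphere n))" using S by blast
    have "S \<inter> T \<inter> topspace (nsphere n) =
        (S \<inter> topspace (nsphere n)) \<inter> (T \<inter> topspace (nsphere n))" by blast
    then show "openin (nsphere n) (S \<inter> T \<inter> topspace (nsphere n))"
      using S T by (metis openin_Int)
  next
    fix \<K> :: "(nat \<Rightarrow> real) set set" and n
    assume K: "\<forall>K\<in>\<K>. K \<subseteq> (\<Union>n. topspace (nsphere n)) \<and>
          (\<forall>n. openin (nsphere n) (K \<inter> topspace (nsphere n)))"
    show "\<Union>\<K> \<subseteq> (\<Union>n. topspace (nsphere n))" using K by blast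
    have "\<Union>\<K> \<inter> topspace (nsphere n) = (\<Union>K\<in>\<K>. K \<inter> topspace (nsphere n))" by blast
    moreover have "openin (nsphere n) (\<Union>K\<in>\<K>. K \<inter> topspace (nsphere n))"
      by (rule openin_Union) (use K in blast)
    ultimately show "openin (nsphere n) (\<Union>\<K> \<inter> topspace (nsphere n))" by simp
  qed
  then show ?thesis
    unfolding infinite_sphere_def by (simp add: topology_inverse')
qed

definition antipode :: "(nat \<Rightarrow> real) \<Rightarrow> nat \<Rightarrow> real" where
  "antipode x = (\<lambda>i. - x i)"

definition RP_infinity :: "(nat \<Rightarrow> real) set topology" where
  "RP_infinity = orbit_space antipode infinite_sphere"

text \<open>\<open>H\<^sup>*(X) = \<int>\<^sub>2[\<omega>]\<close> with \<open>\<omega>\<close> in degree one means, degree by degree, that \<open>H\<^sup>q(X)\<close> consists of \<open>0\<close> and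
  \<open>\<omega>\<^sup>q \<noteq> 0\<close>.\<close>

definition AS_polynomial_generator :: "'a topology \<Rightarrow> ('a list \<Rightarrow> bit) set \<Rightarrow> bool" where
  "AS_polynomial_generator X \<omega> \<longleftrightarrow>
     \<omega> \<in> carrier (AS_cohomology_group 1 X) \<and>
     (\<forall>q. AS_cup_power X \<omega> q \<noteq> \<one>\<^bsub>AS_cohomology_group q X\<^esub> \<and>
          carrier (AS_cohomology_group q X) =
            {\<one>\<^bsub>AS_cohomology_group q X\<^esub>, AS_cup_power X \<omega> q})"

definition RP_generator :: "((nat \<Rightarrow> real) set list \<Rightarrow> bit) set" where
  "RP_generator = (THE \<omega>. AS_polynomial_generator RP_infinity \<omega>)"


section \<open>The \<open>\<int>\<^sub>2\<close>-cohomological index\<close>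

definition symmetric_set :: "'a::real_normed_vector set \<Rightarrow> bool" where
  "symmetric_set A \<longleftrightarrow> uminus ` A = A"

definition sym_quotient :: "'a::real_normed_vector set \<Rightarrow> 'a set topology" where
  "sym_quotient A = orbit_space uminus (top_of_set A)"

text \<open>
  A classifying map of the double covering \<open>A \<rightarrow> A/\<int>\<^sub>2\<close> is a map to \<open>\<real>P\<^sup>\<infinity>\<close> covered by an equivariant
  map \<open>A \<rightarrow> S\<^sup>\<infinity>\<close>. It exists and is unique up to homotopy.
\<close>

definition is_classifying_map ::
    "'a::real_normed_vector set \<Rightarrow> ('a set \<Rightarrow> (nat \<Rightarrow> real) set) \<Rightarrow> bool" where
  "is_classifying_map A f \<longleftrightarrow>
     continuous_map (sym_quotient A) RP_infinity f \<and>
     (\<exists>F. continuous_map (top_of_set A) infinite_sphere F \<and>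
          (\<forall>u\<in>A. F (- u) = antipode (F u)) \<and>
          (\<forall>u\<in>A. f (orbit_pair uminus u) = orbit_pair antipode (F u)))"

definition classifying_map :: "'a::real_normed_vector set \<Rightarrow> 'a set \<Rightarrow> (nat \<Rightarrow> real) set" where
  "classifying_map A = (SOME f. is_classifying_map A f)"

definition cohomological_index :: "'a::real_normed_vector set \<Rightarrow> enat" where
  "cohomological_index A =
     (if A = {} then 0
      else Sup {enat m |m. 1 \<le> m \<and>
             AS_induced (m - 1) (sym_quotient A) (classifying_map A)
                 (AS_cup_power RP_infinity RP_generator (m - 1))
               \<noteq> \<one>\<^bsub>AS_cohomology_group (m - 1) (sym_quotient A)\<^esub>})"


section \<open>Cohomological linking and radial projection\<close>

definition links_cohomologically :: "nat \<Rightarrow> 'a::real_normed_vector set \<Rightarrow> 'a set \<Rightarrow> bool" where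
  "links_cohomologically k A B \<longleftrightarrow>
     A \<noteq> {} \<and> B \<noteq> {} \<and> A \<inter> B = {} \<and>
     (\<exists>K \<in> carrier (AS_reduced_cohomology_group k (top_of_set (UNIV - B))).
        AS_reduced_induced k (top_of_set A) id K
          \<noteq> \<one>\<^bsub>AS_reduced_cohomology_group k (top_of_set A)\<^esub>)"

definition sphere_proj :: "'a::real_normed_vector \<Rightarrow> 'a" where
  "sphere_proj u = u /\<^sub>R norm u"

definition radially_homeomorphic_to_sphere :: "'a::real_normed_vector set \<Rightarrow> bool" where
  "radially_homeomorphic_to_sphere M \<longleftrightarrow> (\<exists>g. homeomorphism M (sphere 0 1) sphere_proj g)"

definition radial_proj :: "'a::real_normed_vector set \<Rightarrow> 'a \<Rightarrow> 'a" where
  "radial_proj M u = inv_into M sphere_proj (sphere_proj u)"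

end

theory Submission
  imports Defs "HOL-Analysis.Abstract_Topological_Spaces"
begin

text \<open>
  Let \<open>U = M - B0\<close> and \<open>k \<ge> 1\<close>. Since \<open>\<omega>\<^sup>k\<close> vanishes on \<open>U/\<int>\<^sub>2\<close>, the Gysin sequence of the double covering
  of \<open>U/\<int>\<^sub>2\<close> provides \<open>\<alpha> \<in> H\<^sup>k\<^sup>-\<^sup>1(U)\<close> whose transfer is \<open>\<omega>\<^sup>k\<^sup>-\<^sup>1\<close>. Its restriction to \<open>A0\<close> has the nonzero
  transfer \<open>\<omega>\<^sup>k\<^sup>-\<^sup>1\<close>, hence is not zero in reduced cohomology. A Mayer--Vietoris connecting homomorphism
  turns \<open>\<alpha>\<close>, pulled back to the rays through \<open>U\<close>, into a class \<open>\<beta>\<close> of degree \<open>k\<close> on the complement of \<open>B\<close>.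
  If \<open>\<beta>\<close> vanished on \<open>A\<close>, then \<open>\<alpha>\<close> restricted to \<open>A0\<close> would be a sum of two classes that extend to the
  lower and to the upper part of \<open>A\<close>; but \<open>A0\<close> is null-homotopic in both, by the cones at the levels
  \<open>r\<close> and \<open>R\<close>. The same contraction of \<open>A0\<close> in \<open>M\<close> shows that \<open>B0\<close> is not empty.

  That \<open>\<omega>\<close> is the characteristic class of the covering
  \<open>S\<^sup>\<infinity> \<rightarrow> \<real>P\<^sup>\<infinity>\<close> follows again from the Gysin sequence, because \<open>S\<^sup>\<infinity>\<close> is contractible.
\<close>

section \<open>Cochains\<close>

text \<open>All arguments run on cochains. These are total functions on lists compared up to
  \<open>locally_zero\<close>, so one and the same function serves on every subspace.
  \<open>RP_generator\<close> and \<open>classifying_map\<close> are given by description and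
  choice, so nothing is known about the index until existence is proved. In an arbitrary Banach
  space an equivariant map into the infinite sphere comes from paracompactness of metric spaces.
  Labellings of a double covering are unique up to a coboundary, so the index can afterwards be read
  off from any 1-cochain \<open>w\<close> belonging to the covering, and classifying maps disappear.
  The sets involved need not be compact, so homotopy invariance is proved for arbitrary spaces;
  finiteness of the coefficients makes this possible. Cochains need not be continuous either. In the
  Mayer--Vietoris step a characteristic function of the points below \<open>B\<close> therefore
  replaces a partition of unity. For k = 0 the class \<alpha> would have degree -1; there this
  characteristic function is itself the linking class.\<close>

declare add_bit_eq_xor [simp del] mult_bit_eq_and [simp del]

lemma bit_add_self [simp]: "a + a = (0::bit)"
  by (simp flip: mult_2)

lemma bit_add_self_left [simp]: "a + (a + b) = (b::bit)"
  by (simp flip: add.assoc)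

text \<open>
  Unlike \<^const>\<open>AS_coboundary\<close>, the operator \<open>delta\<close> acts on arbitrary functions on lists. The value
  \<open>\<phi> []\<close> plays the role of the augmentation: \<open>delta \<phi> [x] = \<phi> []\<close>.
\<close>

fun delta :: "('a list \<Rightarrow> bit) \<Rightarrow> 'a list \<Rightarrow> bit" where
  "delta \<phi> [] = 0"
| "delta \<phi> (x # xs) = \<phi> xs + delta (\<lambda>ys. \<phi> (x # ys)) xs"

section \<open>The coboundary on lists\<close>

lemma delta_add: "delta (\<lambda>xs. \<phi> xs + \<psi> xs) zs = delta \<phi> zs + delta \<psi> zs"
  by (induction zs arbitrary: \<phi> \<psi>) (simp_all add: ac_simps)

lemma delta_0 [simp]: "delta (\<lambda>_. 0) zs = 0"
  by (induction zs) simp_all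

lemma delta_cong:
  assumes "\<And>ys. Suc (length ys) = length xs \<Longrightarrow> set ys \<subseteq> set xs \<Longrightarrow> \<phi> ys = \<psi> ys"
  shows "delta \<phi> xs = delta \<psi> xs"
  using assms
proof (induction xs arbitrary: \<phi> \<psi>)
  case (Cons x xs)
  have "delta (\<lambda>ys. \<phi> (x # ys)) xs = delta (\<lambda>ys. \<psi> (x # ys)) xs"
    by (rule Cons.IH) (rule Cons.prems, auto)
  moreover have "\<phi> xs = \<psi> xs" by (rule Cons.prems) auto
  ultimately show ?case by simp
qed simp

lemma delta_delta [simp]: "delta (delta \<phi>) xs = 0"
  by (induction xs arbitrary: \<phi>) (simp_all add: delta_add)

lemma delta_map: "delta (\<lambda>ys. \<phi> (map f ys)) xs = delta \<phi> (map f xs)"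
proof (induction xs arbitrary: \<phi>)
  case (Cons x xs)
  show ?case using Cons[of "\<lambda>zs. \<phi> (f x # zs)"] by simp
qed simp

lemma delta_eq_sum: "delta \<phi> xs = (\<Sum>i<length xs. \<phi> (take i xs @ drop (Suc i) xs))"
  by (induction xs arbitrary: \<phi>) (simp_all add: sum.lessThan_Suc_shift del: sum.lessThan_Suc)

lemma delta_const: "delta (\<lambda>_. v) xs = of_nat (length xs) * v"
  by (induction xs) (simp_all add: algebra_simps)

text \<open>The Alexander--Whitney product: front face times back face, sharing the vertex at
  position p. The second degree is left to the length of the list.\<close>

definition cup :: "nat \<Rightarrow> ('a list \<Rightarrow> bit) \<Rightarrow> ('a list \<Rightarrow> bit) \<Rightarrow> 'a list \<Rightarrow> bit" where
  "cup p \<phi> \<psi> xs = \<phi> (take (Suc p) xs) * \<psi> (drop p xs)"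

lemma cup_Cons_Suc: "cup (Suc p) \<phi> \<psi> (x # xs) = cup p (\<lambda>ys. \<phi> (x # ys)) \<psi> xs"
  by (simp add: cup_def)

lemma delta_scale: "delta (\<lambda>xs. v * \<phi> xs) zs = v * delta \<phi> zs"
  by (cases v) simp_all

lemma cup_add_left: "cup p (\<lambda>xs. \<phi> xs + \<phi>' xs) \<psi> xs = cup p \<phi> \<psi> xs + cup p \<phi>' \<psi> xs"
  by (simp add: cup_def algebra_simps)

lemma cup_add_right: "cup p \<phi> (\<lambda>xs. \<psi> xs + \<psi>' xs) xs = cup p \<phi> \<psi> xs + cup p \<phi> \<psi>' xs"
  by (simp add: cup_def algebra_simps)

text \<open>The Leibniz rule. Peeling off first vertices reduces it to p = 0, where the term
  \<open>\<phi> [x] * \<psi> (y # zs)\<close> occurs once in each product on the right and cancels.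
  The length guarantees that the front face is complete.\<close>

lemma delta_cup:
  assumes "length xs = Suc (Suc (p + q))"
  shows "delta (cup p \<phi> \<psi>) xs = cup (Suc p) (delta \<phi>) \<psi> xs + cup p \<phi> (delta \<psi>) xs"
  using assms
proof (induction p arbitrary: xs \<phi>)
  case 0
  then obtain x y zs where xs: "xs = x # y # zs"
    by (metis length_Suc_conv)
  have "delta (\<lambda>ys. cup 0 \<phi> \<psi> (x # y # ys)) zs = \<phi> [x] * delta (\<lambda>ys. \<psi> (x # y # ys)) zs"
    by (simp add: cup_def delta_scale)
  then show ?case
    by (simp add: xs cup_def algebra_simps)
next
  case (Suc p)
  then obtain x ys where xs: "xs = x # ys" and len: "length ys = Suc (Suc (p + q))"
    by (cases xs) auto
  have "delta (cup (Suc p) \<phi> \<psi>) xs = cup (Suc p) \<phi> \<psi> ys + delta (cup p (\<lambda>zs. \<phi> (x # zs)) \<psi>) ys"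
    by (simp add: xs cup_Cons_Suc)
  also have "\<dots> = cup (Suc p) \<phi> \<psi> ys +
      (cup (Suc p) (delta (\<lambda>zs. \<phi> (x # zs))) \<psi> ys + cup p (\<lambda>zs. \<phi> (x # zs)) (delta \<psi>) ys)"
    using Suc.IH[OF len] by simp
  also have "\<dots> = cup (Suc (Suc p)) (delta \<phi>) \<psi> xs + cup (Suc p) \<phi> (delta \<psi>) xs"
    by (simp add: xs cup_Cons_Suc cup_add_left ac_simps)
  finally show ?case .
qed

text \<open>The classical prism operator: the sum over i of \<phi> at the tuples (f z_0, ..., f z_i,
  g z_i, ..., g z_n).\<close>

fun prism :: "('a \<Rightarrow> 'b) \<Rightarrow> ('a \<Rightarrow> 'b) \<Rightarrow> ('b list \<Rightarrow> bit) \<Rightarrow> 'a list \<Rightarrow> bit" where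
  "prism f g \<phi> [] = 0"
| "prism f g \<phi> (z # zs) = \<phi> (f z # g z # map g zs) + prism f g (\<lambda>ys. \<phi> (f z # ys)) zs"

lemma prism_add: "prism f g (\<lambda>xs. \<phi> xs + \<psi> xs) zs = prism f g \<phi> zs + prism f g \<psi> zs"
  by (induction zs arbitrary: \<phi> \<psi>) (simp_all add: ac_simps)

lemma prism_eq_0:
  assumes "\<And>xs. length xs = Suc (length zs) \<Longrightarrow> set xs \<subseteq> f ` set zs \<union> g ` set zs \<Longrightarrow> \<phi> xs = 0"
  shows "prism f g \<phi> zs = 0"
  using assms
proof (induction zs arbitrary: \<phi>)
  case (Cons z zs)
  have "prism f g (\<lambda>ys. \<phi> (f z # ys)) zs = 0"
    by (rule Cons.IH) (rule Cons.prems, auto)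
  moreover have "\<phi> (f z # g z # map g zs) = 0"
    by (rule Cons.prems) auto
  ultimately show ?case by simp
qed simp

text \<open>A purely algebraic chain homotopy between arbitrary maps: the inner faces of the prism
  cancel in pairs. Continuity enters only later, to make \<open>prism f g (delta \<phi>)\<close>
  vanish on small tuples.\<close>

lemma delta_prism:
  "delta (prism f g \<phi>) zs + prism f g (delta \<phi>) zs = \<phi> (map f zs) + \<phi> (map g zs)"
proof (induction zs arbitrary: \<phi>)
  case (Cons z zs)
  have "delta (\<lambda>ys. \<phi> (f z # g z # map g ys)) zs = delta (\<lambda>ys. \<phi> (f z # g z # ys)) (map g zs)"
    by (rule delta_map)
  with Cons.IH[of "\<lambda>ys. \<phi> (f z # ys)"] show ?case
    by (simp add: delta_add prism_add ac_simps)
qed simp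

text \<open>Vanishing of the germ along the diagonal. Values on lists outside the space are left
  free, unlike in \<open>AS_locally_zero\<close>, so that cochains restrict to subspaces without
  being modified.\<close>

definition locally_zero :: "nat \<Rightarrow> 'a topology \<Rightarrow> ('a list \<Rightarrow> bit) \<Rightarrow> bool" where
  "locally_zero q X \<phi> \<longleftrightarrow> (\<forall>x\<in>topspace X. \<exists>V. openin X V \<and> x \<in> V \<and>
     (\<forall>xs. length xs = Suc q \<longrightarrow> set xs \<subseteq> V \<longrightarrow> \<phi> xs = 0))"

definition cocycle :: "nat \<Rightarrow> 'a topology \<Rightarrow> ('a list \<Rightarrow> bit) \<Rightarrow> bool" where
  "cocycle q X \<phi> \<longleftrightarrow> locally_zero (Suc q) X (delta \<phi>)"

text \<open>In degree \<open>0\<close> the condition on \<open>\<theta> []\<close> removes the augmentation; in positive degrees \<open>\<theta> []\<close> is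
  irrelevant.\<close>

definition coboundary :: "nat \<Rightarrow> 'a topology \<Rightarrow> ('a list \<Rightarrow> bit) \<Rightarrow> bool" where
  "coboundary q X \<phi> \<longleftrightarrow> (\<exists>\<theta>. \<theta> [] = 0 \<and> locally_zero q X (\<lambda>xs. \<phi> xs + delta \<theta> xs))"

definition reduced_coboundary :: "nat \<Rightarrow> 'a topology \<Rightarrow> ('a list \<Rightarrow> bit) \<Rightarrow> bool" where
  "reduced_coboundary q X \<phi> \<longleftrightarrow> (\<exists>\<theta>. locally_zero q X (\<lambda>xs. \<phi> xs + delta \<theta> xs))"

lemma locally_zeroI:
  assumes "\<And>x. x \<in> topspace X \<Longrightarrow> \<exists>V. openin X V \<and> x \<in> V \<and>
     (\<forall>xs. length xs = Suc q \<longrightarrow> set xs \<subseteq> V \<longrightarrow> \<phi> xs = 0)"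
  shows "locally_zero q X \<phi>"
  using assms by (simp add: locally_zero_def)

lemma locally_zeroE:
  assumes "locally_zero q X \<phi>" "x \<in> topspace X"
  obtains V where "openin X V" "x \<in> V" "\<And>xs. length xs = Suc q \<Longrightarrow> set xs \<subseteq> V \<Longrightarrow> \<phi> xs = 0"
  using assms unfolding locally_zero_def by metis

lemma locally_zero_0 [simp]: "locally_zero q X (\<lambda>_. 0)"
  by (auto simp: locally_zero_def)

lemma locally_zero_add:
  assumes "locally_zero q X \<phi>" "locally_zero q X \<psi>"
  shows "locally_zero q X (\<lambda>xs. \<phi> xs + \<psi> xs)"
proof (rule locally_zeroI)
  fix x assume x: "x \<in> topspace X"
  obtain U where U: "openin X U" "x \<in> U" "\<And>xs. length xs = Suc q \<Longrightarrow> set xs \<subseteq> U \<Longrightarrow> \<phi> xs = 0"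
    using locally_zeroE[OF assms(1) x] by metis
  obtain V where V: "openin X V" "x \<in> V" "\<And>xs. length xs = Suc q \<Longrightarrow> set xs \<subseteq> V \<Longrightarrow> \<psi> xs = 0"
    using locally_zeroE[OF assms(2) x] by metis
  show "\<exists>V. openin X V \<and> x \<in> V \<and>
     (\<forall>xs. length xs = Suc q \<longrightarrow> set xs \<subseteq> V \<longrightarrow> \<phi> xs + \<psi> xs = 0)"
    by (rule exI[of _ "U \<inter> V"]) (use U V in auto)
qed

lemma locally_zero_scale: "locally_zero q X \<phi> \<Longrightarrow> locally_zero q X (\<lambda>xs. v * \<phi> xs)"
  unfolding locally_zero_def by (metis mult_zero_right)

lemma locally_zero_cong:
  assumes "locally_zero q X \<phi>" "\<And>xs. length xs = Suc q \<Longrightarrow> set xs \<subseteq> topspace X \<Longrightarrow> \<psi> xs = \<phi> xs"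
  shows "locally_zero q X \<psi>"
proof (rule locally_zeroI)
  fix x assume "x \<in> topspace X"
  then obtain U where "openin X U" "x \<in> U" "\<And>xs. length xs = Suc q \<Longrightarrow> set xs \<subseteq> U \<Longrightarrow> \<phi> xs = 0"
    using locally_zeroE[OF assms(1)] by metis
  then show "\<exists>V. openin X V \<and> x \<in> V \<and> (\<forall>xs. length xs = Suc q \<longrightarrow> set xs \<subseteq> V \<longrightarrow> \<psi> xs = 0)"
    using assms(2) openin_subset by (metis subset_trans)
qed

lemma locally_zero_delta:
  assumes "locally_zero q X \<phi>"
  shows "locally_zero (Suc q) X (delta \<phi>)"
proof (rule locally_zeroI)
  fix x assume "x \<in> topspace X"
  then obtain U where U: "openin X U" "x \<in> U" "\<And>xs. length xs = Suc q \<Longrightarrow> set xs \<subseteq> U \<Longrightarrow> \<phi> xs = 0"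
    using locally_zeroE[OF assms] by metis
  have "delta \<phi> xs = 0" if "length xs = Suc (Suc q)" "set xs \<subseteq> U" for xs
  proof -
    have "delta \<phi> xs = delta (\<lambda>_. 0) xs"
      by (rule delta_cong) (use that U(3) in auto)
    then show ?thesis by simp
  qed
  with U show "\<exists>V. openin X V \<and> x \<in> V \<and>
      (\<forall>xs. length xs = Suc (Suc q) \<longrightarrow> set xs \<subseteq> V \<longrightarrow> delta \<phi> xs = 0)" by blast
qed

lemma locally_zero_pullback:
  assumes f: "continuous_map X Y f" and "locally_zero q Y \<phi>"
  shows "locally_zero q X (\<lambda>xs. \<phi> (map f xs))"
proof (rule locally_zeroI)
  fix x assume x: "x \<in> topspace X"
  with f have "f x \<in> topspace Y" by (auto simp: continuous_map_def)
  then obtain U where U: "openin Y U" "f x \<in> U" "\<And>xs. length xs = Suc q \<Longrightarrow> set xs \<subseteq> U \<Longrightarrow> \<phi> xs = 0"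
    using locally_zeroE[OF assms(2)] by metis
  have "openin X {x \<in> topspace X. f x \<in> U}"
    using f U(1) by (rule openin_continuous_map_preimage)
  then show "\<exists>V. openin X V \<and> x \<in> V \<and>
      (\<forall>xs. length xs = Suc q \<longrightarrow> set xs \<subseteq> V \<longrightarrow> \<phi> (map f xs) = 0)"
    using U x by (intro exI[of _ "{x \<in> topspace X. f x \<in> U}"]) (auto intro!: U(3))
qed

lemma locally_zero_cup_left:
  assumes "locally_zero p X \<phi>"
  shows "locally_zero (p + q) X (cup p \<phi> \<psi>)"
proof (rule locally_zeroI)
  fix x assume "x \<in> topspace X"
  then obtain U where U: "openin X U" "x \<in> U" "\<And>xs. length xs = Suc p \<Longrightarrow> set xs \<subseteq> U \<Longrightarrow> \<phi> xs = 0"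
    using locally_zeroE[OF assms] by metis
  have "cup p \<phi> \<psi> xs = 0" if "length xs = Suc (p + q)" "set xs \<subseteq> U" for xs
    using that U(3)[of "take (Suc p) xs"] set_take_subset[of "Suc p" xs] by (auto simp: cup_def)
  with U show "\<exists>V. openin X V \<and> x \<in> V \<and>
      (\<forall>xs. length xs = Suc (p + q) \<longrightarrow> set xs \<subseteq> V \<longrightarrow> cup p \<phi> \<psi> xs = 0)" by blast
qed

lemma locally_zero_cup_right:
  assumes "locally_zero q X \<psi>"
  shows "locally_zero (p + q) X (cup p \<phi> \<psi>)"
proof (rule locally_zeroI)
  fix x assume "x \<in> topspace X"
  then obtain U where U: "openin X U" "x \<in> U" "\<And>xs. length xs = Suc q \<Longrightarrow> set xs \<subseteq> U \<Longrightarrow> \<psi> xs = 0"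
    using locally_zeroE[OF assms] by metis
  have "cup p \<phi> \<psi> xs = 0" if "length xs = Suc (p + q)" "set xs \<subseteq> U" for xs
    using that U(3)[of "drop p xs"] set_drop_subset[of p xs] by (auto simp: cup_def)
  with U show "\<exists>V. openin X V \<and> x \<in> V \<and>
      (\<forall>xs. length xs = Suc (p + q) \<longrightarrow> set xs \<subseteq> V \<longrightarrow> cup p \<phi> \<psi> xs = 0)" by blast
qed

lemma coboundary_imp_reduced: "coboundary q X \<phi> \<Longrightarrow> reduced_coboundary q X \<phi>"
  by (auto simp: coboundary_def reduced_coboundary_def)

lemma locally_zero_imp_coboundary: "locally_zero q X \<phi> \<Longrightarrow> coboundary q X \<phi>"
  unfolding coboundary_def by (intro exI[of _ "\<lambda>_. 0"]) simp

lemma coboundary_delta_Suc: "coboundary (Suc q) X (delta \<theta>)"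
proof -
  let ?\<theta> = "\<lambda>xs. if xs = [] then 0 else \<theta> xs"
  have "delta \<theta> xs + delta ?\<theta> xs = 0" if "length xs = Suc (Suc q)" for xs
  proof -
    have "delta ?\<theta> xs = delta \<theta> xs" by (rule delta_cong) (use that in auto)
    then show ?thesis by simp
  qed
  then show ?thesis unfolding coboundary_def
    by (intro exI[of _ ?\<theta>]) (auto intro: locally_zero_cong[OF locally_zero_0])
qed

lemma coboundary_add:
  assumes "coboundary q X \<phi>" "coboundary q X \<psi>"
  shows "coboundary q X (\<lambda>xs. \<phi> xs + \<psi> xs)"
proof -
  obtain \<theta> \<eta> where "\<theta> [] = 0" "\<eta> [] = 0" and
    1: "locally_zero q X (\<lambda>xs. \<phi> xs + delta \<theta> xs)" and 2: "locally_zero q X (\<lambda>xs. \<psi> xs + delta \<eta> xs)"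
    using assms unfolding coboundary_def by metis
  then show ?thesis unfolding coboundary_def
    by (intro exI[of _ "\<lambda>xs. \<theta> xs + \<eta> xs"] conjI locally_zero_cong[OF locally_zero_add[OF 1 2]])
      (simp_all add: delta_add ac_simps)
qed

lemma reduced_coboundary_add:
  assumes "reduced_coboundary q X \<phi>" "reduced_coboundary q X \<psi>"
  shows "reduced_coboundary q X (\<lambda>xs. \<phi> xs + \<psi> xs)"
proof -
  obtain \<theta> \<eta> where
    1: "locally_zero q X (\<lambda>xs. \<phi> xs + delta \<theta> xs)" and 2: "locally_zero q X (\<lambda>xs. \<psi> xs + delta \<eta> xs)"
    using assms unfolding reduced_coboundary_def by metis
  then show ?thesis unfolding reduced_coboundary_def
    by (intro exI[of _ "\<lambda>xs. \<theta> xs + \<eta> xs"] conjI locally_zero_cong[OF locally_zero_add[OF 1 2]])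
      (simp_all add: delta_add ac_simps)
qed

lemma coboundary_cong:
  assumes "coboundary q X \<phi>" "\<And>xs. length xs = Suc q \<Longrightarrow> set xs \<subseteq> topspace X \<Longrightarrow> \<psi> xs = \<phi> xs"
  shows "coboundary q X \<psi>"
  using assms unfolding coboundary_def by (metis (no_types, lifting) locally_zero_cong)

lemma reduced_coboundary_cong:
  assumes "reduced_coboundary q X \<phi>"
    "\<And>xs. length xs = Suc q \<Longrightarrow> set xs \<subseteq> topspace X \<Longrightarrow> \<psi> xs = \<phi> xs"
  shows "reduced_coboundary q X \<psi>"
  using assms unfolding reduced_coboundary_def by (metis (no_types, lifting) locally_zero_cong)

lemma coboundary_pullback:
  assumes f: "continuous_map X Y f" and "coboundary q Y \<phi>"
  shows "coboundary q X (\<lambda>xs. \<phi> (map f xs))"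
proof -
  obtain \<theta> where "\<theta> [] = 0" "locally_zero q Y (\<lambda>xs. \<phi> xs + delta \<theta> xs)"
    using assms unfolding coboundary_def by metis
  with locally_zero_pullback[OF f this(2)] show ?thesis
    unfolding coboundary_def
    by (intro exI[of _ "\<lambda>xs. \<theta> (map f xs)"]) (simp add: delta_map)
qed

lemma cocycle_pullback:
  assumes f: "continuous_map X Y f" and "cocycle q Y \<phi>"
  shows "cocycle q X (\<lambda>xs. \<phi> (map f xs))"
  using locally_zero_pullback[OF f, of "Suc q" "delta \<phi>"] assms(2) unfolding cocycle_def
  by (auto simp: delta_map elim: locally_zero_cong)

lemma cocycle_add: "cocycle q X \<phi> \<Longrightarrow> cocycle q X \<psi> \<Longrightarrow> cocycle q X (\<lambda>xs. \<phi> xs + \<psi> xs)"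
  unfolding cocycle_def using locally_zero_add[of "Suc q" X "delta \<phi>" "delta \<psi>"]
  by (auto simp: delta_add elim: locally_zero_cong)

lemma cocycle_delta: "cocycle q X (delta \<theta>)"
  unfolding cocycle_def by (rule locally_zero_cong[OF locally_zero_0]) simp

lemma cocycle_cong:
  assumes "cocycle q X \<phi>" "\<And>xs. length xs = Suc q \<Longrightarrow> set xs \<subseteq> topspace X \<Longrightarrow> \<psi> xs = \<phi> xs"
  shows "cocycle q X \<psi>"
  unfolding cocycle_def
proof (rule locally_zero_cong)
  show "locally_zero (Suc q) X (delta \<phi>)" using assms(1) by (simp add: cocycle_def)
  show "delta \<psi> xs = delta \<phi> xs" if "length xs = Suc (Suc q)" "set xs \<subseteq> topspace X" for xs
    by (rule delta_cong) (use that assms(2) in auto)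
qed

lemma locally_zero_imp_cocycle: "locally_zero q X \<phi> \<Longrightarrow> cocycle q X \<phi>"
  by (simp add: cocycle_def locally_zero_delta)

lemma reduced_coboundary_imp_cocycle:
  assumes "reduced_coboundary q X \<phi>" shows "cocycle q X \<phi>"
proof -
  obtain \<theta> where \<theta>: "locally_zero q X (\<lambda>xs. \<phi> xs + delta \<theta> xs)"
    using assms unfolding reduced_coboundary_def by metis
  then have "cocycle q X (\<lambda>xs. (\<phi> xs + delta \<theta> xs) + delta \<theta> xs)"
    by (intro cocycle_add locally_zero_imp_cocycle cocycle_delta)
  then show ?thesis by (simp add: add.assoc)
qed

lemma cocycle_cup:
  assumes "cocycle p X \<phi>" "cocycle q X \<psi>"
  shows "cocycle (p + q) X (cup p \<phi> \<psi>)"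
  unfolding cocycle_def
proof (rule locally_zero_cong)
  have "locally_zero (Suc p + q) X (cup (Suc p) (delta \<phi>) \<psi>)"
    using assms by (intro locally_zero_cup_left) (simp add: cocycle_def)
  moreover have "locally_zero (p + Suc q) X (cup p \<phi> (delta \<psi>))"
    using assms by (intro locally_zero_cup_right) (simp add: cocycle_def)
  ultimately show "locally_zero (Suc (p + q)) X
      (\<lambda>xs. cup (Suc p) (delta \<phi>) \<psi> xs + cup p \<phi> (delta \<psi>) xs)"
    by (simp add: locally_zero_add)
qed (simp add: delta_cup)

lemma coboundary_cup_left:
  assumes "coboundary p X \<phi>" "cocycle q X \<psi>"
  shows "coboundary (p + q) X (cup p \<phi> \<psi>)"
proof -
  obtain \<theta> where \<theta>: "\<theta> [] = 0" "locally_zero p X (\<lambda>xs. \<phi> xs + delta \<theta> xs)"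
    using assms unfolding coboundary_def by metis
  have lz: "locally_zero (p + q) X (cup p (\<lambda>xs. \<phi> xs + delta \<theta> xs) \<psi>)"
    by (rule locally_zero_cup_left[OF \<theta>(2)])
  have "coboundary (p + q) X (cup p (delta \<theta>) \<psi>)"
  proof (cases p)
    \<comment> \<open>In degree 0 the coboundary of \<theta> is the constant
      \<open>\<theta> [] = 0\<close>.\<close>
    case 0
    have "cup p (delta \<theta>) \<psi> xs = 0" if "length xs = Suc (p + q)" for xs
      using that \<theta>(1) 0 by (cases xs) (simp_all add: cup_def)
    then show ?thesis
      by (intro locally_zero_imp_coboundary locally_zero_cong[OF locally_zero_0]) simp
  next
    case (Suc p')
    have "locally_zero (p' + Suc q) X (cup p' \<theta> (delta \<psi>))"
      using assms(2) by (intro locally_zero_cup_right) (simp add: cocycle_def)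
    then have "coboundary (p + q) X (\<lambda>xs. delta (cup p' \<theta> \<psi>) xs + cup p' \<theta> (delta \<psi>) xs)"
      using Suc by (intro coboundary_add)
        (simp_all add: coboundary_delta_Suc locally_zero_imp_coboundary)
    then show ?thesis
      by (rule coboundary_cong) (simp add: Suc delta_cup[of _ p' q] add.assoc)
  qed
  with lz have "coboundary (p + q) X
      (\<lambda>xs. cup p (\<lambda>xs. \<phi> xs + delta \<theta> xs) \<psi> xs + cup p (delta \<theta>) \<psi> xs)"
    by (intro coboundary_add) (simp_all add: locally_zero_imp_coboundary)
  then show ?thesis by (rule coboundary_cong) (simp add: cup_add_left add.assoc)
qed

lemma coboundary_cup_right:
  assumes "cocycle p X \<phi>" "coboundary (Suc q) X \<psi>"
  shows "coboundary (p + Suc q) X (cup p \<phi> \<psi>)"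
proof -
  obtain \<theta> where \<theta>: "locally_zero (Suc q) X (\<lambda>xs. \<psi> xs + delta \<theta> xs)"
    using assms unfolding coboundary_def by metis
  have 1: "locally_zero (p + Suc q) X (cup p \<phi> (\<lambda>xs. \<psi> xs + delta \<theta> xs))"
    by (rule locally_zero_cup_right[OF \<theta>])
  have "locally_zero (Suc p + q) X (cup (Suc p) (delta \<phi>) \<theta>)"
    using assms(1) by (intro locally_zero_cup_left) (simp add: cocycle_def)
  then have "coboundary (p + Suc q) X (\<lambda>xs. delta (cup p \<phi> \<theta>) xs + cup (Suc p) (delta \<phi>) \<theta> xs)"
    by (intro coboundary_add) (simp_all add: coboundary_delta_Suc locally_zero_imp_coboundary)
  then have "coboundary (p + Suc q) X (cup p \<phi> (delta \<theta>))"
    by (rule coboundary_cong) (simp add: delta_cup[of _ p q] ac_simps)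
  with 1 have "coboundary (p + Suc q) X
      (\<lambda>xs. cup p \<phi> (\<lambda>xs. \<psi> xs + delta \<theta> xs) xs + cup p \<phi> (delta \<theta>) xs)"
    by (intro coboundary_add) (simp_all add: locally_zero_imp_coboundary)
  then show ?thesis by (rule coboundary_cong) (simp add: cup_add_right add.assoc)
qed

section \<open>Homotopy invariance\<close>

text \<open>By Tychonoff the topology \<open>T\<close> of pointwise convergence is compact, so the
  closures of the tails of the sequence have a common point. Prescribing finitely many values
  defines a neighbourhood of it, which therefore meets every tail.\<close>

lemma finite_agreement_cluster_point:
  fixes \<theta> :: "nat \<Rightarrow> 'a \<Rightarrow> 'b::finite"
  shows "\<exists>\<eta>. \<forall>F N. finite F \<longrightarrow> (\<exists>n\<ge>N. \<forall>y\<in>F. \<eta> y = \<theta> n y)"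
proof -
  define T :: "('a \<Rightarrow> 'b) topology" where "T = product_topology (\<lambda>_. discrete_topology UNIV) UNIV"
  have topT: "topspace T = UNIV" by (simp add: T_def)
  have "compact_space T"
    unfolding T_def compact_space_product_topology
    by (simp add: compact_space_discrete_topology)
  then have "(\<Inter>N. T closure_of (\<theta> ` {N..})) \<noteq> {}"
  proof (rule compact_space_imp_nest)
    show "decseq (\<lambda>N. T closure_of (\<theta> ` {N..}))"
      unfolding decseq_def by (intro allI impI closure_of_mono image_mono) auto
    show "T closure_of (\<theta> ` {N..}) \<noteq> {}" for N
      using closure_of_subset[of "\<theta> ` {N..}" T] by (auto simp: topT)
  qed auto
  then obtain \<eta> where \<eta>: "\<And>N. \<eta> \<in> T closure_of (\<theta> ` {N..})" by blast
  have "\<exists>n\<ge>N. \<forall>y\<in>F. \<eta> y = \<theta> n y" if "finite F" for F N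
  proof -
    have "openin T {\<psi>. \<forall>y\<in>F. \<psi> y = \<eta> y}" using that
    proof (induction F)
      case empty
      then show ?case using openin_topspace[of T] by (simp add: topT)
    next
      case (insert y F)
      have "continuous_map T (discrete_topology UNIV) (\<lambda>\<psi>. \<psi> y)"
        unfolding T_def by (rule continuous_map_product_projection) simp
      then have "openin T {\<psi> \<in> topspace T. \<psi> y \<in> {\<eta> y}}"
        by (rule openin_continuous_map_preimage) simp
      then have "openin T ({\<psi> \<in> topspace T. \<psi> y \<in> {\<eta> y}} \<inter> {\<psi>. \<forall>y\<in>F. \<psi> y = \<eta> y})"
        using insert.IH by (rule openin_Int)
      then show ?case by (rule back_subst[of "openin T"]) (auto simp: topT)
    qed
    then have "\<eta> \<in> {\<psi>. \<forall>y\<in>F. \<psi> y = \<eta> y} \<and> openin T {\<psi>. \<forall>y\<in>F. \<psi> y = \<eta> y}" by simp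
    moreover have "\<forall>U. \<eta> \<in> U \<and> openin T U \<longrightarrow> (\<exists>\<psi>. \<psi> \<in> \<theta> ` {N..} \<and> \<psi> \<in> U)"
      using \<eta>[of N] unfolding in_closure_of by (rule conjunct2)
    ultimately have "\<exists>\<psi>. \<psi> \<in> \<theta> ` {N..} \<and> \<psi> \<in> {\<psi>. \<forall>y\<in>F. \<psi> y = \<eta> y}"
      by (elim allE) (rule mp)
    then obtain n where "n \<ge> N" "\<forall>y\<in>F. \<theta> n y = \<eta> y" by auto
    then show ?thesis by (intro exI[of _ n]) simp
  qed
  then show ?thesis by blast
qed

text \<open>Tube lemma and Lebesgue number: finitely many rectangles cover the segment over z, N is
  the intersection of their bases, and 1/n is below the Lebesgue number of their sides. The bound n0
  depends on z.\<close>

lemma homotopy_uniform_partition: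
  assumes h: "continuous_map (prod_topology (top_of_set {0..1::real}) Z) X h"
    and \<U>: "\<And>x. x \<in> topspace X \<Longrightarrow> \<exists>U\<in>\<U>. openin X U \<and> x \<in> U"
    and z: "z \<in> topspace Z"
  obtains N n0 where "openin Z N" "z \<in> N"
    "\<And>n i. n0 \<le> n \<Longrightarrow> i < n \<Longrightarrow>
       \<exists>U\<in>\<U>. \<forall>y\<in>N. h (real i / real n, y) \<in> U \<and> h (real (Suc i) / real n, y) \<in> U"
proof -
  have "\<exists>W N. open W \<and> t \<in> W \<and> openin Z N \<and> z \<in> N \<and>
      (\<exists>U\<in>\<U>. \<forall>s\<in>W \<inter> {0..1}. \<forall>y\<in>N. h (s, y) \<in> U)" if t: "t \<in> {0..1}" for t
  proof -
    have "(t, z) \<in> topspace (prod_topology (top_of_set {0..1::real}) Z)" using t z by simp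
    with h have "h (t, z) \<in> topspace X" by (auto simp: continuous_map_def)
    then obtain U where U: "U \<in> \<U>" "openin X U" "h (t, z) \<in> U" using \<U> by blast
    have "openin (prod_topology (top_of_set {0..1::real}) Z)
        {p \<in> topspace (prod_topology (top_of_set {0..1::real}) Z). h p \<in> U}"
      using h U(2) by (rule openin_continuous_map_preimage)
    then have rect: "\<forall>s y. (s, y) \<in> {p \<in> topspace (prod_topology (top_of_set {0..1::real}) Z). h p \<in> U} \<longrightarrow>
        (\<exists>W N. openin (top_of_set {0..1::real}) W \<and> openin Z N \<and> s \<in> W \<and> y \<in> N \<and>
          W \<times> N \<subseteq> {p \<in> topspace (prod_topology (top_of_set {0..1::real}) Z). h p \<in> U})"
      by (simp only: openin_prod_topology_alt)
    have "(t, z) \<in> {p \<in> topspace (prod_topology (top_of_set {0..1::real}) Z). h p \<in> U}"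
      using t z U(3) by simp
    from rect[rule_format, OF this] obtain W' N where WN: "openin (top_of_set {0..1::real}) W'" "openin Z N" "t \<in> W'" "z \<in> N"
      "W' \<times> N \<subseteq> {p \<in> topspace (prod_topology (top_of_set {0..1::real}) Z). h p \<in> U}"
      by (elim exE conjE) (rule that)
    then obtain W where W: "open W" "W' = {0..1} \<inter> W" by (auto simp: openin_open)
    have "h (s, y) \<in> U" if "s \<in> W \<inter> {0..1}" "y \<in> N" for s y
    proof -
      have "(s, y) \<in> W' \<times> N" using W(2) that by simp
      with WN(5) show ?thesis by blast
    qed
    then show ?thesis
      by (intro exI[of _ W] exI[of _ N] conjI bexI[of _ U] ballI) (use W WN U(1) in simp_all)
  qed
  then have "\<forall>t\<in>{0..1}. \<exists>p. open (fst p) \<and> t \<in> fst p \<and> openin Z (snd p) \<and> z \<in> snd p \<and>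
      (\<exists>U\<in>\<U>. \<forall>s\<in>fst p \<inter> {0..1}. \<forall>y\<in>snd p. h (s, y) \<in> U)"
    by (metis fst_conv snd_conv)
  then obtain p where p: "\<forall>t\<in>{0..1}. open (fst (p t)) \<and> t \<in> fst (p t) \<and> openin Z (snd (p t)) \<and>
      z \<in> snd (p t) \<and> (\<exists>U\<in>\<U>. \<forall>s\<in>fst (p t) \<inter> {0..1}. \<forall>y\<in>snd (p t). h (s, y) \<in> U)"
    unfolding bchoice_iff by blast
  define W N where "W = (\<lambda>t. fst (p t))" and "N = (\<lambda>t. snd (p t))"
  have W: "\<And>t. t \<in> {0..1} \<Longrightarrow> open (W t)" "\<And>t. t \<in> {0..1} \<Longrightarrow> t \<in> W t"
    and N: "\<And>t. t \<in> {0..1} \<Longrightarrow> openin Z (N t)" "\<And>t. t \<in> {0..1} \<Longrightarrow> z \<in> N t"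
    and WN: "\<And>t. t \<in> {0..1} \<Longrightarrow> \<exists>U\<in>\<U>. \<forall>s\<in>W t \<inter> {0..1}. \<forall>y\<in>N t. h (s, y) \<in> U"
    using p by (simp_all add: W_def N_def)
  have "compact {0..1::real}" by simp
  then obtain C where C: "C \<subseteq> {0..1}" "finite C" "{0..1} \<subseteq> (\<Union>t\<in>C. W t)"
    by (rule compactE_image[of _ "{0..1}" W]) (use W in auto)
  then have "C \<noteq> {}" by auto
  obtain e where e: "e > 0" "\<And>s. s \<in> {0..1} \<Longrightarrow> \<exists>G\<in>W ` C. ball s e \<subseteq> G"
  proof (rule Heine_Borel_lemma[of "{0..1::real}" "W ` C"])
    show "open G" if "G \<in> W ` C" for G using that C(1) W(1) by auto
  qed (use C(3) in simp_all)
  obtain n0 where n0: "inverse (real (Suc n0)) < e" using reals_Archimedean[OF e(1)] by blast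
  show thesis
  proof (rule that[of "\<Inter>t\<in>C. N t" "Suc n0"])
    show "openin Z (\<Inter>t\<in>C. N t)" using C(1,2) N(1) \<open>C \<noteq> {}\<close> by (intro openin_INT2) auto
    show "z \<in> (\<Inter>t\<in>C. N t)" using C(1) N(2) by auto
    fix n i :: nat assume n: "Suc n0 \<le> n" and i: "i < n"
    have i01: "real i / real n \<in> {0..1}" "real (Suc i) / real n \<in> {0..1}" using i by auto
    then obtain t where t: "t \<in> C" "ball (real i / real n) e \<subseteq> W t" using e(2) by blast
    have "real (Suc i) / real n - real i / real n = inverse (real n)"
      using i by (simp add: field_simps)
    moreover have "inverse (real n) \<le> inverse (real (Suc n0))" using n by (intro le_imp_inverse_le) auto
    moreover have "0 < inverse (real n)" using i by simp
    ultimately have "dist (real i / real n) (real (Suc i) / real n) < e"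
      using n0 unfolding dist_real_def by linarith
    then have W2: "real (Suc i) / real n \<in> W t" "real i / real n \<in> W t"
      using t(2) e(1) by (simp_all add: subset_iff)
    have "t \<in> {0..1}" using t(1) C(1) by blast
    then obtain U where U: "U \<in> \<U>" "\<forall>s\<in>W t \<inter> {0..1}. \<forall>y\<in>N t. h (s, y) \<in> U"
      using WN by blast
    have "h (real i / real n, y) \<in> U \<and> h (real (Suc i) / real n, y) \<in> U" if "y \<in> N t" for y
      using U(2) W2 i01 that by blast
    with U(1) t(1) show "\<exists>U\<in>\<U>. \<forall>y\<in>\<Inter>t\<in>C. N t.
        h (real i / real n, y) \<in> U \<and> h (real (Suc i) / real n, y) \<in> U"
      by auto
  qed
qed

text \<open>
  A partition of \<open>[0, 1]\<close> into \<open>n\<close> equal parts gives a chain homotopy \<open>\<theta> n\<close> that works on small tuples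
  near a given point once \<open>n\<close> is large, but no single \<open>n\<close> works near all points. Since the values lie
  in a finite set, a cluster point of the sequence \<open>\<theta> n\<close> (Tychonoff) works everywhere.
\<close>

lemma homotopy_coboundary:
  assumes h: "continuous_map (prod_topology (top_of_set {0..1::real}) Z) X h"
    and c: "cocycle q X c"
  shows "coboundary q Z (\<lambda>zs. c (map (\<lambda>z. h (0, z)) zs) + c (map (\<lambda>z. h (1, z)) zs))"
proof -
  define \<theta> where "\<theta> n zs = (\<Sum>i<n. prism (\<lambda>z. h (real i / real n, z))
    (\<lambda>z. h (real (Suc i) / real n, z)) c zs)" for n zs
  \<comment> \<open>Parity carries the values to \<open>bool\<close>, a type of class
    \<open>finite\<close>; \<eta> translates the cluster point back.\<close>
  have "\<exists>\<eta>. \<forall>F N. finite F \<longrightarrow> (\<exists>n\<ge>N. \<forall>y\<in>F. \<eta> y = odd (\<theta> n y))"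
    by (rule finite_agreement_cluster_point)
  then obtain \<eta>' where \<eta>': "\<And>F N. finite F \<Longrightarrow> \<exists>n\<ge>N. \<forall>y\<in>F. \<eta>' y = odd (\<theta> n y)" by blast
  define \<eta> :: "'a list \<Rightarrow> bit" where "\<eta> y = of_bool (\<eta>' y)" for y
  have \<eta>: "\<exists>n\<ge>N. \<forall>y\<in>F. \<eta> y = \<theta> n y" if "finite F" for F N
    using \<eta>'[OF that, of N] by (fastforce simp: \<eta>_def)
  \<comment> \<open>The prisms over consecutive subintervals telescope, so only the ends 0 and 1
    remain.\<close>
  have delta_\<theta>: "delta (\<theta> n) zs = c (map (\<lambda>z. h (0, z)) zs) + c (map (\<lambda>z. h (1, z)) zs)"
    if n: "n > 0" and small: "\<And>i. i < n \<Longrightarrow> prism (\<lambda>z. h (real i / real n, z))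
      (\<lambda>z. h (real (Suc i) / real n, z)) (delta c) zs = 0" for n zs
  proof -
    define a where "a i = c (map (\<lambda>z. h (real i / real n, z)) zs)" for i
    have "delta (\<lambda>zs. \<Sum>i<m. prism (\<lambda>z. h (real i / real n, z))
        (\<lambda>z. h (real (Suc i) / real n, z)) c zs) zs = a 0 + a m" if "m \<le> n" for m
      using that
    proof (induction m)
      case (Suc m)
      have "delta (prism (\<lambda>z. h (real m / real n, z)) (\<lambda>z. h (real (Suc m) / real n, z)) c) zs
          = a m + a (Suc m)"
        using delta_prism[of "\<lambda>z. h (real m / real n, z)" "\<lambda>z. h (real (Suc m) / real n, z)" c zs]
          small[of m] Suc.prems by (simp add: a_def)
      with Suc show ?case by (simp add: delta_add ac_simps)
    qed simp
    from this[of n] n show ?thesis by (simp add: a_def \<theta>_def[abs_def])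
  qed
  define \<U> where "\<U> = {U. \<forall>xs. length xs = Suc (Suc q) \<longrightarrow> set xs \<subseteq> U \<longrightarrow> delta c xs = 0}"
  have \<U>: "\<exists>U\<in>\<U>. openin X U \<and> x \<in> U" if "x \<in> topspace X" for x
    using c that unfolding cocycle_def locally_zero_def \<U>_def by blast
  have "locally_zero q Z
      (\<lambda>zs. (c (map (\<lambda>z. h (0, z)) zs) + c (map (\<lambda>z. h (1, z)) zs)) + delta \<eta> zs)"
  proof (rule locally_zeroI)
    fix z assume "z \<in> topspace Z"
    from homotopy_uniform_partition[OF h \<U> this] obtain N n0 where N: "openin Z N" "z \<in> N"
      and n0: "\<And>n i. n0 \<le> n \<Longrightarrow> i < n \<Longrightarrow>
       \<exists>U\<in>\<U>. \<forall>y\<in>N. h (real i / real n, y) \<in> U \<and> h (real (Suc i) / real n, y) \<in> U"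
      by metis
    have "(c (map (\<lambda>z. h (0, z)) zs) + c (map (\<lambda>z. h (1, z)) zs)) + delta \<eta> zs = 0"
      if zs: "length zs = Suc q" "set zs \<subseteq> N" for zs
    proof -
      \<comment> \<open>\<open>delta \<eta> zs\<close> involves only these finitely many lists, so
        on them \<eta> may be replaced by some \<open>\<theta> n\<close> with n as large as this
        tuple requires.\<close>
      have "finite {ys. set ys \<subseteq> set zs \<and> length ys = q}"
        by (rule finite_lists_length_eq) simp
      then obtain n where n: "n \<ge> Suc n0"
        and "\<forall>ys\<in>{ys. set ys \<subseteq> set zs \<and> length ys = q}. \<eta> ys = \<theta> n ys"
        using \<eta> by blast
      then have "delta \<eta> zs = delta (\<theta> n) zs"
        using zs by (intro delta_cong) auto
      also have "\<dots> = c (map (\<lambda>z. h (0, z)) zs) + c (map (\<lambda>z. h (1, z)) zs)"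
      proof (rule delta_\<theta>)
        fix i assume "i < n"
        with n n0[of n i] obtain U where U: "U \<in> \<U>"
          "\<forall>y\<in>N. h (real i / real n, y) \<in> U \<and> h (real (Suc i) / real n, y) \<in> U" by auto
        show "prism (\<lambda>z. h (real i / real n, z)) (\<lambda>z. h (real (Suc i) / real n, z)) (delta c) zs = 0"
        proof (rule prism_eq_0)
          fix xs assume "length xs = Suc (length zs)" "set xs \<subseteq> (\<lambda>z. h (real i / real n, z)) ` set zs \<union>
            (\<lambda>z. h (real (Suc i) / real n, z)) ` set zs"
          then have "length xs = Suc (Suc q)" "set xs \<subseteq> U" using U(2) zs by auto
          with U(1) show "delta c xs = 0" by (auto simp: \<U>_def)
        qed
      qed (use n in simp)
      finally show ?thesis by simp
    qed
    with N show "\<exists>V. openin Z V \<and> z \<in> V \<and> (\<forall>zs. length zs = Suc q \<longrightarrow> set zs \<subseteq> V \<longrightarrow>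
        (c (map (\<lambda>z. h (0, z)) zs) + c (map (\<lambda>z. h (1, z)) zs)) + delta \<eta> zs = 0)"
      by blast
  qed
  \<comment> \<open>Every prism vanishes on the empty list, hence so does the cluster point; this
    makes the coboundary an unreduced one.\<close>
  moreover have "\<eta> [] = 0" using \<eta>[of "{[]}" 0] by (auto simp: \<theta>_def)
  ultimately show ?thesis unfolding coboundary_def by blast
qed

text \<open>The pullback has a constant value v. The cocycle condition at the tuple (x, ..., x)
  reads (q + 2) v = 0, so v = (q + 1) v, which is the coboundary of the constant v. In degree 0 this
  uses the augmentation.\<close>

lemma constant_map_reduced_coboundary:
  assumes "cocycle q X c" "x \<in> topspace X"
  shows "reduced_coboundary q Z (\<lambda>zs. c (map (\<lambda>_. x) zs))"
proof -
  define v where "v = c (replicate (Suc q) x)"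
  obtain V where V: "openin X V" "x \<in> V"
    "\<And>xs. length xs = Suc (Suc q) \<Longrightarrow> set xs \<subseteq> V \<Longrightarrow> delta c xs = 0"
    using locally_zeroE[OF assms(1)[unfolded cocycle_def] assms(2)] by metis
  have "delta c (replicate (Suc (Suc q)) x) = 0"
    by (rule V(3)) (use V(2) in auto)
  moreover have "delta c (replicate (Suc (Suc q)) x) = delta (\<lambda>_. v) (replicate (Suc (Suc q)) x)"
  proof (rule delta_cong)
    fix ys assume ys: "Suc (length ys) = length (replicate (Suc (Suc q)) x)"
      "set ys \<subseteq> set (replicate (Suc (Suc q)) x)"
    then have "replicate (length ys) x = ys" by (intro replicate_length_same) auto
    with ys show "c ys = v" by (simp add: v_def del: replicate_Suc)
  qed
  ultimately have *: "of_nat (Suc (Suc q)) * v = 0" by (simp only: delta_const length_replicate)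
  have "v + delta (\<lambda>_. v) zs = 0" if "length zs = Suc q" for zs :: "'b list"
  proof -
    have "v + of_nat (Suc q) * v = of_nat (Suc (Suc q)) * v"
      by (simp only: of_nat_Suc[of "Suc q"] distrib_right mult_1)
    with * that show ?thesis by (simp only: delta_const)
  qed
  moreover have "c (map (\<lambda>_. x) zs) = v" if "length zs = Suc q" for zs :: "'b list"
    using that by (simp add: v_def map_replicate_const del: replicate_Suc)
  ultimately show ?thesis unfolding reduced_coboundary_def
    by (intro exI[of _ "\<lambda>_. v"] locally_zero_cong[OF locally_zero_0]) simp
qed

lemma homotopy_reduced_coboundary:
  assumes h: "continuous_map (prod_topology (top_of_set {0..1::real}) Z) X h"
    and c: "cocycle q X c"
    and 1: "reduced_coboundary q Z (\<lambda>zs. c (map (\<lambda>z. h (1, z)) zs))"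
  shows "reduced_coboundary q Z (\<lambda>zs. c (map (\<lambda>z. h (0, z)) zs))"
proof -
  have "reduced_coboundary q Z (\<lambda>zs. c (map (\<lambda>z. h (0, z)) zs) + c (map (\<lambda>z. h (1, z)) zs))"
    by (rule coboundary_imp_reduced) (rule homotopy_coboundary[OF h c])
  then have "reduced_coboundary q Z (\<lambda>zs. (c (map (\<lambda>z. h (0, z)) zs) + c (map (\<lambda>z. h (1, z)) zs))
      + c (map (\<lambda>z. h (1, z)) zs))"
    using 1 by (rule reduced_coboundary_add)
  then show ?thesis
    by (simp only: add.assoc bit_add_self add_0_right)
qed

section \<open>Double coverings\<close>

lemma topspace_orbit_space [simp]: "topspace (orbit_space \<tau> X) = orbit_pair \<tau> ` topspace X"
proof
  show "topspace (orbit_space \<tau> X) \<subseteq> orbit_pair \<tau> ` topspace X"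
    using openin_topspace[of "orbit_space \<tau> X"] unfolding openin_orbit_space by blast
  have "{x \<in> topspace X. orbit_pair \<tau> x \<in> orbit_pair \<tau> ` topspace X} = topspace X" by blast
  then have "openin (orbit_space \<tau> X) (orbit_pair \<tau> ` topspace X)"
    unfolding openin_orbit_space by simp
  then show "orbit_pair \<tau> ` topspace X \<subseteq> topspace (orbit_space \<tau> X)" by (rule openin_subset)
qed

lemma continuous_map_orbit_pair: "continuous_map X (orbit_space \<tau> X) (orbit_pair \<tau>)"
  unfolding continuous_map_def by (auto simp: openin_orbit_space)

section \<open>Powers of a class of degree one\<close>

fun cup_power :: "('a list \<Rightarrow> bit) \<Rightarrow> nat \<Rightarrow> 'a list \<Rightarrow> bit" where
  "cup_power w 0 = (\<lambda>_. 1)"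
| "cup_power w (Suc n) = cup n (cup_power w n) w"

lemma cup_map: "cup p \<phi> \<psi> (map f xs) = cup p (\<lambda>xs. \<phi> (map f xs)) (\<lambda>xs. \<psi> (map f xs)) xs"
  by (simp add: cup_def take_map drop_map)

lemma cup_power_map: "cup_power w n (map f xs) = cup_power (\<lambda>xs. w (map f xs)) n xs"
  by (induction n arbitrary: xs) (simp_all add: cup_def take_map drop_map)

lemma cocycle_cup_power: "cocycle 1 X w \<Longrightarrow> cocycle n X (cup_power w n)"
proof (induction n)
  case 0
  have "delta (\<lambda>_. 1) xs = 0" if "length xs = Suc (Suc 0)" for xs :: "'a list"
    using that by (simp add: delta_const)
  then show ?case unfolding cocycle_def by (intro locally_zero_cong[OF locally_zero_0]) simp
next
  case (Suc n)
  then show ?case using cocycle_cup[of n X "cup_power w n" 1 w] by simp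
qed

text \<open>One factor is exchanged at a time: modulo 2, w^(n+1) + w'^(n+1) = (w^n + w'^n) w + w'^n
  (w + w').\<close>

lemma cup_power_cohomologous:
  assumes w: "cocycle 1 X w" and w': "cocycle 1 X w'" and ww': "coboundary 1 X (\<lambda>xs. w xs + w' xs)"
  shows "coboundary n X (\<lambda>xs. cup_power w n xs + cup_power w' n xs)"
proof (induction n)
  case 0
  then show ?case by (simp add: locally_zero_imp_coboundary)
next
  case (Suc n)
  have "coboundary (n + 1) X (cup n (\<lambda>xs. cup_power w n xs + cup_power w' n xs) w)"
    using Suc w by (rule coboundary_cup_left)
  moreover have "coboundary (n + Suc 0) X (cup n (cup_power w' n) (\<lambda>xs. w xs + w' xs))"
    using cocycle_cup_power[OF w'] ww' by (intro coboundary_cup_right) simp_all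
  ultimately have "coboundary (Suc n) X (\<lambda>xs. cup n (\<lambda>xs. cup_power w n xs + cup_power w' n xs) w xs
      + cup n (cup_power w' n) (\<lambda>xs. w xs + w' xs) xs)"
    by (intro coboundary_add) simp_all
  then show ?case
    by (rule coboundary_cong) (simp add: cup_add_left cup_add_right ac_simps)
qed

text \<open>
  A double covering \<open>p : X \<rightarrow> P = X / \<tau>\<close> together with a representative \<open>w\<close> of its characteristic class:
  \<open>\<sigma>\<close> labels the two points of each fibre, and \<open>p\<^sup>* w\<close> is locally the coboundary of \<open>\<sigma>\<close>.
\<close>

locale double_cover =
  fixes X :: "'a topology" and \<tau> :: "'a \<Rightarrow> 'a" and w :: "'a set list \<Rightarrow> bit" and \<sigma> :: "'a \<Rightarrow> bit"
  assumes tau_cont: "continuous_map X X \<tau>"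
    and tau_tau: "x \<in> topspace X \<Longrightarrow> \<tau> (\<tau> x) = x"
    and sigma_tau: "x \<in> topspace X \<Longrightarrow> \<sigma> (\<tau> x) = 1 + \<sigma> x"
    and sheets: "x \<in> topspace X \<Longrightarrow> \<exists>V. openin X V \<and> x \<in> V \<and>
      (\<forall>a\<in>V. \<forall>b\<in>V. w [orbit_pair \<tau> a, orbit_pair \<tau> b] = \<sigma> a + \<sigma> b)"
begin

abbreviation p :: "'a \<Rightarrow> 'a set" where "p \<equiv> orbit_pair \<tau>"
abbreviation P :: "'a set topology" where "P \<equiv> orbit_space \<tau> X"

text \<open>Such a set meets each fibre at most once: if a and \<open>\<tau> a\<close> were both in
  V, then \<open>w [p a, p a]\<close> would be 0 as well as 1.\<close>

definition sheet :: "'a set \<Rightarrow> bool" where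
  "sheet V \<longleftrightarrow> V \<subseteq> topspace X \<and> (\<forall>a\<in>V. \<forall>b\<in>V. w [p a, p b] = \<sigma> a + \<sigma> b)"

lemma ex_sheet: "x \<in> topspace X \<Longrightarrow> \<exists>V. openin X V \<and> x \<in> V \<and> sheet V"
  using sheets openin_subset unfolding sheet_def by metis

lemma tau_in: "x \<in> topspace X \<Longrightarrow> \<tau> x \<in> topspace X"
  using tau_cont by (auto simp: continuous_map_def)

lemma p_tau: "x \<in> topspace X \<Longrightarrow> p (\<tau> x) = p x"
  by (auto simp: orbit_pair_def tau_tau)

lemma p_eq_iff: "x \<in> topspace X \<Longrightarrow> p y = p x \<Longrightarrow> y = x \<or> y = \<tau> x"
  by (auto simp: orbit_pair_def doubleton_eq_iff)

text \<open>The saturation of V is the union of V and its preimage under \<tau>, both open.\<close>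

lemma openin_image_p:
  assumes "openin X V" shows "openin P (p ` V)"
proof -
  have V: "V \<subseteq> topspace X" using assms by (rule openin_subset)
  have "{x \<in> topspace X. p x \<in> p ` V} = V \<union> {x \<in> topspace X. \<tau> x \<in> V}"
  proof (intro subset_antisym subsetI)
    fix x assume "x \<in> {x \<in> topspace X. p x \<in> p ` V}"
    then obtain v where v: "x \<in> topspace X" "v \<in> V" "p x = p v" by auto
    with V p_eq_iff[of v x] have "x = v \<or> x = \<tau> v" by blast
    with v V show "x \<in> V \<union> {x \<in> topspace X. \<tau> x \<in> V}" using tau_tau[of v] by auto
  next
    fix x assume "x \<in> V \<union> {x \<in> topspace X. \<tau> x \<in> V}"
    then show "x \<in> {x \<in> topspace X. p x \<in> p ` V}"
      using V p_tau[of x] by (auto intro: image_eqI[of _ p "\<tau> x"])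
  qed
  moreover have "openin X {x \<in> topspace X. \<tau> x \<in> V}"
    using tau_cont assms by (rule openin_continuous_map_preimage)
  ultimately show ?thesis using assms V by (auto simp: openin_orbit_space)
qed

lemma locally_zero_PI:
  assumes "locally_zero q X (\<lambda>vs. \<phi> (map p vs))"
  shows "locally_zero q P \<phi>"
proof (rule locally_zeroI)
  fix y assume "y \<in> topspace P"
  then obtain x where x: "x \<in> topspace X" "y = p x" by auto
  then obtain V where V: "openin X V" "x \<in> V"
    "\<And>vs. length vs = Suc q \<Longrightarrow> set vs \<subseteq> V \<Longrightarrow> \<phi> (map p vs) = 0"
    using locally_zeroE[OF assms] by metis
  have "\<phi> ys = 0" if ys: "length ys = Suc q" "set ys \<subseteq> p ` V" for ys
  proof -
    have "ys \<in> lists (p ` V)" using ys by auto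
    then obtain vs where "ys = map p vs" "vs \<in> lists V" unfolding lists_image by blast
    with ys V(3)[of vs] show ?thesis by auto
  qed
  then show "\<exists>U. openin P U \<and> y \<in> U \<and> (\<forall>ys. length ys = Suc q \<longrightarrow> set ys \<subseteq> U \<longrightarrow> \<phi> ys = 0)"
    using openin_image_p[OF V(1)] V(2) x(2) by blast
qed

lemma locally_zero_pullback_p: "locally_zero q P \<phi> \<Longrightarrow> locally_zero q X (\<lambda>vs. \<phi> (map p vs))"
  by (rule locally_zero_pullback[OF continuous_map_orbit_pair])

lemma locally_zero_sheetI:
  assumes "\<And>V vs. sheet V \<Longrightarrow> set vs \<subseteq> V \<Longrightarrow> length vs = Suc q \<Longrightarrow> \<phi> vs = 0"
  shows "locally_zero q X \<phi>"
proof (rule locally_zeroI)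
  fix x assume "x \<in> topspace X"
  then obtain V where "openin X V" "x \<in> V" "sheet V" using ex_sheet by blast
  with assms show "\<exists>V. openin X V \<and> x \<in> V \<and>
      (\<forall>xs. length xs = Suc q \<longrightarrow> set xs \<subseteq> V \<longrightarrow> \<phi> xs = 0)" by blast
qed

lemma cocycle_w: "cocycle 1 P w"
  unfolding cocycle_def
proof (intro locally_zero_PI locally_zero_sheetI)
  fix V vs assume V: "sheet V" "set vs \<subseteq> V" and "length vs = Suc (Suc 1)"
  then obtain a b c where "vs = [a, b, c]"
    by (auto simp: length_Suc_conv)
  with V show "delta w (map p vs) = 0" by (simp add: sheet_def ac_simps)
qed

subsection \<open>Transfer\<close>

definition lift :: "'a set \<Rightarrow> bit \<Rightarrow> 'a" where
  "lift y b = (SOME x. x \<in> topspace X \<and> p x = y \<and> \<sigma> x = b)"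

text \<open>The point labelled b over the first vertex selects a sheet, and
  \<open>w [hd ys, y]\<close> tells whether the point over y in that sheet has the same label. On
  tuples that do not come from one sheet the value is arbitrary.\<close>

definition lift_list :: "bit \<Rightarrow> 'a set list \<Rightarrow> 'a list" where
  "lift_list b ys = map (\<lambda>y. lift y (b + w [hd ys, y])) ys"

definition transfer :: "('a list \<Rightarrow> bit) \<Rightarrow> 'a set list \<Rightarrow> bit" where
  "transfer \<psi> ys = \<psi> (lift_list 0 ys) + \<psi> (lift_list 1 ys)"

lemma lift_p:
  assumes x: "x \<in> topspace X"
  shows "lift (p x) b = (if b = \<sigma> x then x else \<tau> x)"
  unfolding lift_def
proof (rule some_equality)
  show "(if b = \<sigma> x then x else \<tau> x) \<in> topspace X \<and> p (if b = \<sigma> x then x else \<tau> x) = p x \<and>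
      \<sigma> (if b = \<sigma> x then x else \<tau> x) = b"
    using x by (cases b; cases "\<sigma> x") (simp_all add: tau_in p_tau sigma_tau)
  fix y assume y: "y \<in> topspace X \<and> p y = p x \<and> \<sigma> y = b"
  with x have "y = x \<or> y = \<tau> x" by (intro p_eq_iff) auto
  then show "y = (if b = \<sigma> x then x else \<tau> x)"
    using y x sigma_tau[OF x] by (cases "\<sigma> x") auto
qed

lemma lift_list_sheet:
  assumes V: "sheet V" "set vs \<subseteq> V"
  shows "lift_list b (map p vs) = (if vs = [] then [] else if b = \<sigma> (hd vs) then vs else map \<tau> vs)"
proof (cases vs)
  case Nil
  then show ?thesis by (simp add: lift_list_def)
next
  case (Cons v vs')
  have "lift (p x) (b + w [p v, p x]) = (if b = \<sigma> v then x else \<tau> x)" if "x \<in> set vs" for x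
  proof -
    have "x \<in> topspace X" "w [p v, p x] = \<sigma> v + \<sigma> x" using V that Cons by (auto simp: sheet_def)
    then show ?thesis by (cases b; cases "\<sigma> v"; cases "\<sigma> x") (simp_all add: lift_p)
  qed
  then have "lift_list b (map p vs) = map (\<lambda>x. if b = \<sigma> v then x else \<tau> x) vs"
    by (simp add: lift_list_def Cons)
  then show ?thesis by (simp add: Cons)
qed

lemma transfer_sheet:
  assumes "sheet V" "set vs \<subseteq> V"
  shows "transfer \<psi> (map p vs) = \<psi> vs + \<psi> (map \<tau> vs)"
  by (cases "\<sigma> (hd vs)") (simp_all add: transfer_def lift_list_sheet[OF assms] add.commute)

text \<open>Both lifts of the empty list coincide and cancel. Thus the transfer kills augmentation
  constants and turns reduced coboundaries into ordinary ones.\<close>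

lemma transfer_Nil [simp]: "transfer \<psi> [] = 0"
  by (simp add: transfer_def lift_list_def)

lemma transfer_add: "transfer (\<lambda>vs. \<phi> vs + \<psi> vs) ys = transfer \<phi> ys + transfer \<psi> ys"
  by (simp add: transfer_def ac_simps)

text \<open>\<open>lift_list\<close> refers to the first vertex, so lifting commutes with the
  deletion of vertices only on tuples coming from one sheet. There the transfer is the plain sum
  over a tuple and its \<tau>-image.\<close>

lemma delta_transfer_sheet:
  assumes "sheet V" "set vs \<subseteq> V"
  shows "delta (transfer \<psi>) (map p vs) = transfer (delta \<psi>) (map p vs)"
proof -
  have "delta (transfer \<psi>) (map p vs) = delta (\<lambda>vs. transfer \<psi> (map p vs)) vs"
    by (simp add: delta_map)
  also have "\<dots> = delta (\<lambda>vs. \<psi> vs + \<psi> (map \<tau> vs)) vs"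
    by (rule delta_cong) (use assms in \<open>auto intro!: transfer_sheet\<close>)
  also have "\<dots> = delta \<psi> vs + delta \<psi> (map \<tau> vs)"
    by (simp add: delta_add delta_map)
  finally show ?thesis by (simp add: transfer_sheet[OF assms])
qed

lemma locally_zero_transfer:
  assumes "locally_zero q X \<psi>" shows "locally_zero q P (transfer \<psi>)"
proof (rule locally_zero_PI)
  have "locally_zero q X (\<lambda>vs. \<psi> vs + \<psi> (map \<tau> vs))"
    by (intro locally_zero_add assms locally_zero_pullback[OF tau_cont])
  moreover have "locally_zero q X (\<lambda>vs. transfer \<psi> (map p vs) + (\<psi> vs + \<psi> (map \<tau> vs)))"
    by (rule locally_zero_sheetI) (simp add: transfer_sheet)
  ultimately have "locally_zero q X (\<lambda>vs. (transfer \<psi> (map p vs) + (\<psi> vs + \<psi> (map \<tau> vs)))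
      + (\<psi> vs + \<psi> (map \<tau> vs)))" by (rule locally_zero_add[rotated])
  then show "locally_zero q X (\<lambda>vs. transfer \<psi> (map p vs))"
    by (simp only: add.assoc[of "transfer \<psi> _"] bit_add_self add_0_right)
qed

lemma map_p_tau: "set vs \<subseteq> topspace X \<Longrightarrow> map (p \<circ> \<tau>) vs = map p vs"
  by (auto simp: p_tau)

subsection \<open>The Gysin sequence\<close>

text \<open>The transfer maps \<open>lift_cochain m \<phi>\<close> to \<open>\<phi>\<close>.\<close>

definition lift_cochain :: "nat \<Rightarrow> ('a set list \<Rightarrow> bit) \<Rightarrow> 'a list \<Rightarrow> bit" where
  "lift_cochain m \<phi> = cup m (\<lambda>vs. \<phi> (map p vs)) (\<lambda>vs. \<sigma> (hd vs))"

text \<open>The second factor is the label of the last vertex; over the two lifts its values add up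
  to 1.\<close>

lemma lift_cochain_tau:
  assumes "length vs = Suc m" "set vs \<subseteq> topspace X"
  shows "lift_cochain m \<phi> vs + lift_cochain m \<phi> (map \<tau> vs) = \<phi> (map p vs)"
proof -
  have "hd (drop m vs) \<in> topspace X"
    using assms by (simp add: hd_drop_conv_nth subset_iff)
  then have "\<sigma> (hd (drop m (map \<tau> vs))) = 1 + \<sigma> (hd (drop m vs))"
    using assms by (simp add: hd_drop_conv_nth sigma_tau)
  moreover have "map p (map \<tau> vs) = map p vs"
    using map_p_tau[OF assms(2)] by (simp only: map_map)
  ultimately show ?thesis using assms(1)
    by (simp add: lift_cochain_def cup_def distrib_left ac_simps del: map_map)
qed

text \<open>Leibniz rule: \<phi> is locally closed, and the coboundary of the labelling is locally
  the pullback of w. Hence the connecting map of the Gysin sequence is the product with w.\<close>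

lemma delta_lift_cochain:
  assumes \<phi>: "cocycle m P \<phi>"
  shows "locally_zero (Suc m) X (\<lambda>vs. delta (lift_cochain m \<phi>) vs + cup m \<phi> w (map p vs))"
proof -
  have "locally_zero (Suc m) X (\<lambda>vs. delta \<phi> (map p vs))"
    using \<phi> unfolding cocycle_def by (rule locally_zero_pullback_p)
  then have "locally_zero (Suc m + 0) X (cup (Suc m) (\<lambda>vs. delta \<phi> (map p vs)) (\<lambda>vs. \<sigma> (hd vs)))"
    by (rule locally_zero_cup_left)
  moreover have "locally_zero 1 X (\<lambda>vs. delta (\<lambda>vs. \<sigma> (hd vs)) vs + w (map p vs))"
  proof (rule locally_zero_sheetI)
    fix V vs assume V: "sheet V" "set vs \<subseteq> V" and "length vs = Suc 1"
    then obtain a b where "vs = [a, b]" by (auto simp: length_Suc_conv)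
    with V show "delta (\<lambda>vs. \<sigma> (hd vs)) vs + w (map p vs) = 0"
      by (simp add: sheet_def ac_simps)
  qed
  then have "locally_zero (m + 1) X
      (cup m (\<lambda>vs. \<phi> (map p vs)) (\<lambda>vs. delta (\<lambda>vs. \<sigma> (hd vs)) vs + w (map p vs)))"
    by (rule locally_zero_cup_right)
  ultimately have "locally_zero (Suc m) X (\<lambda>vs.
      cup (Suc m) (\<lambda>vs. delta \<phi> (map p vs)) (\<lambda>vs. \<sigma> (hd vs)) vs +
      cup m (\<lambda>vs. \<phi> (map p vs)) (\<lambda>vs. delta (\<lambda>vs. \<sigma> (hd vs)) vs + w (map p vs)) vs)"
    by (intro locally_zero_add) simp_all
  then show ?thesis
  proof (rule locally_zero_cong)
    fix vs :: "'a list" assume "length vs = Suc (Suc m)"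
    then have "delta (lift_cochain m \<phi>) vs = cup (Suc m) (delta (\<lambda>vs. \<phi> (map p vs))) (\<lambda>vs. \<sigma> (hd vs)) vs
        + cup m (\<lambda>vs. \<phi> (map p vs)) (delta (\<lambda>vs. \<sigma> (hd vs))) vs"
      unfolding lift_cochain_def by (intro delta_cup[where q = 0]) simp
    moreover have "delta (\<lambda>vs. \<phi> (map p vs)) = (\<lambda>vs. delta \<phi> (map p vs))"
      by (rule ext) (rule delta_map)
    ultimately show "delta (lift_cochain m \<phi>) vs + cup m \<phi> w (map p vs) =
      cup (Suc m) (\<lambda>vs. delta \<phi> (map p vs)) (\<lambda>vs. \<sigma> (hd vs)) vs +
      cup m (\<lambda>vs. \<phi> (map p vs)) (\<lambda>vs. delta (\<lambda>vs. \<sigma> (hd vs)) vs + w (map p vs)) vs"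
      by (simp add: cup_add_right cup_map add.assoc)
  qed
qed

text \<open>If the product of \<phi> and w is the coboundary of \<eta>, adding the pullback of
  \<eta> closes the lifted cochain. The transfer remains \<phi>, since a pullback is counted
  twice.\<close>

lemma gysin_lift:
  assumes \<phi>: "cocycle m P \<phi>" and "coboundary (Suc m) P (cup m \<phi> w)"
  obtains \<eta> where "cocycle m X (\<lambda>vs. lift_cochain m \<phi> vs + \<eta> (map p vs))"
proof -
  obtain \<eta> where "locally_zero (Suc m) P (\<lambda>ys. cup m \<phi> w ys + delta \<eta> ys)"
    using assms(2) unfolding coboundary_def by metis
  then have "locally_zero (Suc m) X (\<lambda>vs. cup m \<phi> w (map p vs) + delta \<eta> (map p vs))"
    by (rule locally_zero_pullback_p)
  with delta_lift_cochain[OF \<phi>] have "locally_zero (Suc m) X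
      (\<lambda>vs. (delta (lift_cochain m \<phi>) vs + cup m \<phi> w (map p vs)) +
        (cup m \<phi> w (map p vs) + delta \<eta> (map p vs)))"
    by (rule locally_zero_add)
  then have "cocycle m X (\<lambda>vs. lift_cochain m \<phi> vs + \<eta> (map p vs))"
    unfolding cocycle_def by (rule locally_zero_cong) (simp add: delta_add delta_map add.assoc)
  then show thesis by (rule that)
qed

text \<open>Apply the transfer: the cochain goes to \<phi>, and its primitive \<theta> to a
  primitive on P. Even a reduced primitive yields an unreduced one, because
  \<open>transfer \<theta> [] = 0\<close>.\<close>

lemma gysin_descend:
  assumes "reduced_coboundary m X (\<lambda>vs. lift_cochain m \<phi> vs + \<eta> (map p vs))"
  shows "coboundary m P \<phi>"
proof -
  obtain \<theta> where "locally_zero m X (\<lambda>vs. lift_cochain m \<phi> vs + \<eta> (map p vs) + delta \<theta> vs)"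
    using assms unfolding reduced_coboundary_def by metis
  then have "locally_zero m P (transfer (\<lambda>vs. lift_cochain m \<phi> vs + \<eta> (map p vs) + delta \<theta> vs))"
    by (rule locally_zero_transfer)
  then have 1: "locally_zero m X (\<lambda>vs. transfer (\<lambda>vs. lift_cochain m \<phi> vs + \<eta> (map p vs) + delta \<theta> vs) (map p vs))"
    by (rule locally_zero_pullback_p)
  have 2: "locally_zero m X (\<lambda>vs. transfer (\<lambda>vs. lift_cochain m \<phi> vs + \<eta> (map p vs) + delta \<theta> vs) (map p vs)
      + (\<phi> (map p vs) + delta (transfer \<theta>) (map p vs)))"
  proof (rule locally_zero_sheetI)
    fix V vs assume V: "sheet V" "set vs \<subseteq> V" and len: "length vs = Suc m"
    then have vs: "set vs \<subseteq> topspace X" by (auto simp: sheet_def)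
    have "transfer (lift_cochain m \<phi>) (map p vs) = \<phi> (map p vs)"
      using V len vs by (simp add: transfer_sheet lift_cochain_tau)
    moreover have "transfer (\<lambda>vs. \<eta> (map p vs)) (map p vs) = 0"
      by (simp only: transfer_sheet[OF V] map_map map_p_tau[OF vs] bit_add_self)
    ultimately show "transfer (\<lambda>vs. lift_cochain m \<phi> vs + \<eta> (map p vs) + delta \<theta> vs) (map p vs)
      + (\<phi> (map p vs) + delta (transfer \<theta>) (map p vs)) = 0"
      by (simp add: transfer_add delta_transfer_sheet[OF V])
  qed
  have "locally_zero m X (\<lambda>vs. \<phi> (map p vs) + delta (transfer \<theta>) (map p vs))"
    using locally_zero_add[OF 1 2] by (simp only: bit_add_self_left)
  then have "locally_zero m P (\<lambda>ys. \<phi> ys + delta (transfer \<theta>) ys)"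
    by (rule locally_zero_PI)
  then show ?thesis unfolding coboundary_def by (intro exI[of _ "transfer \<theta>"]) simp
qed

subsection \<open>Acyclic total space\<close>

text \<open>If w^(n+1) were a coboundary, w^n would be the transfer of a cocycle on X, which is a
  reduced coboundary, so w^n would be a coboundary too. The descent ends at the class 1, nonzero
  because X is not empty.\<close>

lemma cup_power_not_coboundary:
  assumes acyclic: "\<And>q c. cocycle q X c \<Longrightarrow> reduced_coboundary q X c" and "topspace X \<noteq> {}"
  shows "\<not> coboundary n P (cup_power w n)"
proof (induction n)
  case 0
  show ?case
  proof
    assume "coboundary 0 P (cup_power w 0)"
    then obtain \<theta> where \<theta>: "\<theta> [] = 0" "locally_zero 0 P (\<lambda>ys. 1 + delta \<theta> ys)"
      by (auto simp: coboundary_def)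
    obtain x where "x \<in> topspace X" using assms(2) by blast
    then have "p x \<in> topspace P" by simp
    from locally_zeroE[OF \<theta>(2) this] obtain V where "p x \<in> V"
      "\<And>ys. length ys = Suc 0 \<Longrightarrow> set ys \<subseteq> V \<Longrightarrow> 1 + delta \<theta> ys = 0" by metis
    from this(2)[of "[p x]"] this(1) \<theta>(1) show False by simp
  qed
next
  case (Suc n)
  show ?case
  proof
    assume "coboundary (Suc n) P (cup_power w (Suc n))"
    then obtain \<eta> where "cocycle n X (\<lambda>vs. lift_cochain n (cup_power w n) vs + \<eta> (map p vs))"
      using gysin_lift[OF cocycle_cup_power[OF cocycle_w]] by (metis cup_power.simps(2))
    then have "coboundary n P (cup_power w n)" by (intro gysin_descend acyclic)
    with Suc show False ..
  qed
qed

text \<open>The pullback of \<phi> is the coboundary of some \<theta>, whose transfer is a cocycle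
  one degree lower, hence \<epsilon> w^q up to a coboundary by induction. Correcting \<theta> makes
  its transfer vanish; then it descends to P and shows that \<phi> is cohomologous to \<epsilon>
  w^(q+1).\<close>

lemma cocycle_eq_cup_power:
  assumes acyclic: "\<And>q c. cocycle q X c \<Longrightarrow> reduced_coboundary q X c"
  shows "cocycle q P \<phi> \<Longrightarrow> \<exists>\<epsilon>. coboundary q P (\<lambda>ys. \<phi> ys + \<epsilon> * cup_power w q ys)"
proof (induction q arbitrary: \<phi>)
  case 0
  from cocycle_pullback[OF continuous_map_orbit_pair this] acyclic
  have "reduced_coboundary 0 X (\<lambda>vs. \<phi> (map p vs))" by blast
  then obtain \<theta> where "locally_zero 0 X (\<lambda>vs. \<phi> (map p vs) + delta \<theta> vs)"
    unfolding reduced_coboundary_def by blast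
  \<comment> \<open>In degree 0 a reduced coboundary is locally the constant
    \<open>\<theta> []\<close>, which serves as \<epsilon>.\<close>
  then have "locally_zero 0 X (\<lambda>vs. \<phi> (map p vs) + \<theta> [] * cup_power w 0 (map p vs))"
  proof (rule locally_zero_cong)
    fix vs :: "'a list" assume "length vs = Suc 0"
    then show "\<phi> (map p vs) + \<theta> [] * cup_power w 0 (map p vs) = \<phi> (map p vs) + delta \<theta> vs"
      by (cases vs) simp_all
  qed
  then have "locally_zero 0 P (\<lambda>ys. \<phi> ys + \<theta> [] * cup_power w 0 ys)"
    by (rule locally_zero_PI)
  then show ?case by (blast intro: locally_zero_imp_coboundary)
next
  case (Suc q)
  let ?W = "cup_power w q"
  from cocycle_pullback[OF continuous_map_orbit_pair Suc.prems] acyclic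
  have "reduced_coboundary (Suc q) X (\<lambda>vs. \<phi> (map p vs))" by blast
  then obtain \<theta> where \<theta>: "locally_zero (Suc q) X (\<lambda>vs. \<phi> (map p vs) + delta \<theta> vs)"
    unfolding reduced_coboundary_def by blast
  have "locally_zero (Suc q) X (\<lambda>vs. transfer (\<lambda>vs. \<phi> (map p vs) + delta \<theta> vs) (map p vs))"
    by (intro locally_zero_pullback_p locally_zero_transfer \<theta>)
  moreover have "locally_zero (Suc q) X (\<lambda>vs. transfer (\<lambda>vs. \<phi> (map p vs) + delta \<theta> vs) (map p vs)
      + delta (transfer \<theta>) (map p vs))"
  proof (rule locally_zero_sheetI)
    fix V vs assume V: "sheet V" "set vs \<subseteq> V"
    then have vs: "set vs \<subseteq> topspace X" by (auto simp: sheet_def)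
    \<comment> \<open>A pullback takes equal values on the two lifts.\<close>
    have "transfer (\<lambda>vs. \<phi> (map p vs)) (map p vs) = 0"
      by (simp only: transfer_sheet[OF V] map_map map_p_tau[OF vs] bit_add_self)
    then show "transfer (\<lambda>vs. \<phi> (map p vs) + delta \<theta> vs) (map p vs)
      + delta (transfer \<theta>) (map p vs) = 0"
      by (simp add: transfer_add delta_transfer_sheet[OF V])
  qed
  ultimately have "locally_zero (Suc q) X (\<lambda>vs. transfer (\<lambda>vs. \<phi> (map p vs) + delta \<theta> vs) (map p vs)
      + (transfer (\<lambda>vs. \<phi> (map p vs) + delta \<theta> vs) (map p vs) + delta (transfer \<theta>) (map p vs)))"
    by (rule locally_zero_add)
  then have "cocycle q P (transfer \<theta>)"
    unfolding cocycle_def by (intro locally_zero_PI) (simp only: bit_add_self_left)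
  from Suc.IH[OF this] obtain \<epsilon> \<mu> where \<mu>: "\<mu> [] = 0"
    "locally_zero q P (\<lambda>ys. transfer \<theta> ys + \<epsilon> * ?W ys + delta \<mu> ys)"
    unfolding coboundary_def by blast
  \<comment> \<open>A cochain with transfer \<mu>, like \<open>lift_cochain\<close> but labelled by
    the first vertex, so that it needs no degree. For q = 0 only the empty list counts, where both
    \<mu> and the transfer are 0.\<close>
  define \<kappa> where "\<kappa> vs = (if vs = [] then 0 else \<mu> (map p vs) * \<sigma> (hd vs))" for vs
  have transfer_\<kappa>: "transfer \<kappa> (map p vs) = \<mu> (map p vs)" if V: "sheet V" "set vs \<subseteq> V" for V vs
  proof (cases vs)
    case Nil
    with \<mu>(1) show ?thesis by simp
  next
    case (Cons v vs')
    have vs: "set vs \<subseteq> topspace X" using V by (auto simp: sheet_def)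
    then have "\<sigma> (\<tau> v) = 1 + \<sigma> v" "map p (map \<tau> vs) = map p vs"
      using Cons by (auto simp: sigma_tau p_tau)
    then have "\<kappa> vs + \<kappa> (map \<tau> vs) = \<mu> (map p vs) * \<sigma> v + \<mu> (map p vs) * (1 + \<sigma> v)"
      unfolding \<kappa>_def using Cons by (simp only:) simp
    also have "\<dots> = \<mu> (map p vs)" by (cases "\<sigma> v") simp_all
    finally show ?thesis by (simp only: transfer_sheet[OF V])
  qed
  define \<theta>' where "\<theta>' vs = \<theta> vs + \<epsilon> * lift_cochain q ?W vs + delta \<kappa> vs" for vs
  have transfer_\<theta>': "locally_zero q X (\<lambda>vs. \<theta>' vs + \<theta>' (map \<tau> vs))"
  proof -
    have "locally_zero q X (\<lambda>vs. transfer \<theta> (map p vs) + \<epsilon> * ?W (map p vs) + delta \<mu> (map p vs))"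
      using \<mu>(2) by (rule locally_zero_pullback_p)
    moreover have "locally_zero q X (\<lambda>vs.
      (transfer \<theta> (map p vs) + \<epsilon> * ?W (map p vs) + delta \<mu> (map p vs)) + (\<theta>' vs + \<theta>' (map \<tau> vs)))"
    proof (rule locally_zero_sheetI)
      fix V vs assume V: "sheet V" "set vs \<subseteq> V" and len: "length vs = Suc q"
      then have vs: "set vs \<subseteq> topspace X" by (auto simp: sheet_def)
      have "delta \<mu> (map p vs) = delta (\<lambda>vs. \<mu> (map p vs)) vs" by (simp add: delta_map)
      also have "\<dots> = delta (\<lambda>vs. transfer \<kappa> (map p vs)) vs"
        by (rule delta_cong, rule transfer_\<kappa>[symmetric, OF V(1)]) (use V(2) in auto)
      also have "\<dots> = delta (transfer \<kappa>) (map p vs)" by (simp add: delta_map)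
      also have "\<dots> = delta \<kappa> vs + delta \<kappa> (map \<tau> vs)"
        by (simp only: delta_transfer_sheet[OF V] transfer_sheet[OF V])
      finally have "delta \<mu> (map p vs) = delta \<kappa> vs + delta \<kappa> (map \<tau> vs)" .
      moreover have "\<epsilon> * ?W (map p vs) =
          \<epsilon> * lift_cochain q ?W vs + \<epsilon> * lift_cochain q ?W (map \<tau> vs)"
        using lift_cochain_tau[OF len vs, of ?W] by (simp flip: distrib_left)
      moreover have "transfer \<theta> (map p vs) = \<theta> vs + \<theta> (map \<tau> vs)"
        by (rule transfer_sheet[OF V])
      ultimately show "(transfer \<theta> (map p vs) + \<epsilon> * ?W (map p vs) + delta \<mu> (map p vs)) +
          (\<theta>' vs + \<theta>' (map \<tau> vs)) = 0"
        by (simp add: \<theta>'_def ac_simps)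
    qed
    ultimately have "locally_zero q X (\<lambda>vs.
      (transfer \<theta> (map p vs) + \<epsilon> * ?W (map p vs) + delta \<mu> (map p vs)) +
      ((transfer \<theta> (map p vs) + \<epsilon> * ?W (map p vs) + delta \<mu> (map p vs)) + (\<theta>' vs + \<theta>' (map \<tau> vs))))"
      by (rule locally_zero_add)
    then show ?thesis by (simp only: bit_add_self_left)
  qed
  \<comment> \<open>By now \<theta>' is locally invariant under \<tau>, so evaluation at either lift
    descends it to P; the label 0 is an arbitrary choice.\<close>
  define \<nu> where "\<nu> ys = \<theta>' (lift_list 0 ys)" for ys
  have "locally_zero q X (\<lambda>vs. \<theta>' vs + \<nu> (map p vs))"
  proof (rule locally_zeroI)
    fix x assume x: "x \<in> topspace X"
    obtain V where V: "openin X V" "x \<in> V" "sheet V" using ex_sheet[OF x] by blast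
    obtain U where U: "openin X U" "x \<in> U"
      "\<And>vs. length vs = Suc q \<Longrightarrow> set vs \<subseteq> U \<Longrightarrow> \<theta>' vs + \<theta>' (map \<tau> vs) = 0"
      using locally_zeroE[OF transfer_\<theta>' x] by metis
    have "\<theta>' vs + \<nu> (map p vs) = 0" if "length vs = Suc q" "set vs \<subseteq> U \<inter> V" for vs
      using that lift_list_sheet[OF V(3), of vs 0] U(3)[of vs] by (auto simp: \<nu>_def)
    then show "\<exists>V. openin X V \<and> x \<in> V \<and>
        (\<forall>vs. length vs = Suc q \<longrightarrow> set vs \<subseteq> V \<longrightarrow> \<theta>' vs + \<nu> (map p vs) = 0)"
      using U V by (intro exI[of _ "U \<inter> V"]) auto
  qed
  then have "locally_zero (Suc q) X (delta (\<lambda>vs. \<theta>' vs + \<nu> (map p vs)))"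
    by (rule locally_zero_delta)
  then have 1: "locally_zero (Suc q) X (\<lambda>vs. delta \<theta> vs + \<epsilon> * delta (lift_cochain q ?W) vs
      + delta \<nu> (map p vs))"
    by (rule locally_zero_cong) (simp add: delta_add delta_map delta_scale \<theta>'_def[abs_def])
  have "locally_zero (Suc q) X
      (\<lambda>vs. \<epsilon> * (delta (lift_cochain q ?W) vs + cup_power w (Suc q) (map p vs)))"
    using delta_lift_cochain[OF cocycle_cup_power[OF cocycle_w], of q] by (simp add: locally_zero_scale)
  then have "locally_zero (Suc q) X (\<lambda>vs. (delta \<theta> vs + \<epsilon> * delta (lift_cochain q ?W) vs
      + delta \<nu> (map p vs)) + ((\<phi> (map p vs) + delta \<theta> vs) +
      \<epsilon> * (delta (lift_cochain q ?W) vs + cup_power w (Suc q) (map p vs))))"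
    by (intro locally_zero_add 1 \<theta>)
  then have "locally_zero (Suc q) X (\<lambda>vs. \<phi> (map p vs) + \<epsilon> * cup_power w (Suc q) (map p vs)
      + delta \<nu> (map p vs))"
    by (rule locally_zero_cong) (simp add: distrib_left ac_simps)
  then have "locally_zero (Suc q) P (\<lambda>ys. \<phi> ys + \<epsilon> * cup_power w (Suc q) ys + delta \<nu> ys)"
    by (rule locally_zero_PI)
  then have "coboundary (Suc q) P
      (\<lambda>ys. (\<phi> ys + \<epsilon> * cup_power w (Suc q) ys + delta \<nu> ys) + delta \<nu> ys)"
    by (intro coboundary_add[OF locally_zero_imp_coboundary coboundary_delta_Suc])
  then have "coboundary (Suc q) P (\<lambda>ys. \<phi> ys + \<epsilon> * cup_power w (Suc q) ys)"
    by (rule coboundary_cong) (simp add: add.assoc)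
  then show ?case by blast
qed

end

text \<open>The sum of the two labellings is invariant under \<tau> and so defines a 0-cochain
  \<kappa> on the quotient, whose coboundary is locally w + w'.\<close>

lemma double_cover_unique:
  assumes "double_cover X \<tau> w \<sigma>" "double_cover X \<tau> w' \<sigma>'"
  shows "coboundary 1 (orbit_space \<tau> X) (\<lambda>ys. w ys + w' ys)"
proof -
  interpret A: double_cover X \<tau> w \<sigma> by fact
  interpret B: double_cover X \<tau> w' \<sigma>' by fact
  define \<kappa> where "\<kappa> ys = \<sigma> (A.lift (hd ys) 0) + \<sigma>' (A.lift (hd ys) 0)" for ys
  have \<kappa>: "\<kappa> [A.p v] = \<sigma> v + \<sigma>' v" if "v \<in> topspace X" for v
    using that by (auto simp: \<kappa>_def A.lift_p A.sigma_tau B.sigma_tau)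
  have "locally_zero 1 X (\<lambda>vs. w (map A.p vs) + w' (map A.p vs) + delta \<kappa> (map A.p vs))"
  proof (rule locally_zeroI)
    fix x assume x: "x \<in> topspace X"
    obtain V where V: "openin X V" "x \<in> V" "A.sheet V" using A.ex_sheet[OF x] by blast
    obtain U where U: "openin X U" "x \<in> U" "B.sheet U" using B.ex_sheet[OF x] by blast
    have "w (map A.p vs) + w' (map A.p vs) + delta \<kappa> (map A.p vs) = 0"
      if len: "length vs = Suc 1" and UV: "set vs \<subseteq> U \<inter> V" for vs
    proof -
      obtain a b where vs: "vs = [a, b]" using len by (auto simp: length_Suc_conv)
      then have "a \<in> V" "b \<in> V" "a \<in> U" "b \<in> U" using UV by auto
      moreover from this have "a \<in> topspace X" "b \<in> topspace X"
        using V(1) openin_subset by blast+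
      ultimately show ?thesis using V(3) U(3)
        by (simp add: vs \<kappa> A.sheet_def B.sheet_def ac_simps)
    qed
    then show "\<exists>V. openin X V \<and> x \<in> V \<and> (\<forall>vs. length vs = Suc 1 \<longrightarrow> set vs \<subseteq> V \<longrightarrow>
        w (map A.p vs) + w' (map A.p vs) + delta \<kappa> (map A.p vs) = 0)"
      using U V by (intro exI[of _ "U \<inter> V"]) auto
  qed
  then have "locally_zero 1 A.P (\<lambda>ys. w ys + w' ys + delta \<kappa> ys)" by (rule A.locally_zero_PI)
  then have "coboundary (Suc 0) A.P (\<lambda>ys. (w ys + w' ys + delta \<kappa> ys) + delta \<kappa> ys)"
    by (intro coboundary_add[OF locally_zero_imp_coboundary coboundary_delta_Suc]) simp
  then show ?thesis by (simp add: add.assoc)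
qed

lemma double_cover_pullback:
  assumes "double_cover Y \<tau>' w \<sigma>" and \<tau>: "continuous_map X X \<tau>" "\<And>x. x \<in> topspace X \<Longrightarrow> \<tau> (\<tau> x) = x"
    and F: "continuous_map X Y F" "\<And>x. x \<in> topspace X \<Longrightarrow> F (\<tau> x) = \<tau>' (F x)"
    and f: "\<And>x. x \<in> topspace X \<Longrightarrow> f (orbit_pair \<tau> x) = orbit_pair \<tau>' (F x)"
  shows "double_cover X \<tau> (\<lambda>ys. w (map f ys)) (\<lambda>x. \<sigma> (F x))"
proof -
  interpret B: double_cover Y \<tau>' w \<sigma> by fact
  have F_in: "F x \<in> topspace Y" if "x \<in> topspace X" for x
    using F(1) that by (auto simp: continuous_map_def)
  show ?thesis
  proof
    fix x assume x: "x \<in> topspace X"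
    obtain V where V: "openin Y V" "F x \<in> V" "B.sheet V" using B.ex_sheet[OF F_in[OF x]] by blast
    have "openin X {x \<in> topspace X. F x \<in> V}" using F(1) V(1) by (rule openin_continuous_map_preimage)
    then show "\<exists>V. openin X V \<and> x \<in> V \<and> (\<forall>a\<in>V. \<forall>b\<in>V.
        w (map f [orbit_pair \<tau> a, orbit_pair \<tau> b]) = \<sigma> (F a) + \<sigma> (F b))"
      using V(2,3) x by (intro exI[of _ "{x \<in> topspace X. F x \<in> V}"]) (auto simp: f B.sheet_def)
  qed (use \<tau> F_in F(2) B.sigma_tau in auto)
qed

section \<open>Alexander--Spanier classes\<close>

definition AS_restrict :: "nat \<Rightarrow> 'a topology \<Rightarrow> ('a list \<Rightarrow> bit) \<Rightarrow> 'a list \<Rightarrow> bit" where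
  "AS_restrict q X \<phi> xs = (if xs \<in> AS_tuples q X then \<phi> xs else 0)"

lemma AS_restrict_in [simp]: "AS_restrict q X \<phi> \<in> AS_cochains q X"
  by (simp add: AS_restrict_def AS_cochains_def)

lemma AS_restrict_apply [simp]:
  "length xs = Suc q \<Longrightarrow> set xs \<subseteq> topspace X \<Longrightarrow> AS_restrict q X \<phi> xs = \<phi> xs"
  by (simp add: AS_restrict_def AS_tuples_def)

lemma AS_cochains_add:
  "\<phi> \<in> AS_cochains q X \<Longrightarrow> \<psi> \<in> AS_cochains q X \<Longrightarrow> (\<lambda>xs. \<phi> xs + \<psi> xs) \<in> AS_cochains q X"
  by (simp add: AS_cochains_def)

lemma AS_locally_zero_iff:
  "\<phi> \<in> AS_locally_zero q X \<longleftrightarrow> \<phi> \<in> AS_cochains q X \<and> locally_zero q X \<phi>"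
proof
  assume \<phi>: "\<phi> \<in> AS_locally_zero q X"
  then obtain \<U> where \<U>: "\<forall>U\<in>\<U>. openin X U" "\<Union>\<U> = topspace X"
    "\<forall>U\<in>\<U>. \<forall>xs\<in>AS_tuples q X. set xs \<subseteq> U \<longrightarrow> \<phi> xs = 0"
    unfolding AS_locally_zero_def by auto
  have "locally_zero q X \<phi>"
  proof (rule locally_zeroI)
    fix x assume "x \<in> topspace X"
    then obtain U where "U \<in> \<U>" "x \<in> U" using \<U>(2) by blast
    moreover from this have "openin X U" "U \<subseteq> topspace X" using \<U> by auto
    ultimately show "\<exists>V. openin X V \<and> x \<in> V \<and>
        (\<forall>xs. length xs = Suc q \<longrightarrow> set xs \<subseteq> V \<longrightarrow> \<phi> xs = 0)"
      using \<U>(3) by (intro exI[of _ U]) (auto simp: AS_tuples_def)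
  qed
  with \<phi> show "\<phi> \<in> AS_cochains q X \<and> locally_zero q X \<phi>" by (simp add: AS_locally_zero_def)
next
  assume \<phi>: "\<phi> \<in> AS_cochains q X \<and> locally_zero q X \<phi>"
  let ?\<U> = "{V. openin X V \<and> (\<forall>xs. length xs = Suc q \<longrightarrow> set xs \<subseteq> V \<longrightarrow> \<phi> xs = 0)}"
  have "\<Union>?\<U> = topspace X"
  proof
    show "\<Union>?\<U> \<subseteq> topspace X" using openin_subset by blast
    show "topspace X \<subseteq> \<Union>?\<U>" using \<phi> unfolding locally_zero_def by auto
  qed
  then show "\<phi> \<in> AS_locally_zero q X"
    using \<phi> unfolding AS_locally_zero_def by (auto simp: AS_tuples_def intro!: exI[of _ ?\<U>])
qed

lemma AS_coboundary_eq: "AS_coboundary q X \<phi> = AS_restrict (Suc q) X (delta \<phi>)"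
  by (rule ext) (auto simp: AS_coboundary_def AS_restrict_def AS_tuples_def delta_eq_sum lessThan_Suc_atMost)

lemma locally_zero_restrict [simp]: "locally_zero q X (AS_restrict q X \<phi>) \<longleftrightarrow> locally_zero q X \<phi>"
  by (auto elim: locally_zero_cong)

lemma AS_cocycles_iff: "\<phi> \<in> AS_cocycles q X \<longleftrightarrow> \<phi> \<in> AS_cochains q X \<and> cocycle q X \<phi>"
  by (simp add: AS_cocycles_def AS_locally_zero_iff AS_coboundary_eq cocycle_def)

lemma delta_restrict:
  assumes "length xs = Suc (Suc q)" "set xs \<subseteq> topspace X"
  shows "delta (AS_restrict q X \<theta>) xs = delta \<theta> xs"
  by (rule delta_cong) (use assms in auto)

lemma AS_coboundaries_iff:
  "\<phi> \<in> AS_coboundaries q X \<longleftrightarrow> \<phi> \<in> AS_cochains q X \<and> coboundary q X \<phi>"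
proof
  assume "\<phi> \<in> AS_coboundaries q X"
  then obtain \<beta> \<zeta> where \<phi>: "\<phi> = (\<lambda>xs. \<beta> xs + \<zeta> xs)" "\<beta> \<in> AS_image q X" "\<zeta> \<in> AS_locally_zero q X"
    unfolding AS_coboundaries_def by auto
  have "\<beta> \<in> AS_cochains q X \<and> coboundary q X \<beta>"
  proof (cases q)
    case 0
    then show ?thesis using \<phi>(2) by (simp add: AS_cochains_def locally_zero_imp_coboundary)
  next
    case (Suc q')
    then obtain \<theta> where \<theta>: "\<beta> = AS_restrict q X (delta \<theta>)"
      using \<phi>(2) by (auto simp: AS_coboundary_eq)
    have "coboundary q X \<beta>" unfolding \<theta>
      by (rule coboundary_cong[where \<phi> = "delta \<theta>"]) (use Suc coboundary_delta_Suc in auto)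
    with \<theta> show ?thesis by simp
  qed
  with \<phi> show "\<phi> \<in> AS_cochains q X \<and> coboundary q X \<phi>"
    by (auto simp: AS_locally_zero_iff intro: AS_cochains_add coboundary_add locally_zero_imp_coboundary)
next
  assume \<phi>: "\<phi> \<in> AS_cochains q X \<and> coboundary q X \<phi>"
  then obtain \<theta> where \<theta>: "\<theta> [] = 0" "locally_zero q X (\<lambda>xs. \<phi> xs + delta \<theta> xs)"
    by (auto simp: coboundary_def)
  have "\<exists>\<beta>\<in>AS_image q X. \<beta> \<in> AS_cochains q X \<and>
      (\<forall>xs. length xs = Suc q \<longrightarrow> set xs \<subseteq> topspace X \<longrightarrow> \<beta> xs = delta \<theta> xs)"
  proof (cases q)
    case 0
    have "delta \<theta> xs = 0" if "length xs = Suc q" for xs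
      using \<theta>(1) that 0 by (cases xs) auto
    then show ?thesis using 0 by (auto simp: AS_cochains_def)
  next
    case (Suc q')
    then show ?thesis
      by (auto simp: AS_coboundary_eq delta_restrict intro!: bexI[of _ "AS_restrict q' X \<theta>"])
  qed
  then obtain \<beta> where \<beta>: "\<beta> \<in> AS_image q X" "\<beta> \<in> AS_cochains q X"
    "\<And>xs. length xs = Suc q \<Longrightarrow> set xs \<subseteq> topspace X \<Longrightarrow> \<beta> xs = delta \<theta> xs" by blast
  have "locally_zero q X (\<lambda>xs. \<beta> xs + \<phi> xs)"
    using \<theta>(2) by (rule locally_zero_cong) (simp add: \<beta>(3) add.commute)
  then have "(\<lambda>xs. \<beta> xs + \<phi> xs) \<in> AS_locally_zero q X"
    using \<phi> \<beta>(2) by (simp add: AS_locally_zero_iff AS_cochains_add)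
  then show "\<phi> \<in> AS_coboundaries q X"
    unfolding AS_coboundaries_def using \<beta>(1)
    by (intro CollectI exI[of _ \<beta>] exI[of _ "\<lambda>xs. \<beta> xs + \<phi> xs"]) simp
qed

lemma AS_reduced_coboundaries_iff:
  "\<phi> \<in> AS_reduced_coboundaries q X \<longleftrightarrow> \<phi> \<in> AS_cochains q X \<and> reduced_coboundary q X \<phi>"
proof
  assume "\<phi> \<in> AS_reduced_coboundaries q X"
  then obtain \<beta> \<zeta> where \<phi>: "\<phi> = (\<lambda>xs. \<beta> xs + \<zeta> xs)" "\<beta> \<in> AS_reduced_image q X" "\<zeta> \<in> AS_locally_zero q X"
    unfolding AS_reduced_coboundaries_def by auto
  have "\<exists>\<theta>. \<beta> = AS_restrict q X (delta \<theta>)"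
  proof (cases q)
    case 0
    then obtain c where "\<beta> = AS_const X c" using \<phi>(2) by auto
    then have "\<beta> = AS_restrict q X (delta (\<lambda>_. c))"
      using 0 by (auto simp: AS_const_def AS_restrict_def AS_tuples_def delta_const)
    then show ?thesis by blast
  next
    case (Suc q')
    then show ?thesis using \<phi>(2) by (auto simp: AS_coboundary_eq)
  qed
  then obtain \<theta> where \<theta>: "\<beta> = AS_restrict q X (delta \<theta>)" ..
  have "locally_zero q X (\<lambda>xs. \<phi> xs + delta \<theta> xs)"
    using \<phi>(3) unfolding AS_locally_zero_iff
    by (auto elim!: locally_zero_cong simp: \<phi>(1) \<theta> ac_simps)
  moreover have "\<phi> \<in> AS_cochains q X"
    using \<phi>(1,3) \<theta> by (auto simp: AS_locally_zero_iff intro: AS_cochains_add)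
  ultimately show "\<phi> \<in> AS_cochains q X \<and> reduced_coboundary q X \<phi>"
    by (auto simp: reduced_coboundary_def)
next
  assume \<phi>: "\<phi> \<in> AS_cochains q X \<and> reduced_coboundary q X \<phi>"
  then obtain \<theta> where \<theta>: "locally_zero q X (\<lambda>xs. \<phi> xs + delta \<theta> xs)"
    by (auto simp: reduced_coboundary_def)
  have "\<exists>\<beta>\<in>AS_reduced_image q X. \<beta> \<in> AS_cochains q X \<and>
      (\<forall>xs. length xs = Suc q \<longrightarrow> set xs \<subseteq> topspace X \<longrightarrow> \<beta> xs = delta \<theta> xs)"
  proof (cases q)
    case 0
    have "delta \<theta> xs = \<theta> []" if "length xs = Suc q" for xs
      using that 0 by (cases xs) auto
    then show ?thesis using 0
      by (auto simp: AS_cochains_def AS_const_def AS_tuples_def intro!: exI[of _ "\<theta> []"])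
  next
    case (Suc q')
    then show ?thesis
      by (auto simp: AS_coboundary_eq delta_restrict intro!: bexI[of _ "AS_restrict q' X \<theta>"])
  qed
  then obtain \<beta> where \<beta>: "\<beta> \<in> AS_reduced_image q X" "\<beta> \<in> AS_cochains q X"
    "\<And>xs. length xs = Suc q \<Longrightarrow> set xs \<subseteq> topspace X \<Longrightarrow> \<beta> xs = delta \<theta> xs" by blast
  have "locally_zero q X (\<lambda>xs. \<beta> xs + \<phi> xs)"
    using \<theta> by (rule locally_zero_cong) (simp add: \<beta>(3) add.commute)
  then have "(\<lambda>xs. \<beta> xs + \<phi> xs) \<in> AS_locally_zero q X"
    using \<phi> \<beta>(2) by (simp add: AS_locally_zero_iff AS_cochains_add)
  then show "\<phi> \<in> AS_reduced_coboundaries q X"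
    unfolding AS_reduced_coboundaries_def using \<beta>(1)
    by (intro CollectI exI[of _ \<beta>] exI[of _ "\<lambda>xs. \<beta> xs + \<phi> xs"]) simp
qed

text \<open>Only the members are normalised outside the tuples, so any function on lists can name a
  coset.\<close>

definition AS_class :: "nat \<Rightarrow> 'a topology \<Rightarrow> ('a list \<Rightarrow> bit) \<Rightarrow> ('a list \<Rightarrow> bit) set" where
  "AS_class q X \<phi> = {\<psi> \<in> AS_cochains q X. coboundary q X (\<lambda>xs. \<psi> xs + \<phi> xs)}"

definition AS_reduced_class :: "nat \<Rightarrow> 'a topology \<Rightarrow> ('a list \<Rightarrow> bit) \<Rightarrow> ('a list \<Rightarrow> bit) set" where
  "AS_reduced_class q X \<phi> = {\<psi> \<in> AS_cochains q X. reduced_coboundary q X (\<lambda>xs. \<psi> xs + \<phi> xs)}"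

lemma AS_class_eq_iff: "AS_class q X \<phi> = AS_class q X \<psi> \<longleftrightarrow> coboundary q X (\<lambda>xs. \<phi> xs + \<psi> xs)"
proof
  have "coboundary q X (\<lambda>xs. AS_restrict q X \<phi> xs + \<phi> xs)"
    by (intro locally_zero_imp_coboundary locally_zero_cong[OF locally_zero_0]) simp
  then have "AS_restrict q X \<phi> \<in> AS_class q X \<phi>" by (simp add: AS_class_def)
  moreover assume "AS_class q X \<phi> = AS_class q X \<psi>"
  ultimately have "AS_restrict q X \<phi> \<in> AS_class q X \<psi>" by (simp only:)
  then have "coboundary q X (\<lambda>xs. AS_restrict q X \<phi> xs + \<psi> xs)" by (simp add: AS_class_def)
  then show "coboundary q X (\<lambda>xs. \<phi> xs + \<psi> xs)" by (rule coboundary_cong) simp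
next
  assume *: "coboundary q X (\<lambda>xs. \<phi> xs + \<psi> xs)"
  have "coboundary q X (\<lambda>xs. \<xi> xs + \<psi> xs)" if "coboundary q X (\<lambda>xs. \<xi> xs + \<phi> xs)" for \<xi>
    by (rule coboundary_cong[OF coboundary_add[OF that *]]) (simp add: ac_simps)
  moreover have "coboundary q X (\<lambda>xs. \<xi> xs + \<phi> xs)" if "coboundary q X (\<lambda>xs. \<xi> xs + \<psi> xs)" for \<xi>
    by (rule coboundary_cong[OF coboundary_add[OF that *]]) (simp add: ac_simps)
  ultimately show "AS_class q X \<phi> = AS_class q X \<psi>" by (auto simp: AS_class_def)
qed

lemma AS_class_rep: "\<phi> \<in> AS_class q X \<psi> \<Longrightarrow> AS_class q X \<phi> = AS_class q X \<psi>"
  by (simp add: AS_class_eq_iff) (simp add: AS_class_def)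

lemma AS_class_self: "AS_restrict q X \<phi> \<in> AS_class q X \<phi>"
  unfolding AS_class_def
  by (auto intro!: locally_zero_imp_coboundary locally_zero_cong[OF locally_zero_0])

lemma AS_class_cong:
  "(\<And>xs. length xs = Suc q \<Longrightarrow> set xs \<subseteq> topspace X \<Longrightarrow> \<phi> xs = \<psi> xs) \<Longrightarrow> AS_class q X \<phi> = AS_class q X \<psi>"
  unfolding AS_class_eq_iff
  by (intro locally_zero_imp_coboundary locally_zero_cong[OF locally_zero_0]) simp

lemma AS_class_cocycle:
  assumes "cocycle q X \<phi>" "\<psi> \<in> AS_class q X \<phi>" shows "cocycle q X \<psi>"
proof -
  have "cocycle q X (\<lambda>xs. \<psi> xs + \<phi> xs)"
    using assms(2) by (intro reduced_coboundary_imp_cocycle coboundary_imp_reduced) (simp add: AS_class_def)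
  then have "cocycle q X (\<lambda>xs. (\<psi> xs + \<phi> xs) + \<phi> xs)"
    using assms(1) by (rule cocycle_add)
  then show ?thesis by (simp add: add.assoc)
qed

lemma AS_coset_eq_class:
  assumes "\<phi> \<in> AS_cochains q X"
  shows "AS_coboundaries q X #>\<^bsub>AS_cocycle_group q X\<^esub> \<phi> = AS_class q X \<phi>"
proof (intro subset_antisym subsetI)
  fix \<psi> assume "\<psi> \<in> AS_coboundaries q X #>\<^bsub>AS_cocycle_group q X\<^esub> \<phi>"
  then obtain \<zeta> where "\<zeta> \<in> AS_coboundaries q X" "\<psi> = (\<lambda>xs. \<zeta> xs + \<phi> xs)"
    by (auto simp: r_coset_def AS_cocycle_group_def)
  with assms show "\<psi> \<in> AS_class q X \<phi>"
    by (auto simp: AS_class_def AS_coboundaries_iff AS_cochains_add add.assoc)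
next
  fix \<psi> assume "\<psi> \<in> AS_class q X \<phi>"
  with assms have "(\<lambda>xs. \<psi> xs + \<phi> xs) \<in> AS_coboundaries q X"
    by (auto simp: AS_class_def AS_coboundaries_iff AS_cochains_add)
  then show "\<psi> \<in> AS_coboundaries q X #>\<^bsub>AS_cocycle_group q X\<^esub> \<phi>"
    unfolding r_coset_def by (rule UN_I) (simp add: AS_cocycle_group_def add.assoc)
qed

lemma AS_reduced_coset_eq_class:
  assumes "\<phi> \<in> AS_cochains q X"
  shows "AS_reduced_coboundaries q X #>\<^bsub>AS_cocycle_group q X\<^esub> \<phi> = AS_reduced_class q X \<phi>"
proof (intro subset_antisym subsetI)
  fix \<psi> assume "\<psi> \<in> AS_reduced_coboundaries q X #>\<^bsub>AS_cocycle_group q X\<^esub> \<phi>"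
  then obtain \<zeta> where "\<zeta> \<in> AS_reduced_coboundaries q X" "\<psi> = (\<lambda>xs. \<zeta> xs + \<phi> xs)"
    by (auto simp: r_coset_def AS_cocycle_group_def)
  with assms show "\<psi> \<in> AS_reduced_class q X \<phi>"
    by (auto simp: AS_reduced_class_def AS_reduced_coboundaries_iff AS_cochains_add add.assoc)
next
  fix \<psi> assume "\<psi> \<in> AS_reduced_class q X \<phi>"
  with assms have "(\<lambda>xs. \<psi> xs + \<phi> xs) \<in> AS_reduced_coboundaries q X"
    by (auto simp: AS_reduced_class_def AS_reduced_coboundaries_iff AS_cochains_add)
  then show "\<psi> \<in> AS_reduced_coboundaries q X #>\<^bsub>AS_cocycle_group q X\<^esub> \<phi>"
    unfolding r_coset_def by (rule UN_I) (simp add: AS_cocycle_group_def add.assoc)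
qed

lemma one_AS_cohomology_group: "\<one>\<^bsub>AS_cohomology_group q X\<^esub> = AS_class q X (\<lambda>_. 0)"
  by (auto simp: AS_cohomology_group_def AS_class_def AS_coboundaries_iff)

lemma AS_class_eq_one_iff: "AS_class q X \<phi> = \<one>\<^bsub>AS_cohomology_group q X\<^esub> \<longleftrightarrow> coboundary q X \<phi>"
  by (simp add: one_AS_cohomology_group AS_class_eq_iff)

lemma carrier_AS_cohomology_group:
  "carrier (AS_cohomology_group q X) = {AS_class q X \<phi> |\<phi>. cocycle q X \<phi>}"
proof (intro subset_antisym subsetI)
  fix K assume "K \<in> carrier (AS_cohomology_group q X)"
  then obtain \<phi> where "\<phi> \<in> AS_cocycles q X" "K = AS_coboundaries q X #>\<^bsub>AS_cocycle_group q X\<^esub> \<phi>"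
    by (auto simp: AS_cohomology_group_def FactGroup_def RCOSETS_def AS_cocycle_group_def)
  then show "K \<in> {AS_class q X \<phi> |\<phi>. cocycle q X \<phi>}"
    by (auto simp: AS_cocycles_iff AS_coset_eq_class)
next
  fix K assume "K \<in> {AS_class q X \<phi> |\<phi>. cocycle q X \<phi>}"
  then obtain \<phi> where \<phi>: "cocycle q X \<phi>" "K = AS_class q X \<phi>" by blast
  have "AS_restrict q X \<phi> \<in> AS_cocycles q X"
    using cocycle_cong[OF \<phi>(1), of "AS_restrict q X \<phi>"] by (simp add: AS_cocycles_iff)
  moreover have "K = AS_coboundaries q X #>\<^bsub>AS_cocycle_group q X\<^esub> AS_restrict q X \<phi>"
    using AS_class_rep[OF AS_class_self, of q X \<phi>] by (simp add: AS_coset_eq_class \<phi>(2))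
  ultimately show "K \<in> carrier (AS_cohomology_group q X)"
    by (auto simp: AS_cohomology_group_def FactGroup_def RCOSETS_def AS_cocycle_group_def)
qed

lemma AS_cup_class:
  assumes \<phi>: "cocycle n X \<phi>" and \<psi>: "cocycle 1 X \<psi>"
  shows "AS_cup n 1 X (AS_class n X \<phi>) (AS_class 1 X \<psi>) = AS_class (Suc n) X (cup n \<phi> \<psi>)"
proof -
  have "AS_coboundaries (n + 1) X #>\<^bsub>AS_cocycle_group (n + 1) X\<^esub> AS_cup_cochain n 1 X \<phi>' \<psi>'
      = AS_class (Suc n) X (cup n \<phi> \<psi>)"
    if \<phi>': "\<phi>' \<in> AS_class n X \<phi>" and \<psi>': "\<psi>' \<in> AS_class 1 X \<psi>" for \<phi>' \<psi>'
  proof -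
    have eq: "AS_cup_cochain n 1 X \<phi>' \<psi>' = AS_restrict (n + 1) X (cup n \<phi>' \<psi>')"
      by (rule ext) (simp add: AS_cup_cochain_def AS_restrict_def cup_def)
    have "coboundary (n + 1) X (cup n (\<lambda>xs. \<phi>' xs + \<phi> xs) \<psi>')"
      using \<phi>' AS_class_cocycle[OF \<psi> \<psi>'] by (intro coboundary_cup_left) (auto simp: AS_class_def)
    moreover have "coboundary (n + Suc 0) X (cup n \<phi> (\<lambda>xs. \<psi>' xs + \<psi> xs))"
      using \<psi>' \<phi> by (intro coboundary_cup_right) (auto simp: AS_class_def)
    ultimately have "coboundary (Suc n) X
        (\<lambda>xs. cup n (\<lambda>xs. \<phi>' xs + \<phi> xs) \<psi>' xs + cup n \<phi> (\<lambda>xs. \<psi>' xs + \<psi> xs) xs)"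
      by (intro coboundary_add) simp_all
    then have "coboundary (Suc n) X (\<lambda>xs. cup n \<phi>' \<psi>' xs + cup n \<phi> \<psi> xs)"
      by (rule coboundary_cong) (simp add: cup_add_left cup_add_right ac_simps)
    then have "AS_class (Suc n) X (cup n \<phi>' \<psi>') = AS_class (Suc n) X (cup n \<phi> \<psi>)"
      by (simp add: AS_class_eq_iff)
    moreover have "AS_class (Suc n) X (AS_restrict (Suc n) X (cup n \<phi>' \<psi>')) = AS_class (Suc n) X (cup n \<phi>' \<psi>')"
      by (rule AS_class_cong) simp
    ultimately show ?thesis unfolding eq by (simp add: AS_coset_eq_class)
  qed
  moreover have "AS_class n X \<phi> \<noteq> {}" "AS_class 1 X \<psi> \<noteq> {}" using AS_class_self by blast+
  ultimately show ?thesis unfolding AS_cup_def by simp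
qed

lemma AS_cup_power_class:
  assumes w: "cocycle 1 X w"
  shows "AS_cup_power X (AS_class 1 X w) n = AS_class n X (cup_power w n)"
proof (induction n)
  case 0
  have "AS_const X 1 \<in> AS_cochains 0 X" by (simp add: AS_const_def AS_cochains_def)
  moreover have "AS_class 0 X (AS_const X 1) = AS_class 0 X (\<lambda>_. 1)"
    by (rule AS_class_cong) (simp add: AS_const_def AS_tuples_def)
  ultimately show ?case by (simp add: AS_coset_eq_class)
next
  case (Suc n)
  then show ?case using AS_cup_class[OF cocycle_cup_power[OF w] w] by simp
qed

lemma AS_pullback_eq: "AS_pullback q X f \<phi> = AS_restrict q X (\<lambda>xs. \<phi> (map f xs))"
  by (rule ext) (simp add: AS_pullback_def AS_restrict_def)

lemma AS_induced_class:
  assumes f: "continuous_map X Y f"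
  shows "AS_induced q X f (AS_class q Y \<phi>) = AS_class q X (\<lambda>xs. \<phi> (map f xs))"
proof -
  have "AS_coboundaries q X #>\<^bsub>AS_cocycle_group q X\<^esub> AS_pullback q X f \<psi> =
      AS_class q X (\<lambda>xs. \<phi> (map f xs))" if "\<psi> \<in> AS_class q Y \<phi>" for \<psi>
  proof -
    have "coboundary q X (\<lambda>xs. \<psi> (map f xs) + \<phi> (map f xs))"
      using coboundary_pullback[OF f, of q "\<lambda>xs. \<psi> xs + \<phi> xs"] that by (simp add: AS_class_def)
    then have "AS_class q X (\<lambda>xs. \<psi> (map f xs)) = AS_class q X (\<lambda>xs. \<phi> (map f xs))"
      by (simp add: AS_class_eq_iff)
    moreover have "AS_class q X (AS_restrict q X (\<lambda>xs. \<psi> (map f xs))) = AS_class q X (\<lambda>xs. \<psi> (map f xs))"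
      by (rule AS_class_cong) simp
    ultimately show ?thesis by (simp add: AS_pullback_eq AS_coset_eq_class)
  qed
  moreover have "AS_class q Y \<phi> \<noteq> {}" using AS_class_self by blast
  ultimately show ?thesis unfolding AS_induced_def by simp
qed

text \<open>Comparing one element is enough: the pullback of a representative lies in the union
  defining the induced class, but not in the neutral coset.\<close>

lemma AS_reduced_induced_nontrivial:
  assumes f: "continuous_map X Y f" and c: "cocycle q Y c"
    and nt: "\<not> reduced_coboundary q X (\<lambda>xs. c (map f xs))"
  shows "\<exists>K \<in> carrier (AS_reduced_cohomology_group q Y).
    AS_reduced_induced q X f K \<noteq> \<one>\<^bsub>AS_reduced_cohomology_group q X\<^esub>"
proof
  let ?c = "AS_restrict q Y c"
  let ?K = "AS_reduced_coboundaries q Y #>\<^bsub>AS_cocycle_group q Y\<^esub> ?c"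
  have "?c \<in> AS_cocycles q Y"
    using cocycle_cong[OF c, of ?c] by (simp add: AS_cocycles_iff)
  then show "?K \<in> carrier (AS_reduced_cohomology_group q Y)"
    by (auto simp: AS_reduced_cohomology_group_def FactGroup_def RCOSETS_def AS_cocycle_group_def)
  have "?c \<in> ?K"
    by (simp add: AS_reduced_coset_eq_class AS_reduced_class_def)
      (simp add: reduced_coboundary_def, rule exI[of _ "\<lambda>_. 0"], simp)
  moreover have "AS_pullback q X f ?c \<in> AS_reduced_coboundaries q X #>\<^bsub>AS_cocycle_group q X\<^esub> AS_pullback q X f ?c"
    by (simp add: AS_pullback_eq AS_reduced_coset_eq_class AS_reduced_class_def)
      (simp add: reduced_coboundary_def, rule exI[of _ "\<lambda>_. 0"], simp)
  ultimately have "AS_pullback q X f ?c \<in> AS_reduced_induced q X f ?K"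
    unfolding AS_reduced_induced_def by blast
  moreover have "AS_pullback q X f ?c \<notin> AS_reduced_coboundaries q X"
  proof
    assume "AS_pullback q X f ?c \<in> AS_reduced_coboundaries q X"
    then have "reduced_coboundary q X (AS_pullback q X f ?c)" by (simp add: AS_reduced_coboundaries_iff)
    then have "reduced_coboundary q X (\<lambda>xs. c (map f xs))"
    proof (rule reduced_coboundary_cong)
      fix xs assume "length xs = Suc q" "set xs \<subseteq> topspace X"
      moreover from this have "f ` set xs \<subseteq> topspace Y" using f by (auto simp: continuous_map_def)
      ultimately show "c (map f xs) = AS_pullback q X f ?c xs" by (simp add: AS_pullback_eq)
    qed
    with nt show False ..
  qed
  moreover have "\<one>\<^bsub>AS_reduced_cohomology_group q X\<^esub> = AS_reduced_coboundaries q X"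
    by (simp add: AS_reduced_cohomology_group_def)
  ultimately show "AS_reduced_induced q X f ?K \<noteq> \<one>\<^bsub>AS_reduced_cohomology_group q X\<^esub>" by blast
qed

section \<open>The infinite sphere\<close>

lemma topspace_nsphere: "topspace (nsphere n) = {x. (\<Sum>i\<le>n. x i ^ 2) = 1 \<and> (\<forall>i>n. x i = 0)}"
  by (simp add: nsphere)

lemma sum_over_support:
  fixes g :: "nat \<Rightarrow> real"
  assumes "\<And>i. n < i \<Longrightarrow> x i = 0" "\<And>i. x i = 0 \<Longrightarrow> g i = 0"
  shows "(\<Sum>i | x i \<noteq> (0::real). g i) = (\<Sum>i\<le>n. g i)"
proof (rule sum.mono_neutral_left)
  show "{i. x i \<noteq> 0} \<subseteq> {..n}" using assms(1) by (auto simp flip: not_less)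
qed (use assms(2) in auto)

lemma nsphere_mono: "m \<le> n \<Longrightarrow> topspace (nsphere m) \<subseteq> topspace (nsphere n)"
proof
  fix x assume "m \<le> n" and "x \<in> topspace (nsphere m)"
  then have x: "(\<Sum>i\<le>m. x i ^ 2) = 1" "\<And>i. m < i \<Longrightarrow> x i = 0" by (auto simp: topspace_nsphere)
  have "(\<Sum>i\<le>n. x i ^ 2) = (\<Sum>i\<le>m. x i ^ 2)"
    by (rule sum.mono_neutral_right) (use \<open>m \<le> n\<close> x(2) in auto)
  with x \<open>m \<le> n\<close> show "x \<in> topspace (nsphere n)" by (simp add: topspace_nsphere)
qed

lemma topspace_infinite_sphere: "topspace infinite_sphere = (\<Union>n. topspace (nsphere n))"
proof
  show "topspace infinite_sphere \<subseteq> (\<Union>n. topspace (nsphere n))"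
    using openin_topspace[of infinite_sphere] unfolding openin_infinite_sphere by blast
  have "openin infinite_sphere (\<Union>n. topspace (nsphere n))"
    unfolding openin_infinite_sphere
  proof (intro conjI allI)
    fix n
    have "(\<Union>n. topspace (nsphere n)) \<inter> topspace (nsphere n) = topspace (nsphere n)" by blast
    then show "openin (nsphere n) ((\<Union>n. topspace (nsphere n)) \<inter> topspace (nsphere n))" by simp
  qed simp
  then show "(\<Union>n. topspace (nsphere n)) \<subseteq> topspace infinite_sphere" by (rule openin_subset)
qed

lemma continuous_map_nsphere_infinite_sphere: "continuous_map (nsphere n) infinite_sphere (\<lambda>x. x)"
  unfolding continuous_map_def
proof (intro conjI allI impI)
  show "(\<lambda>x. x) \<in> topspace (nsphere n) \<rightarrow> topspace infinite_sphere"
    by (auto simp: topspace_infinite_sphere)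
  fix U assume "openin infinite_sphere U"
  then have "openin (nsphere n) (U \<inter> topspace (nsphere n))" by (simp add: openin_infinite_sphere)
  then show "openin (nsphere n) {x \<in> topspace (nsphere n). x \<in> U}"
    by (rule back_subst[of "openin (nsphere n)"]) blast
qed

text \<open>Summation over the support gives one formula for the radial projection onto the spheres
  of all dimensions.\<close>

definition normalize_seq :: "(nat \<Rightarrow> real) \<Rightarrow> nat \<Rightarrow> real" where
  "normalize_seq x = (\<lambda>k. x k / sqrt (\<Sum>i | x i \<noteq> 0. x i ^ 2))"

lemma normalize_seq_nsphere:
  assumes "\<And>i. n < i \<Longrightarrow> x i = 0"
  shows "normalize_seq x = (\<lambda>k. x k / sqrt (\<Sum>i\<le>n. x i ^ 2))"
  using assms by (simp add: normalize_seq_def sum_over_support[of n x])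

lemma normalize_seq_uminus: "normalize_seq (\<lambda>k. - x k) = antipode (normalize_seq x)"
  by (simp add: normalize_seq_def antipode_def)

lemma normalize_seq_id:
  assumes "x \<in> topspace (nsphere n)" shows "normalize_seq x = x"
  using assms by (simp add: topspace_nsphere normalize_seq_nsphere[of n])

lemma continuous_map_normalize_seq:
  assumes g: "\<And>k. continuous_map Z euclideanreal (\<lambda>z. g z k)"
    and supp: "\<And>z i. z \<in> topspace Z \<Longrightarrow> n < i \<Longrightarrow> g z i = 0"
    and nz: "\<And>z. z \<in> topspace Z \<Longrightarrow> \<exists>k. g z k \<noteq> 0"
  shows "continuous_map Z (nsphere n) (\<lambda>z. normalize_seq (g z))"
proof -
  have pos: "0 < (\<Sum>i\<le>n. g z i ^ 2)" if z: "z \<in> topspace Z" for z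
  proof -
    obtain k where "g z k \<noteq> 0" using nz[OF z] by blast
    moreover from this have "k \<le> n" using supp[OF z, of k] by (metis not_le)
    ultimately show ?thesis by (intro sum_pos2[of _ k]) auto
  qed
  have "continuous_map Z euclideanreal (\<lambda>z. g z k / sqrt (\<Sum>i\<le>n. g z i ^ 2))" for k
    by (intro continuous_intros g) (use pos in \<open>auto simp: less_le\<close>)
  then have "continuous_map Z euclideanreal (\<lambda>z. normalize_seq (g z) k)" for k
  proof (rule continuous_map_eq)
    fix z assume "z \<in> topspace Z"
    then show "g z k / sqrt (\<Sum>i\<le>n. g z i ^ 2) = normalize_seq (g z) k"
      using normalize_seq_nsphere[of n "g z"] supp by simp
  qed
  then have "continuous_map Z (powertop_real UNIV) (\<lambda>z. normalize_seq (g z))"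
    by (simp add: continuous_map_componentwise_UNIV)
  moreover have "(\<Sum>i\<le>n. normalize_seq (g z) i ^ 2) = 1 \<and> (\<forall>i>n. normalize_seq (g z) i = 0)"
    if z: "z \<in> topspace Z" for z
  proof -
    have "(\<Sum>i\<le>n. normalize_seq (g z) i ^ 2) = (\<Sum>i\<le>n. g z i ^ 2 / (\<Sum>i\<le>n. g z i ^ 2))"
      using pos[OF z] by (simp add: normalize_seq_nsphere[OF supp[OF z]] power_divide)
    also have "\<dots> = 1" using pos[OF z] by (simp flip: sum_divide_distrib)
    finally show ?thesis using supp[OF z] by (simp add: normalize_seq_def)
  qed
  ultimately show ?thesis by (auto simp: nsphere continuous_map_in_subtopology)
qed

lemma quotient_map_infinite_sphere: "quotient_map (sum_topology nsphere UNIV) infinite_sphere snd"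
  unfolding quotient_map_def
proof (intro conjI allI impI)
  show "snd ` topspace (sum_topology nsphere UNIV) = topspace infinite_sphere"
    by (force simp: topspace_infinite_sphere)
  fix U assume "U \<subseteq> topspace infinite_sphere"
  moreover have "{x. (n, x) \<in> {p \<in> topspace (sum_topology nsphere UNIV). snd p \<in> U}} =
      U \<inter> topspace (nsphere n)" for n by auto
  ultimately show "openin (sum_topology nsphere UNIV) {p \<in> topspace (sum_topology nsphere UNIV). snd p \<in> U}
      \<longleftrightarrow> openin infinite_sphere U"
    by (auto simp: openin_sum_topology openin_infinite_sphere topspace_infinite_sphere)
qed

text \<open>Since the unit interval is locally compact, the product of \<open>S\<^sup>\<infinity>\<close> with it carries the direct
  limit topology as well.\<close>

lemma continuous_map_prod_infinite_sphere:
  assumes h: "\<And>n. continuous_map (prod_topology (top_of_set {0..1::real}) (nsphere n)) Y h"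
  shows "continuous_map (prod_topology (top_of_set {0..1::real}) infinite_sphere) Y h"
proof -
  let ?I = "top_of_set {0..1::real}"
  let ?S = "sum_topology nsphere UNIV"
  have quot: "quotient_map (prod_topology ?I ?S) (prod_topology ?I infinite_sphere) (\<lambda>(t, p). (t, snd p))"
  proof (rule quotient_map_prod_right[OF _ _ quotient_map_infinite_sphere])
    show "locally_compact_space ?I"
      by (intro compact_imp_locally_compact_space) (simp add: compact_space_subtopology)
    show "Hausdorff_space ?I \<or> regular_space ?I" by (simp add: Hausdorff_space_subtopology)
  qed
  have "continuous_map (prod_topology ?I ?S) Y (h \<circ> (\<lambda>(t, p). (t, snd p)))"
    unfolding continuous_map_def
  proof (intro conjI allI impI)
    show "h \<circ> (\<lambda>(t, p). (t, snd p)) \<in> topspace (prod_topology ?I ?S) \<rightarrow> topspace Y"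
    proof
      fix q assume "q \<in> topspace (prod_topology ?I ?S)"
      then obtain t n x where q: "q = (t, n, x)" "t \<in> {0..1}" "x \<in> topspace (nsphere n)" by auto
      then have "(t, x) \<in> topspace (prod_topology ?I (nsphere n))" by simp
      then show "(h \<circ> (\<lambda>(t, p). (t, snd p))) q \<in> topspace Y"
        using h[of n] q(1) by (auto simp: continuous_map_def)
    qed
    fix U assume U: "openin Y U"
    let ?O = "{q \<in> topspace (prod_topology ?I ?S). (h \<circ> (\<lambda>(t, p). (t, snd p))) q \<in> U}"
    show "openin (prod_topology ?I ?S) ?O"
      unfolding openin_prod_topology_alt
    proof (intro allI impI)
      fix t p assume tp: "(t, p) \<in> ?O"
      obtain n x where p: "p = (n, x)" by (cases p)
      have "openin (prod_topology ?I (nsphere n)) {q \<in> topspace (prod_topology ?I (nsphere n)). h q \<in> U}"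
        using h U by (rule openin_continuous_map_preimage)
      then have rect: "\<forall>t x. (t, x) \<in> {q \<in> topspace (prod_topology ?I (nsphere n)). h q \<in> U} \<longrightarrow>
        (\<exists>V W. openin ?I V \<and> openin (nsphere n) W \<and> t \<in> V \<and> x \<in> W \<and>
          V \<times> W \<subseteq> {q \<in> topspace (prod_topology ?I (nsphere n)). h q \<in> U})"
        by (simp only: openin_prod_topology_alt)
      have "(t, x) \<in> {q \<in> topspace (prod_topology ?I (nsphere n)). h q \<in> U}" using tp p by auto
      from rect[rule_format, OF this] obtain V W where VW: "openin ?I V" "openin (nsphere n) W"
        "t \<in> V" "x \<in> W" "V \<times> W \<subseteq> {q \<in> topspace (prod_topology ?I (nsphere n)). h q \<in> U}"
        by (elim exE conjE) (rule that)
      have "{y. (m, y) \<in> {n} \<times> W} = (if m = n then W else {})" for m by auto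
      then have "openin ?S ({n} \<times> W)"
        using VW(2) openin_subset[OF VW(2)] by (auto simp: openin_sum_topology)
      moreover have "V \<times> ({n} \<times> W) \<subseteq> ?O" using VW(5) by fastforce
      ultimately show "\<exists>V' W'. openin ?I V' \<and> openin ?S W' \<and> t \<in> V' \<and> p \<in> W' \<and> V' \<times> W' \<subseteq> ?O"
        using VW(1,3,4) p by (intro exI[of _ V] exI[of _ "{n} \<times> W"] conjI) simp_all
    qed
  qed
  with quot show ?thesis by (rule continuous_compose_quotient_map)
qed

text \<open>\<open>Suc n\<close> leaves room for the shift of coordinates, which raises the
  dimension by one.\<close>

lemma homotopy_infinite_sphere:
  assumes g: "\<And>n k. continuous_map (prod_topology (top_of_set {0..1::real}) (nsphere n)) euclideanreal (\<lambda>q. g q k)"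
    and supp: "\<And>n t x i. t \<in> {0..1} \<Longrightarrow> x \<in> topspace (nsphere n) \<Longrightarrow> Suc n < i \<Longrightarrow> g (t, x) i = 0"
    and nz: "\<And>n t x. t \<in> {0..1} \<Longrightarrow> x \<in> topspace (nsphere n) \<Longrightarrow> \<exists>k. g (t, x) k \<noteq> 0"
  shows "continuous_map (prod_topology (top_of_set {0..1::real}) infinite_sphere) infinite_sphere
    (\<lambda>q. normalize_seq (g q))"
proof (rule continuous_map_prod_infinite_sphere)
  fix n
  have "continuous_map (prod_topology (top_of_set {0..1::real}) (nsphere n)) (nsphere (Suc n))
      (\<lambda>q. normalize_seq (g q))"
    by (rule continuous_map_normalize_seq) (use g supp nz in auto)
  from continuous_map_compose[OF this continuous_map_nsphere_infinite_sphere]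
  show "continuous_map (prod_topology (top_of_set {0..1::real}) (nsphere n)) infinite_sphere
      (\<lambda>q. normalize_seq (g q))" by (simp add: o_def)
qed

definition shift_seq :: "(nat \<Rightarrow> real) \<Rightarrow> nat \<Rightarrow> real" where
  "shift_seq x k = (case k of 0 \<Rightarrow> 0 | Suc j \<Rightarrow> x j)"

definition unit_seq :: "nat \<Rightarrow> real" where
  "unit_seq k = (if k = 0 then 1 else 0)"

lemma nsphere_nonzero:
  assumes "x \<in> topspace (nsphere n)" shows "\<exists>k. x k \<noteq> 0"
proof (rule ccontr)
  assume "\<nexists>k. x k \<noteq> 0"
  then have "(\<Sum>i\<le>n. x i ^ 2) = 0" by simp
  with assms show False by (simp add: topspace_nsphere)
qed

text \<open>The identity is joined to the shift by normalised segments, and the shift to the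
  constant \<open>unit_seq\<close>. The second family of segments avoids 0 because a shifted
  sequence has zeroth coordinate 0.\<close>

lemma acyclic_infinite_sphere:
  assumes c: "cocycle q infinite_sphere c"
  shows "reduced_coboundary q infinite_sphere c"
proof -
  let ?I = "top_of_set {0..1::real}"
  define g where "g p k = (1 - fst p) * snd p k + fst p * shift_seq (snd p) k" for p :: "real \<times> (nat \<Rightarrow> real)" and k
  define g' where "g' p k = (1 - fst p) * shift_seq (snd p) k + fst p * unit_seq k"
    for p :: "real \<times> (nat \<Rightarrow> real)" and k
  have fst: "continuous_map (prod_topology ?I (nsphere n)) euclideanreal fst" for n
    using continuous_map_into_fulltopology[OF continuous_map_fst] by blast
  have snd: "continuous_map (prod_topology ?I (nsphere n)) euclideanreal (\<lambda>p. snd p k)" for n k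
    using continuous_map_compose[OF continuous_map_snd continuous_map_nsphere_projection]
    by (simp add: o_def)
  have shift: "continuous_map (prod_topology ?I (nsphere n)) euclideanreal (\<lambda>p. shift_seq (snd p) k)" for n k
    by (cases k) (simp_all add: shift_seq_def snd)
  have h: "continuous_map (prod_topology ?I infinite_sphere) infinite_sphere (\<lambda>p. normalize_seq (g p))"
  proof (rule homotopy_infinite_sphere)
    show "continuous_map (prod_topology ?I (nsphere n)) euclideanreal (\<lambda>p. g p k)" for n k
      unfolding g_def by (intro continuous_intros fst snd shift)
    show "g (t, x) i = 0" if "t \<in> {0..1}" "x \<in> topspace (nsphere n)" "Suc n < i" for n t x i
      using that by (auto simp: g_def shift_seq_def topspace_nsphere split: nat.split)
    show "\<exists>k. g (t, x) k \<noteq> 0" if t: "t \<in> {0..1}" and x: "x \<in> topspace (nsphere n)" for n t x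
    proof -
      \<comment> \<open>At the first nonzero coordinate of x the shifted sequence still vanishes, so
        for t < 1 the segment is nonzero there.\<close>
      define k where "k = (LEAST k. x k \<noteq> 0)"
      have k: "x k \<noteq> 0" unfolding k_def using nsphere_nonzero[OF x] by (rule LeastI_ex)
      have less: "x j = 0" if "j < k" for j using not_less_Least that unfolding k_def by blast
      show ?thesis
      proof (cases "t = 1")
        case True
        then have "g (t, x) (Suc k) \<noteq> 0" using k by (simp add: g_def shift_seq_def)
        then show ?thesis by blast
      next
        case False
        have "shift_seq x k = 0" using less by (simp add: shift_seq_def split: nat.split)
        then have "g (t, x) k \<noteq> 0" using k False by (simp add: g_def)
        then show ?thesis by blast
      qed
    qed
  qed
  have h': "continuous_map (prod_topology ?I infinite_sphere) infinite_sphere (\<lambda>p. normalize_seq (g' p))"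
  proof (rule homotopy_infinite_sphere)
    show "continuous_map (prod_topology ?I (nsphere n)) euclideanreal (\<lambda>p. g' p k)" for n k
      unfolding g'_def by (intro continuous_intros fst shift)
    show "g' (t, x) i = 0" if "t \<in> {0..1}" "x \<in> topspace (nsphere n)" "Suc n < i" for n t x i
      using that by (auto simp: g'_def shift_seq_def unit_seq_def topspace_nsphere split: nat.split)
    show "\<exists>k. g' (t, x) k \<noteq> 0" if t: "t \<in> {0..1}" and x: "x \<in> topspace (nsphere n)" for n t x
    proof (cases "t = 0")
      case True
      obtain k where "x k \<noteq> 0" using nsphere_nonzero[OF x] by blast
      then have "g' (t, x) (Suc k) \<noteq> 0" using True by (simp add: g'_def shift_seq_def)
      then show ?thesis by blast
    next
      case False
      then have "g' (t, x) 0 \<noteq> 0" by (simp add: g'_def shift_seq_def unit_seq_def)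
      then show ?thesis by blast
    qed
  qed
  have u: "unit_seq \<in> topspace (nsphere 0)" by (simp add: topspace_nsphere unit_seq_def)
  then have "normalize_seq unit_seq \<in> topspace infinite_sphere"
    using normalize_seq_id[OF u] by (auto simp: topspace_infinite_sphere)
  then have "reduced_coboundary q infinite_sphere (\<lambda>zs. c (map (\<lambda>z. normalize_seq unit_seq) zs))"
    using c by (rule constant_map_reduced_coboundary[rotated])
  then have "reduced_coboundary q infinite_sphere (\<lambda>zs. c (map (\<lambda>z. normalize_seq (g' (1, z))) zs))"
    by (simp add: g'_def[abs_def])
  then have "reduced_coboundary q infinite_sphere (\<lambda>zs. c (map (\<lambda>z. normalize_seq (g' (0, z))) zs))"
    by (rule homotopy_reduced_coboundary[OF h' c])
  then have "reduced_coboundary q infinite_sphere (\<lambda>zs. c (map (\<lambda>z. normalize_seq (g (1, z))) zs))"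
    by (simp add: g'_def[abs_def] g_def[abs_def])
  then have "reduced_coboundary q infinite_sphere (\<lambda>zs. c (map (\<lambda>z. normalize_seq (g (0, z))) zs))"
    by (rule homotopy_reduced_coboundary[OF h c])
  then show ?thesis
  proof (rule reduced_coboundary_cong)
    fix xs :: "(nat \<Rightarrow> real) list" assume "set xs \<subseteq> topspace infinite_sphere"
    then have "map (\<lambda>z. normalize_seq (g (0, z))) xs = xs"
      by (intro map_idI) (auto simp: g_def[abs_def] topspace_infinite_sphere dest: normalize_seq_id)
    then show "c xs = c (map (\<lambda>z. normalize_seq (g (0, z))) xs)" by simp
  qed
qed

section \<open>The double covering of infinite projective space\<close>

definition seq_inner :: "(nat \<Rightarrow> real) \<Rightarrow> (nat \<Rightarrow> real) \<Rightarrow> real" where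
  "seq_inner x y = (\<Sum>i | x i \<noteq> 0. x i * y i)"

lemma seq_inner_nsphere: "x \<in> topspace (nsphere n) \<Longrightarrow> seq_inner x y = (\<Sum>i\<le>n. x i * y i)"
  unfolding seq_inner_def by (rule sum_over_support) (auto simp: topspace_nsphere)

lemma seq_inner_antipode: "seq_inner (antipode x) y = - seq_inner x y" "seq_inner x (antipode y) = - seq_inner x y"
  by (simp_all add: seq_inner_def antipode_def sum_negf)

lemma infinite_sphere_antipode: "x \<in> topspace infinite_sphere \<Longrightarrow> antipode x \<in> topspace infinite_sphere"
  by (auto simp: topspace_infinite_sphere topspace_nsphere antipode_def)

lemma antipode_antipode [simp]: "antipode (antipode x) = x"
  by (simp add: antipode_def)

text \<open>A homotopy constant in time reuses the passage to the direct limit; on the sphere the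
  normalisation changes nothing.\<close>

lemma continuous_map_antipode: "continuous_map infinite_sphere infinite_sphere antipode"
proof -
  have "continuous_map (prod_topology (top_of_set {0..1::real}) infinite_sphere) infinite_sphere
      (\<lambda>q. normalize_seq (antipode (snd q)))"
  proof (rule homotopy_infinite_sphere)
    show "continuous_map (prod_topology (top_of_set {0..1::real}) (nsphere n)) euclideanreal
        (\<lambda>q. antipode (snd q) k)" for n k
      using continuous_map_compose[OF continuous_map_snd continuous_map_nsphere_projection]
      unfolding antipode_def by (intro continuous_map_minus) (simp add: o_def)
    show "\<exists>k. antipode (snd (t, x)) k \<noteq> 0" if "t \<in> {0..1}" "x \<in> topspace (nsphere n)"
      for n and t :: real and x
      using nsphere_nonzero[OF that(2)] by (simp add: antipode_def)
  qed (auto simp: antipode_def topspace_nsphere)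
  from continuous_map_compose[OF _ this, of infinite_sphere "\<lambda>x. (0, x)"]
  have "continuous_map infinite_sphere infinite_sphere (\<lambda>x. normalize_seq (antipode x))"
    by (simp add: continuous_map_pairwise o_def)
  then show ?thesis
  proof (rule continuous_map_eq)
    fix x assume "x \<in> topspace infinite_sphere"
    then have "antipode x \<in> topspace infinite_sphere" by (rule infinite_sphere_antipode)
    then show "normalize_seq (antipode x) = antipode x"
      by (auto simp: topspace_infinite_sphere dest: normalize_seq_id)
  qed
qed

text \<open>The bound 7/8 puts x and y at distance below 1/2 from a, hence below 1 from each other,
  while unit vectors closer than the square root of 2 have positive inner product. All three lie in
  a common finite-dimensional sphere.\<close>

lemma seq_inner_pos:
  assumes "a \<in> topspace infinite_sphere" "x \<in> topspace infinite_sphere" "y \<in> topspace infinite_sphere"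
    and "seq_inner a x > 7/8" "seq_inner a y > 7/8"
  shows "seq_inner x y > 0"
proof -
  obtain n1 n2 n3 where "a \<in> topspace (nsphere n1)" "x \<in> topspace (nsphere n2)" "y \<in> topspace (nsphere n3)"
    using assms by (auto simp: topspace_infinite_sphere)
  moreover define n where "n = max n1 (max n2 n3)"
  ultimately have n: "a \<in> topspace (nsphere n)" "x \<in> topspace (nsphere n)" "y \<in> topspace (nsphere n)"
    using nsphere_mono[of n1 n] nsphere_mono[of n2 n] nsphere_mono[of n3 n] by (auto simp: subset_iff)
  have unit: "(\<Sum>i\<le>n. a i ^ 2) = 1" "(\<Sum>i\<le>n. x i ^ 2) = 1" "(\<Sum>i\<le>n. y i ^ 2) = 1"
    using n by (auto simp: topspace_nsphere)
  have dist: "(\<Sum>i\<le>n. (u i - v i) ^ 2) = 2 - 2 * (\<Sum>i\<le>n. u i * v i)"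
    if "(\<Sum>i\<le>n. u i ^ 2) = 1" "(\<Sum>i\<le>n. v i ^ 2) = 1" for u v :: "nat \<Rightarrow> real"
    using that by (simp add: power2_diff sum.distrib sum_subtractf sum_distrib_left mult.assoc)
  have "(\<Sum>i\<le>n. (x i - y i) ^ 2) \<le> (\<Sum>i\<le>n. 2 * (a i - x i) ^ 2 + 2 * (a i - y i) ^ 2)"
  proof (rule sum_mono)
    fix i
    have "0 \<le> ((a i - x i) + (a i - y i)) ^ 2" by simp
    then show "(x i - y i) ^ 2 \<le> 2 * (a i - x i) ^ 2 + 2 * (a i - y i) ^ 2"
      by (simp add: power2_eq_square algebra_simps)
  qed
  also have "\<dots> = 2 * (\<Sum>i\<le>n. (a i - x i) ^ 2) + 2 * (\<Sum>i\<le>n. (a i - y i) ^ 2)"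
    by (simp add: sum.distrib sum_distrib_left)
  finally show ?thesis
    using assms(4,5) n by (simp add: dist unit seq_inner_nsphere)
qed

text \<open>Locally, two points are on the same sheet iff their inner product is positive.\<close>

lemma ex_double_cover_infinite_sphere:
  "\<exists>w \<sigma>. double_cover infinite_sphere antipode w \<sigma>"
proof -
  let ?S = "topspace infinite_sphere"
  \<comment> \<open>One point of every antipodal pair is chosen; \<sigma> tells whether x is the
    chosen one. For x, y with positive inner product, the sign of the product of the chosen points
    shows whether the two choices agree.\<close>
  define r where "r o' = (SOME x. x \<in> o')" for o' :: "(nat \<Rightarrow> real) set"
  define \<sigma> :: "(nat \<Rightarrow> real) \<Rightarrow> bit" where "\<sigma> x = (if r (orbit_pair antipode x) = x then 0 else 1)" for x
  define w :: "(nat \<Rightarrow> real) set list \<Rightarrow> bit" where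
    "w ys = (if seq_inner (r (ys ! 0)) (r (ys ! 1)) > 0 then 0 else 1)" for ys
  have neq: "antipode x \<noteq> x" if x: "x \<in> ?S" for x
  proof
    assume eq: "antipode x = x"
    obtain n where "x \<in> topspace (nsphere n)" using x by (auto simp: topspace_infinite_sphere)
    then obtain k where "x k \<noteq> 0" using nsphere_nonzero by blast
    moreover have "- x k = x k" using fun_cong[OF eq, of k] by (simp add: antipode_def)
    ultimately show False by simp
  qed
  have r: "r (orbit_pair antipode x) \<in> {x, antipode x}" for x
    unfolding r_def orbit_pair_def by (rule someI[of _ x]) simp
  have pair: "orbit_pair antipode (antipode x) = orbit_pair antipode x" for x
    by (auto simp: orbit_pair_def)
  have "double_cover infinite_sphere antipode w \<sigma>"
  proof
    show "continuous_map infinite_sphere infinite_sphere antipode" by (rule continuous_map_antipode)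
    show "\<sigma> (antipode x) = 1 + \<sigma> x" if "x \<in> ?S" for x
      using r[of x] neq[OF that] by (auto simp: \<sigma>_def pair)
    fix a assume a: "a \<in> ?S"
    let ?V = "{y \<in> ?S. seq_inner a y > 7/8}"
    obtain n where n: "a \<in> topspace (nsphere n)" using a by (auto simp: topspace_infinite_sphere)
    have "openin infinite_sphere ?V"
      unfolding openin_infinite_sphere
    proof (intro conjI allI)
      show "?V \<subseteq> (\<Union>n. topspace (nsphere n))" by (auto simp: topspace_infinite_sphere)
      fix m
      have "continuous_map (nsphere m) euclideanreal (\<lambda>y. \<Sum>i\<le>n. a i * y i)"
        by (intro continuous_intros continuous_map_nsphere_projection) simp
      then have "openin (nsphere m) {y \<in> topspace (nsphere m). (\<Sum>i\<le>n. a i * y i) \<in> {7/8<..}}"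
        by (rule openin_continuous_map_preimage) simp
      then show "openin (nsphere m) (?V \<inter> topspace (nsphere m))"
        by (rule back_subst[of "openin (nsphere m)"])
          (auto simp: seq_inner_nsphere[OF n] topspace_infinite_sphere)
    qed
    moreover have "a \<in> ?V"
      using a n by (simp add: seq_inner_nsphere) (simp add: topspace_nsphere power2_eq_square)
    moreover have "w [orbit_pair antipode x, orbit_pair antipode y] = \<sigma> x + \<sigma> y"
      if "x \<in> ?V" "y \<in> ?V" for x y
    proof -
      have pos: "seq_inner x y > 0" using seq_inner_pos[OF a, of x y] that by simp
      then show ?thesis
        using r[of x] r[of y] neq[of x] neq[of y] that
        by (auto simp: w_def \<sigma>_def seq_inner_antipode)
    qed
    ultimately show "\<exists>V. openin infinite_sphere V \<and> a \<in> V \<and> (\<forall>x\<in>V. \<forall>y\<in>V.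
        w [orbit_pair antipode x, orbit_pair antipode y] = \<sigma> x + \<sigma> y)" by blast
  qed simp
  then show ?thesis by blast
qed

section \<open>The cohomological index\<close>

lemma bit_eq_0_or_1: "(\<epsilon>::bit) = 0 \<or> \<epsilon> = 1"
  by (cases \<epsilon>) simp_all

lemma infinite_sphere_nonempty: "topspace infinite_sphere \<noteq> {}"
  using in_topspace_nsphere unfolding topspace_infinite_sphere by blast

text \<open>The Gysin lemmas over the acyclic infinite sphere show that the class of w is a
  generator. It is the only one: degree 1 contains only 0 and this class, and the first power of 0
  is 0.\<close>

lemma RP_generator_eq:
  assumes "double_cover infinite_sphere antipode w \<sigma>"
  shows "RP_generator = AS_class 1 RP_infinity w"
proof -
  interpret double_cover infinite_sphere antipode w \<sigma> by fact
  note P_def = RP_infinity_def[symmetric]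
  have w: "cocycle 1 RP_infinity w" using cocycle_w by (simp add: P_def)
  have power: "AS_cup_power RP_infinity (AS_class 1 RP_infinity w) q = AS_class q RP_infinity (cup_power w q)" for q
    by (rule AS_cup_power_class[OF w])
  have nt: "\<not> coboundary q RP_infinity (cup_power w q)" for q
    using cup_power_not_coboundary[OF acyclic_infinite_sphere infinite_sphere_nonempty] by (simp add: P_def)
  have carrier: "carrier (AS_cohomology_group q RP_infinity) =
      {\<one>\<^bsub>AS_cohomology_group q RP_infinity\<^esub>, AS_class q RP_infinity (cup_power w q)}" for q
  proof (intro subset_antisym subsetI)
    fix K assume "K \<in> carrier (AS_cohomology_group q RP_infinity)"
    then obtain \<phi> where \<phi>: "cocycle q RP_infinity \<phi>" "K = AS_class q RP_infinity \<phi>"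
      by (auto simp: carrier_AS_cohomology_group)
    obtain \<epsilon> where "coboundary q RP_infinity (\<lambda>ys. \<phi> ys + \<epsilon> * cup_power w q ys)"
      using cocycle_eq_cup_power[OF acyclic_infinite_sphere] \<phi>(1) unfolding P_def by blast
    then show "K \<in> {\<one>\<^bsub>AS_cohomology_group q RP_infinity\<^esub>, AS_class q RP_infinity (cup_power w q)}"
      using bit_eq_0_or_1[of \<epsilon>] by (auto simp: \<phi>(2) AS_class_eq_one_iff AS_class_eq_iff)
  next
    fix K assume "K \<in> {\<one>\<^bsub>AS_cohomology_group q RP_infinity\<^esub>, AS_class q RP_infinity (cup_power w q)}"
    then show "K \<in> carrier (AS_cohomology_group q RP_infinity)"
      using cocycle_cup_power[OF w, of q] locally_zero_imp_cocycle[OF locally_zero_0]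
      by (auto simp: carrier_AS_cohomology_group one_AS_cohomology_group)
  qed
  have gen: "AS_polynomial_generator RP_infinity (AS_class 1 RP_infinity w)"
    unfolding AS_polynomial_generator_def power
  proof (intro conjI allI)
    show "AS_class 1 RP_infinity w \<in> carrier (AS_cohomology_group 1 RP_infinity)"
      unfolding carrier_AS_cohomology_group using w by blast
  qed (use nt in \<open>simp add: AS_class_eq_one_iff\<close>, rule carrier)
  moreover have "\<omega> = AS_class 1 RP_infinity w" if \<omega>: "AS_polynomial_generator RP_infinity \<omega>" for \<omega>
  proof (rule ccontr)
    assume "\<omega> \<noteq> AS_class 1 RP_infinity w"
    moreover have "\<omega> \<in> carrier (AS_cohomology_group 1 RP_infinity)"
      using \<omega> unfolding AS_polynomial_generator_def by blast
    then have "\<omega> \<in> {\<one>\<^bsub>AS_cohomology_group 1 RP_infinity\<^esub>, AS_class 1 RP_infinity (cup_power w 1)}"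
      by (simp only: carrier)
    moreover have "AS_class 1 RP_infinity (cup_power w 1) = AS_class 1 RP_infinity w"
      by (rule AS_class_cong) (simp add: cup_def)
    ultimately have "\<omega> = AS_class 1 RP_infinity (\<lambda>_. 0)" by (simp add: one_AS_cohomology_group)
    then have "AS_cup_power RP_infinity \<omega> 1 = AS_class 1 RP_infinity (cup_power (\<lambda>_. 0) 1)"
      by (simp only: AS_cup_power_class[OF locally_zero_imp_cocycle[OF locally_zero_0]])
    also have "\<dots> = \<one>\<^bsub>AS_cohomology_group 1 RP_infinity\<^esub>"
      unfolding one_AS_cohomology_group by (rule AS_class_cong) (simp add: cup_def)
    finally show False using \<omega> unfolding AS_polynomial_generator_def by blast
  qed
  ultimately show ?thesis unfolding RP_generator_def by (rule the_equality)
qed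

section \<open>Equivariant maps into the infinite sphere\<close>

lemma infdist_uminus: "infdist (- y) (uminus ` A) = infdist y (A::'a::real_normed_vector set)"
proof -
  have "dist (- y) (- x) = dist y x" for x by (simp add: dist_norm norm_minus_commute)
  then show ?thesis by (simp add: infdist_def image_image)
qed

text \<open>
  The doubly indexed sets in A. H. Stone's theorem on the paracompactness of metric spaces, applied
  to the cover of the unit sphere by pairs of antipodal balls, separate the points of each pair.
\<close>

lemma odd_functions_without_common_zero:
  obtains f :: "nat \<Rightarrow> 'a::real_normed_vector \<Rightarrow> real"
  where "\<And>n. continuous_on UNIV (f n)" "\<And>n y. f n (- y) = - f n y"
    "\<And>n y. norm y = 1 \<Longrightarrow> \<bar>f n y\<bar> \<le> 2" "\<And>y. norm y = 1 \<Longrightarrow> \<exists>n. f n y \<noteq> 0"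
proof -
  obtain r :: "'a rel" where r: "well_order_on UNIV r" using well_order_on by blast
  then have wf: "wf (r - Id)" and antisym: "antisym r" and total: "total_on UNIV r" and refl: "refl r"
    by (auto simp: well_order_on_def linear_order_on_def partial_order_on_def preorder_on_def)
  \<comment> \<open>For x of norm 1 the two balls of radius 1/2 are disjoint, so the sign of the
    nearer centre is well defined on \<open>C x\<close>.\<close>
  define C :: "'a \<Rightarrow> 'a set" where "C x = {y. norm (y - x) < 1/2 \<or> norm (y + x) < 1/2}" for x
  have C_uminus: "- y \<in> C x \<longleftrightarrow> y \<in> C x" for x y
    using norm_minus_cancel[of "y + x"] norm_minus_cancel[of "y - x"] by (auto simp: C_def)
  define least where "least y x \<longleftrightarrow> norm x = 1 \<and> y \<in> C x \<and> (\<forall>x'. norm x' = 1 \<longrightarrow> y \<in> C x' \<longrightarrow> (x, x') \<in> r)" for x y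
  define L where "L y = (SOME x. least y x)" for y
  have L: "least y (L y)" if y: "norm y = 1" for y
    unfolding L_def
  proof (rule someI_ex)
    have "y \<in> {x. norm x = 1 \<and> y \<in> C x}" using y by (simp add: C_def)
    from wf[unfolded wf_eq_minimal, rule_format, OF this]
    obtain x where x: "x \<in> {x. norm x = 1 \<and> y \<in> C x}"
      "\<forall>x'. (x', x) \<in> r - Id \<longrightarrow> x' \<notin> {x. norm x = 1 \<and> y \<in> C x}"
      by (elim bexE)
    have "(x, x') \<in> r" if "norm x' = 1" "y \<in> C x'" for x'
      using that x(2)[rule_format, of x'] total refl by (cases "x' = x") (auto simp: total_on_def refl_on_def)
    with x(1) show "\<exists>x. least y x" by (auto simp: least_def)
  qed
  have L_uminus: "L (- y) = L y" for y by (simp add: L_def least_def C_uminus)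
  define E where "E n = {y. norm y = 1 \<and> (\<forall>z. norm z = 1 \<longrightarrow> norm (z - y) < 1 / real (Suc n) \<longrightarrow> z \<in> C (L y))}" for n
  have E_uminus: "- y \<in> E n" if y: "y \<in> E n" for y n
  proof -
    have "z \<in> C (L y)" if z: "norm z = 1" "norm (z - (- y)) < 1 / real (Suc n)" for z
    proof -
      have "norm (- z - y) < 1 / real (Suc n)"
        using z(2) norm_minus_cancel[of "z + y"] by simp
      then have "- z \<in> C (L y)" using y z(1) by (simp add: E_def)
      then show ?thesis by (simp add: C_uminus)
    qed
    with y show ?thesis by (simp add: E_def L_uminus)
  qed
  define Ep where "Ep n = {y \<in> E n. norm (y - L y) < 1/2}" for n
  define Em where "Em n = {y \<in> E n. norm (y + L y) < 1/2}" for n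
  have Ep_uminus: "- y \<in> Em n" if "y \<in> Ep n" for y n
    using that E_uminus[of y n] norm_minus_cancel[of "y - L y"] by (simp add: Ep_def Em_def L_uminus)
  have Em_uminus: "- y \<in> Ep n" if "y \<in> Em n" for y n
    using that E_uminus[of y n] norm_minus_cancel[of "y + L y"] by (simp add: Ep_def Em_def L_uminus)
  have image_Ep: "uminus ` Ep n = Em n" for n
  proof (intro subset_antisym subsetI)
    show "y \<in> uminus ` Ep n" if "y \<in> Em n" for y
      using Em_uminus[OF that] by (metis image_eqI minus_minus)
  qed (use Ep_uminus in auto)
  have image_Em: "uminus ` Em n = Ep n" for n
    unfolding image_Ep[symmetric] by (simp add: image_image)
  have far: "1 / real (Suc n) \<le> norm (y - y')" if y: "y \<in> Ep n" and y': "y' \<in> Em n" for n y y'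
  proof (rule ccontr)
    assume "\<not> ?thesis"
    then have close: "norm (y' - y) < 1 / real (Suc n)" "norm (y - y') < 1 / real (Suc n)"
      by (simp_all add: norm_minus_commute)
    have norms: "norm y = 1" "norm y' = 1" using y y' by (auto simp: Ep_def Em_def E_def)
    have C: "y' \<in> C (L y)" "y \<in> C (L y')"
      using y y' close norms by (auto simp: Ep_def Em_def E_def)
    \<comment> \<open>Each point lies in the pair of balls selected by the other, so minimality of
      both choices forces the centres to coincide.\<close>
    then have "(L y, L y') \<in> r" "(L y', L y) \<in> r"
      using L[OF norms(1)] L[OF norms(2)] by (auto simp: least_def)
    with antisym have eq: "L y' = L y" by (auto simp: antisym_def)
    have "norm (L y) = 1" using L[OF norms(1)] by (simp add: least_def)
    \<comment> \<open>Two radii 1/2 and a gap below 1 cannot bridge the distance 2 between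
      \<open>L y\<close> and its negative.\<close>
    then have "2 = norm ((L y - y) + (y - y') + (y' + L y))"
      using norm_scaleR[of 2 "L y"] by (simp add: scaleR_2)
    also have "\<dots> \<le> norm (L y - y) + norm (y - y') + norm (y' + L y)"
      by (intro norm_triangle_le add_right_mono norm_triangle_ineq order_refl)
    also have "\<dots> < 1/2 + 1 / real (Suc n) + 1/2"
      using y y' close eq by (intro add_strict_mono) (auto simp: Ep_def Em_def norm_minus_commute)
    also have "\<dots> \<le> 2" by simp
    finally show False by simp
  qed
  define f where "f n y = infdist y (Em n) - infdist y (Ep n)" for n y
  have f_uminus: "f n (- y) = - f n y" for n y
    using infdist_uminus[of y "Ep n"] infdist_uminus[of y "Em n"] by (simp add: f_def image_Ep image_Em)
  have pos: "f n y > 0" if y: "y \<in> Ep n" for n y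
  proof -
    \<comment> \<open>\<open>- y\<close> witnesses that \<open>Em n\<close> is not empty; the
      distance to the empty set would be 0 by convention.\<close>
    have "1 / real (Suc n) \<le> infdist y (Em n)"
      using Ep_uminus[OF y] far[OF y] by (subst infdist_notempty) (auto intro!: cINF_greatest simp: dist_norm)
    moreover have "infdist y (Ep n) = 0" using y by simp
    moreover have "0 < 1 / real (Suc n)" by simp
    ultimately show ?thesis unfolding f_def by linarith
  qed
  show thesis
  proof (rule that[of f])
    show "continuous_on UNIV (f n)" for n unfolding f_def by (intro continuous_intros)
    show "f n (- y) = - f n y" for n y by (rule f_uminus)
    show "\<bar>f n y\<bar> \<le> 2" if y: "norm y = 1" for n y
    proof -
      have "infdist y S \<le> 2" if S: "\<And>z. z \<in> S \<Longrightarrow> norm z = 1" for S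
      proof (cases "S = {}")
        case False
        then obtain z where "z \<in> S" by blast
        then have "infdist y S \<le> dist y z" by (rule infdist_le)
        also have "\<dots> \<le> norm y + norm z" unfolding dist_norm by (rule norm_triangle_ineq4)
        finally show ?thesis using y S[OF \<open>z \<in> S\<close>] by simp
      qed (simp add: infdist_def)
      from this[of "Em n"] this[of "Ep n"] infdist_nonneg[of y "Em n"] infdist_nonneg[of y "Ep n"]
      show ?thesis unfolding f_def by (auto simp: Em_def Ep_def E_def abs_le_iff)
    qed
    show "\<exists>n. f n y \<noteq> 0" if y: "norm y = 1" for y
    proof -
      have "open (C (L y))" unfolding C_def
        by (intro open_Collect_disj open_Collect_less continuous_intros)
      moreover have yC: "y \<in> C (L y)" using L[OF y] by (simp add: least_def)
      ultimately obtain e where e: "e > 0" "ball y e \<subseteq> C (L y)" by (meson openE)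
      obtain n where n: "inverse (real (Suc n)) < e" using reals_Archimedean[OF e(1)] by blast
      have "z \<in> C (L y)" if "norm (z - y) < 1 / real (Suc n)" for z
      proof -
        have "dist y z < e" using that n by (simp add: dist_norm norm_minus_commute inverse_eq_divide)
        with e(2) show ?thesis by auto
      qed
      then have "y \<in> E n" using y by (simp add: E_def)
      with yC have "y \<in> Ep n \<or> y \<in> Em n" by (auto simp: C_def Ep_def Em_def)
      then show ?thesis
      proof
        assume "y \<in> Ep n" with pos[of y n] show ?thesis by (intro exI[of _ n]) simp
      next
        assume "y \<in> Em n"
        then have "f n (- y) > 0" by (intro pos Em_uminus)
        then show ?thesis by (intro exI[of _ n]) (simp add: f_uminus)
      qed
    qed
  qed
qed

lemma continuous_map_locally:
  assumes "\<And>x. x \<in> topspace X \<Longrightarrow> \<exists>V. openin X V \<and> x \<in> V \<and> continuous_map (subtopology X V) Y f"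
  shows "continuous_map X Y f"
  unfolding continuous_map_def
proof (intro conjI allI impI)
  have *: "\<exists>V. openin X V \<and> x \<in> V \<and> V \<subseteq> {x \<in> topspace X. f x \<in> U}"
    if U: "openin Y U" and x: "x \<in> topspace X" "f x \<in> U" for U x
  proof -
    obtain V where V: "openin X V" "x \<in> V" "continuous_map (subtopology X V) Y f" using assms x(1) by blast
    have "openin (subtopology X V) {y \<in> topspace (subtopology X V). f y \<in> U}"
      using V(3) U by (rule openin_continuous_map_preimage)
    then have "openin X {y \<in> topspace (subtopology X V). f y \<in> U}"
      using V(1) by (rule openin_trans_full)
    moreover have "x \<in> {y \<in> topspace (subtopology X V). f y \<in> U}" using V(2) x by simp
    moreover have "{y \<in> topspace (subtopology X V). f y \<in> U} \<subseteq> {x \<in> topspace X. f x \<in> U}" by auto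
    ultimately show ?thesis by blast
  qed
  show "f \<in> topspace X \<rightarrow> topspace Y"
  proof
    fix x assume x: "x \<in> topspace X"
    then obtain V where "openin X V" "x \<in> V" "continuous_map (subtopology X V) Y f" using assms by blast
    with x show "f x \<in> topspace Y" by (auto simp: continuous_map_def)
  qed
  fix U assume "openin Y U"
  then show "openin X {x \<in> topspace X. f x \<in> U}" using * by (subst openin_subopen) blast
qed

text \<open>Dold's trick turns the functions \<open>f n\<close> into a locally finite family \<open>h n\<close>.\<close>

lemma ex_equivariant_map_infinite_sphere:
  "\<exists>F :: 'a::real_normed_vector \<Rightarrow> nat \<Rightarrow> real.
    continuous_map (top_of_set (UNIV - {0})) infinite_sphere F \<and> (\<forall>u. F (- u) = antipode (F u))"
proof -
  obtain f :: "nat \<Rightarrow> 'a \<Rightarrow> real" where f: "\<And>n. continuous_on UNIV (f n)" "\<And>n y. f n (- y) = - f n y"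
    "\<And>n y. norm y = 1 \<Longrightarrow> \<bar>f n y\<bar> \<le> 2" "\<And>y. norm y = 1 \<Longrightarrow> \<exists>n. f n y \<noteq> 0"
    using odd_functions_without_common_zero by metis
  define g where "g n u = f n (sphere_proj u)" for n u
  define h where "h n u = g n u * max 0 (\<bar>g n u\<bar> - real n * (\<Sum>j<n. \<bar>g j u\<bar>))" for n u
  have norm_proj: "norm (sphere_proj u) = 1" if "u \<noteq> 0" for u :: 'a
    using that by (simp add: sphere_proj_def)
  have g_cont: "continuous_on (UNIV - {0}) (g n)" for n
  proof -
    have "continuous_on (UNIV - {0}) (sphere_proj :: 'a \<Rightarrow> 'a)"
      unfolding sphere_proj_def by (intro continuous_intros) simp
    then show ?thesis unfolding g_def
      by (rule continuous_on_compose2[OF f(1)]) simp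
  qed
  have h_cont: "continuous_on (UNIV - {0}) (h n)" for n
    unfolding h_def by (intro continuous_intros g_cont)
  define F where "F u = normalize_seq (\<lambda>n. h n u)" for u
  show ?thesis
  proof (intro exI[of _ F] conjI allI)
    have "h n (- u) = - h n u" for n u
      by (simp add: h_def g_def sphere_proj_def f(2))
    then show "F (- u) = antipode (F u)" for u
      by (simp add: F_def normalize_seq_uminus)
    show "continuous_map (top_of_set (UNIV - {0})) infinite_sphere F"
    proof (rule continuous_map_locally)
      fix u :: 'a assume "u \<in> topspace (top_of_set (UNIV - {0}))"
      then have u: "u \<noteq> 0" by simp
      \<comment> \<open>For the least such index the subtracted sum vanishes at u, so
        \<open>h m u\<close> is nonzero.\<close>
      define m where "m = (LEAST m. g m u \<noteq> 0)"
      have m: "g m u \<noteq> 0"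
        unfolding m_def by (rule LeastI_ex[of "\<lambda>m. g m u \<noteq> 0"]) (use f(4)[OF norm_proj[OF u]] in \<open>simp add: g_def\<close>)
      have "g j u = 0" if "j < m" for j using that not_less_Least unfolding m_def by blast
      then have hm: "h m u \<noteq> 0" using m by (simp add: h_def)
      define e where "e = \<bar>g m u\<bar> / 2"
      have e: "e > 0" using m by (simp add: e_def)
      define V where "V = {v \<in> UNIV - {0}. e < \<bar>g m v\<bar> \<and> h m v \<noteq> 0}"
      have "openin (top_of_set (UNIV - {0})) {v \<in> UNIV - {0}. g m v \<in> {x. e < \<bar>x\<bar>}}"
        by (rule continuous_openin_preimage_gen[OF g_cont, unfolded vimage_def Int_def mem_Collect_eq])
          (intro open_Collect_less continuous_intros)
      moreover have "openin (top_of_set (UNIV - {0})) {v \<in> UNIV - {0}. h m v \<in> - {0}}"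
        by (rule continuous_openin_preimage_gen[OF h_cont, unfolded vimage_def Int_def mem_Collect_eq])
          auto
      ultimately have "openin (top_of_set (UNIV - {0})) ({v \<in> UNIV - {0}. g m v \<in> {x. e < \<bar>x\<bar>}} \<inter>
          {v \<in> UNIV - {0}. h m v \<in> - {0}})" by (rule openin_Int)
      then have V: "openin (top_of_set (UNIV - {0})) V"
        by (rule back_subst[of "openin _"]) (auto simp: V_def)
      obtain N0 where N0: "2 < real N0 * e" using reals_Archimedean3[OF e] by blast
      define N where "N = max N0 m"
      \<comment> \<open>Near u the term with index m contributes at least e to the sum, while
        \<open>\<bar>g n v\<bar> \<le> 2\<close>; as n e > 2, the maximum in \<open>h n v\<close> is
        0.\<close>
      have supp: "h n v = 0" if v: "v \<in> V" and n: "N < n" for n v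
      proof -
        have "m < n" using n by (simp add: N_def)
        then have "\<bar>g m v\<bar> \<le> (\<Sum>j<n. \<bar>g j v\<bar>)" by (intro member_le_sum) auto
        then have "e \<le> (\<Sum>j<n. \<bar>g j v\<bar>)" using v by (simp add: V_def)
        then have "real n * e \<le> real n * (\<Sum>j<n. \<bar>g j v\<bar>)" by (intro mult_left_mono) auto
        moreover have "real N0 * e \<le> real n * e" using n e by (intro mult_right_mono) (auto simp: N_def)
        moreover have "\<bar>g n v\<bar> \<le> 2" using v f(3)[OF norm_proj] by (simp add: g_def V_def)
        ultimately show ?thesis using N0 by (simp add: h_def)
      qed
      have sub: "subtopology (top_of_set (UNIV - {0})) V = top_of_set V"
      proof -
        have "(UNIV - {0}) \<inter> V = V" by (auto simp: V_def)
        then show ?thesis by (simp only: subtopology_subtopology)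
      qed
      have "continuous_map (top_of_set V) (nsphere N) F"
        unfolding F_def
      proof (rule continuous_map_normalize_seq)
        show "continuous_map (top_of_set V) euclideanreal (h k)" for k
          using h_cont[of k] by (auto intro: continuous_on_subset simp: V_def)
        show "h i z = 0" if "z \<in> topspace (top_of_set V)" "N < i" for z i
          using supp that by simp
        show "\<exists>k. h k z \<noteq> 0" if "z \<in> topspace (top_of_set V)" for z
          using that by (intro exI[of _ m]) (simp add: V_def)
      qed
      then have "continuous_map (top_of_set V) infinite_sphere ((\<lambda>x. x) \<circ> F)"
        by (rule continuous_map_compose) (rule continuous_map_nsphere_infinite_sphere)
      then have "continuous_map (subtopology (top_of_set (UNIV - {0})) V) infinite_sphere F"
        unfolding sub o_def .
      moreover have "u \<in> V" using u hm e by (simp add: V_def e_def)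
      ultimately show "\<exists>V. openin (top_of_set (UNIV - {0})) V \<and> u \<in> V \<and>
          continuous_map (subtopology (top_of_set (UNIV - {0})) V) infinite_sphere F"
        using V by blast
    qed
  qed
qed

text \<open>The equivariant map on all nonzero vectors restricts to A, and equivariance makes the
  induced map on pairs independent of the chosen representative.\<close>

lemma is_classifying_map_classifying_map:
  assumes "(0::'a::real_normed_vector) \<notin> A"
  shows "is_classifying_map A (classifying_map A)"
  unfolding classifying_map_def
proof (rule someI_ex[of "is_classifying_map A"])
  obtain F :: "'a \<Rightarrow> nat \<Rightarrow> real" where F: "continuous_map (top_of_set (UNIV - {0})) infinite_sphere F"
    "\<forall>u. F (- u) = antipode (F u)" using ex_equivariant_map_infinite_sphere by blast
  have "top_of_set A = subtopology (top_of_set (UNIV - {0})) A"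
  proof -
    have "(UNIV - {0}) \<inter> A = A" using assms by auto
    then show ?thesis by (simp only: subtopology_subtopology)
  qed
  then have FA: "continuous_map (top_of_set A) infinite_sphere F"
    using F(1) by (simp only: continuous_map_from_subtopology)
  define f where "f y = orbit_pair antipode (F (SOME u. u \<in> y))" for y
  have f: "f (orbit_pair uminus u) = orbit_pair antipode (F u)" for u
  proof -
    have "(SOME v. v \<in> orbit_pair uminus u) \<in> {u, - u}"
      unfolding orbit_pair_def by (rule someI[of _ u]) simp
    then show ?thesis by (auto simp: f_def orbit_pair_def F(2))
  qed
  have "continuous_map (sym_quotient A) RP_infinity f"
    unfolding continuous_map_def
  proof (intro conjI allI impI)
    show "f \<in> topspace (sym_quotient A) \<rightarrow> topspace RP_infinity"
      using FA by (auto simp: sym_quotient_def RP_infinity_def f continuous_map_def)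
    fix U assume U: "openin RP_infinity U"
    have "continuous_map (top_of_set A) RP_infinity (orbit_pair antipode \<circ> F)"
      unfolding RP_infinity_def by (rule continuous_map_compose[OF FA continuous_map_orbit_pair])
    then have "openin (top_of_set A) {u \<in> topspace (top_of_set A). (orbit_pair antipode \<circ> F) u \<in> U}"
      using U by (rule openin_continuous_map_preimage)
    then have "openin (top_of_set A) {u \<in> A. orbit_pair uminus u \<in> {y \<in> orbit_pair uminus ` A. f y \<in> U}}"
      by (rule back_subst[of "openin _"]) (auto simp: f)
    then show "openin (sym_quotient A) {y \<in> topspace (sym_quotient A). f y \<in> U}"
      by (auto simp: sym_quotient_def openin_orbit_space)
  qed
  with FA F(2) f show "\<exists>f. is_classifying_map A f"
    unfolding is_classifying_map_def by blast
qed

text \<open>Removes \<open>classifying_map\<close> and \<open>RP_generator\<close> from the index: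
  the pullback of the characteristic cochain of the infinite sphere is one for the covering of
  A.\<close>

lemma cohomological_index_eq:
  assumes "0 \<notin> A" "A \<noteq> {}" and sym: "symmetric_set A"
  obtains w \<sigma> where "double_cover (top_of_set A) uminus w \<sigma>"
    "cohomological_index A =
      Sup {enat m |m. 1 \<le> m \<and> \<not> coboundary (m - 1) (sym_quotient A) (cup_power w (m - 1))}"
proof -
  obtain w \<sigma> where w: "double_cover infinite_sphere antipode w \<sigma>"
    using ex_double_cover_infinite_sphere by blast
  have "cocycle 1 RP_infinity w" unfolding RP_infinity_def by (rule double_cover.cocycle_w[OF w])
  note power = AS_cup_power_class[OF this, folded RP_generator_eq[OF w]]
  let ?f = "classifying_map A"
  obtain F where f: "continuous_map (sym_quotient A) RP_infinity ?f"
    and F: "continuous_map (top_of_set A) infinite_sphere F" "\<forall>u\<in>A. F (- u) = antipode (F u)"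
    "\<forall>u\<in>A. ?f (orbit_pair uminus u) = orbit_pair antipode (F u)"
    using is_classifying_map_classifying_map[OF assms(1)] unfolding is_classifying_map_def by blast
  have "double_cover (top_of_set A) uminus (\<lambda>ys. w (map ?f ys)) (\<lambda>x. \<sigma> (F x))"
  proof (rule double_cover_pullback[OF w])
    show "continuous_map (top_of_set A) (top_of_set A) uminus"
      using sym by (auto simp: symmetric_set_def intro!: continuous_intros)
  qed (use F in auto)
  moreover have "cohomological_index A =
      Sup {enat m |m. 1 \<le> m \<and> \<not> coboundary (m - 1) (sym_quotient A) (cup_power (\<lambda>ys. w (map ?f ys)) (m - 1))}"
    using assms(2) unfolding cohomological_index_def
    by (simp add: power AS_induced_class[OF f] AS_class_eq_one_iff cup_power_map)
  ultimately show thesis by (rule that)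
qed

lemma cohomological_index_empty: "cohomological_index {} = 0"
  by (simp add: cohomological_index_def)

lemma ex_double_cover:
  assumes "0 \<notin> A" "symmetric_set A"
  obtains w \<sigma> where "double_cover (top_of_set A) uminus w \<sigma>"
proof (cases "A = {}")
  case True
  have "double_cover (top_of_set A) uminus (\<lambda>_. 0) (\<lambda>_. 0)" by standard (use True in auto)
  then show thesis by (rule that)
next
  case False
  then show thesis using cohomological_index_eq[OF assms(1) False assms(2)] that by metis
qed

text \<open>By \<open>double_cover_unique\<close> every w belonging to the covering has the same
  vanishing powers as the one that computes the index.\<close>

lemma cohomological_index_SucD:
  assumes "0 \<notin> A" "symmetric_set A" and w: "double_cover (top_of_set A) uminus w \<sigma>"
    and k: "cohomological_index A = enat (Suc m)"
  shows "\<not> coboundary m (sym_quotient A) (cup_power w m)"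
    and "coboundary (Suc m) (sym_quotient A) (cup_power w (Suc m))"
proof -
  have "A \<noteq> {}" using k by (auto simp: cohomological_index_empty zero_enat_def)
  obtain w' \<sigma>' where w': "double_cover (top_of_set A) uminus w' \<sigma>'"
    and ind: "cohomological_index A =
      Sup {enat m |m. 1 \<le> m \<and> \<not> coboundary (m - 1) (sym_quotient A) (cup_power w' (m - 1))}"
    by (rule cohomological_index_eq[OF assms(1) \<open>A \<noteq> {}\<close> assms(2)])
  have coh: "coboundary n (sym_quotient A) (\<lambda>ys. cup_power w n ys + cup_power w' n ys)" for n
    using cup_power_cohomologous[OF double_cover.cocycle_w[OF w] double_cover.cocycle_w[OF w']
      double_cover_unique[OF w w']] by (simp add: sym_quotient_def)
  have iff: "coboundary n (sym_quotient A) (cup_power w n) \<longleftrightarrow> coboundary n (sym_quotient A) (cup_power w' n)" for n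
  proof
    show "coboundary n (sym_quotient A) (cup_power w' n)" if "coboundary n (sym_quotient A) (cup_power w n)"
      by (rule coboundary_cong[OF coboundary_add[OF coh that]]) (simp add: ac_simps)
    show "coboundary n (sym_quotient A) (cup_power w n)" if "coboundary n (sym_quotient A) (cup_power w' n)"
      by (rule coboundary_cong[OF coboundary_add[OF coh that]]) (simp add: add.assoc)
  qed
  define M where "M = {enat m |m. 1 \<le> m \<and> \<not> coboundary (m - 1) (sym_quotient A) (cup_power w' (m - 1))}"
  have Sup_M: "Sup M = enat (Suc m)" using ind k by (simp add: M_def)
  \<comment> \<open>The supremum is neither 0 nor infinite, so it is attained as a maximum.\<close>
  then have "M \<noteq> {}" "finite M" by (auto simp: Sup_enat_def zero_enat_def split: if_splits)
  then have "enat (Suc m) \<in> M" using Sup_M Max_in[of M] by (simp add: Sup_enat_def)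
  then show "\<not> coboundary m (sym_quotient A) (cup_power w m)" by (auto simp: M_def iff)
  have "enat (Suc (Suc m)) \<notin> M"
  proof
    assume "enat (Suc (Suc m)) \<in> M"
    then have "enat (Suc (Suc m)) \<le> Sup M" by (rule Sup_upper)
    with Sup_M show False by simp
  qed
  then show "coboundary (Suc m) (sym_quotient A) (cup_power w (Suc m))"
    by (auto simp: M_def iff simp del: cup_power.simps)
qed

text \<open>On a nonempty quotient the class 1 of degree 0 does not vanish, which makes the index at
  least 1.\<close>

lemma cohomological_index_0D:
  assumes "0 \<notin> A" "symmetric_set A" and k: "cohomological_index A = 0"
  shows "A = {}"
proof (rule ccontr)
  assume "A \<noteq> {}"
  obtain w \<sigma> where w: "double_cover (top_of_set A) uminus w \<sigma>"
    and ind: "cohomological_index A =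
      Sup {enat m |m. 1 \<le> m \<and> \<not> coboundary (m - 1) (sym_quotient A) (cup_power w (m - 1))}"
    by (rule cohomological_index_eq[OF assms(1) \<open>A \<noteq> {}\<close> assms(2)])
  have "coboundary 0 (sym_quotient A) (cup_power w 0)"
  proof (rule ccontr)
    assume "\<not> ?thesis"
    then have "enat 1 \<in> {enat m |m. 1 \<le> m \<and> \<not> coboundary (m - 1) (sym_quotient A) (cup_power w (m - 1))}"
      by force
    then have "enat 1 \<le> cohomological_index A" unfolding ind by (rule Sup_upper)
    with k show False by (simp add: zero_enat_def)
  qed
  then obtain \<theta> where \<theta>: "\<theta> [] = 0" "locally_zero 0 (sym_quotient A) (\<lambda>ys. 1 + delta \<theta> ys)"
    by (auto simp: coboundary_def)
  obtain x where "x \<in> A" using \<open>A \<noteq> {}\<close> by blast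
  then have x: "orbit_pair uminus x \<in> topspace (sym_quotient A)" by (simp add: sym_quotient_def)
  obtain V where "orbit_pair uminus x \<in> V" "\<And>ys. length ys = Suc 0 \<Longrightarrow> set ys \<subseteq> V \<Longrightarrow> 1 + delta \<theta> ys = 0"
    using locally_zeroE[OF \<theta>(2) x] by metis
  from this(2)[of "[orbit_pair uminus x]"] this(1) \<theta>(1) show False by simp
qed

section \<open>Radial projections and cones\<close>

locale radial_set =
  fixes M :: "'a::real_normed_vector set"
  assumes nonzero: "0 \<notin> M" and radial: "radially_homeomorphic_to_sphere M"
begin

abbreviation proj :: "'a \<Rightarrow> 'a" where "proj \<equiv> radial_proj M"

lemma ex_homeomorphism:
  obtains g where "homeomorphism M (sphere 0 1) sphere_proj g" "\<And>u. u \<noteq> 0 \<Longrightarrow> proj u = g (sphere_proj u)"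
proof -
  obtain g where g: "homeomorphism M (sphere 0 1) sphere_proj g"
    using radial unfolding radially_homeomorphic_to_sphere_def by blast
  have "proj u = g (sphere_proj u)" if u: "u \<noteq> 0" for u
  proof -
    have "sphere_proj u \<in> sphere 0 1" using u by (simp add: sphere_proj_def)
    then have "g (sphere_proj u) \<in> M" "sphere_proj (g (sphere_proj u)) = sphere_proj u"
      using g by (auto simp: homeomorphism_def)
    moreover have "inj_on sphere_proj M"
      using g by (intro inj_on_inverseI[of _ g]) (auto simp: homeomorphism_def)
    ultimately show ?thesis unfolding radial_proj_def by (intro inv_into_f_eq)
  qed
  with g show thesis by (rule that)
qed

lemma proj_in: "u \<noteq> 0 \<Longrightarrow> proj u \<in> M"
proof -
  assume u: "u \<noteq> 0"
  obtain g where g: "homeomorphism M (sphere 0 1) sphere_proj g" "\<And>u. u \<noteq> 0 \<Longrightarrow> proj u = g (sphere_proj u)"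
    using ex_homeomorphism by metis
  have "sphere_proj u \<in> sphere 0 1" using u by (simp add: sphere_proj_def)
  with g u show ?thesis by (auto simp: homeomorphism_def)
qed

lemma proj_id: "v \<in> M \<Longrightarrow> proj v = v"
proof -
  assume v: "v \<in> M"
  obtain g where g: "homeomorphism M (sphere 0 1) sphere_proj g" "\<And>u. u \<noteq> 0 \<Longrightarrow> proj u = g (sphere_proj u)"
    using ex_homeomorphism by metis
  have "v \<noteq> 0" using v nonzero by blast
  with g v show ?thesis by (auto simp: homeomorphism_def)
qed

lemma sphere_proj_scaleR: "0 < t \<Longrightarrow> sphere_proj (t *\<^sub>R v) = sphere_proj v"
  by (simp add: sphere_proj_def)

lemma proj_scaleR: "0 < t \<Longrightarrow> proj (t *\<^sub>R v) = proj v"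
  by (simp add: radial_proj_def sphere_proj_scaleR)

lemma proj_scaleR_id: "0 < t \<Longrightarrow> v \<in> M \<Longrightarrow> proj (t *\<^sub>R v) = v"
  by (simp add: proj_scaleR proj_id)

lemma scaleR_proj: "u \<noteq> 0 \<Longrightarrow> u = (norm u / norm (proj u)) *\<^sub>R proj u"
proof -
  assume u: "u \<noteq> 0"
  obtain g where g: "homeomorphism M (sphere 0 1) sphere_proj g" "\<And>u. u \<noteq> 0 \<Longrightarrow> proj u = g (sphere_proj u)"
    using ex_homeomorphism by metis
  have "sphere_proj u \<in> sphere 0 1" using u by (simp add: sphere_proj_def)
  with g u have "sphere_proj (proj u) = sphere_proj u" by (auto simp: homeomorphism_def)
  then have "norm u *\<^sub>R (proj u /\<^sub>R norm (proj u)) = norm u *\<^sub>R (u /\<^sub>R norm u)"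
    unfolding sphere_proj_def by (simp only:)
  with u show ?thesis by (simp add: divide_inverse)
qed

text \<open>A ray from 0 meets M in one point only. The case s = 0 is included because the lower
  level r may be 0.\<close>

lemma scaleR_eq_iff:
  assumes "u \<in> M" "v \<in> M" "0 \<le> s" "0 < t"
  shows "s *\<^sub>R u = t *\<^sub>R v \<longleftrightarrow> s = t \<and> u = v"
proof
  assume eq: "s *\<^sub>R u = t *\<^sub>R v"
  have "v \<noteq> 0" using assms(2) nonzero by blast
  then have "s \<noteq> 0" using eq assms(4) by auto
  then have "u = v" using eq proj_scaleR_id[OF _ assms(1), of s] proj_scaleR_id[OF assms(4,2)] assms(3) by simp
  with eq \<open>v \<noteq> 0\<close> show "s = t \<and> u = v" by simp
qed simp

lemma continuous_on_proj: "continuous_on (UNIV - {0}) proj"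
proof -
  obtain g where g: "homeomorphism M (sphere 0 1) sphere_proj g" "\<And>u. u \<noteq> 0 \<Longrightarrow> proj u = g (sphere_proj u)"
    using ex_homeomorphism by metis
  have cs: "continuous_on (UNIV - {0}) (sphere_proj :: 'a \<Rightarrow> 'a)"
    unfolding sphere_proj_def by (intro continuous_intros) simp
  have cg: "continuous_on (sphere 0 1) g" using g(1) by (simp add: homeomorphism_def)
  have "sphere_proj u \<in> sphere 0 1" if "u \<noteq> 0" for u :: 'a using that by (simp add: sphere_proj_def)
  then have "(sphere_proj :: 'a \<Rightarrow> 'a) ` (UNIV - {0}) \<subseteq> sphere 0 1" by blast
  with cg cs have "continuous_on (UNIV - {0}) (\<lambda>u. g (sphere_proj u))"
    by (rule continuous_on_compose2)
  then show ?thesis by (rule continuous_on_eq) (simp add: g(2))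
qed

end

lemma prod_top_of_set: "prod_topology (top_of_set S) (top_of_set T) = top_of_set (S \<times> T)"
  by (simp add: prod_topology_subtopology_eu)

locale radial_cone = radial_set +
  fixes A0 :: "'a set" and w0 :: 'a
  assumes A0_subset: "A0 \<subseteq> M" and A0_sym: "symmetric_set A0" and w0: "w0 \<in> M" "w0 \<notin> A0"
begin

definition cone :: "'a \<Rightarrow> real \<Rightarrow> 'a" where
  "cone v s = proj ((1 - s) *\<^sub>R v + s *\<^sub>R w0)"

text \<open>A zero of the segment from \<open>v\<close> to \<open>w0\<close> would make \<open>- v \<in> A0\<close> a positive multiple of \<open>w0\<close>.\<close>

lemma segment_nonzero:
  assumes v: "v \<in> A0" and s: "0 \<le> s" "s \<le> 1"
  shows "(1 - s) *\<^sub>R v + s *\<^sub>R w0 \<noteq> 0"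
proof
  assume 0: "(1 - s) *\<^sub>R v + s *\<^sub>R w0 = 0"
  then have eq: "(1 - s) *\<^sub>R (- v) = s *\<^sub>R w0" by (simp add: add_eq_0_iff)
  have "- v \<in> A0" using v A0_sym by (metis imageI symmetric_set_def)
  then have "- v \<in> M" using A0_subset by blast
  moreover have "w0 \<noteq> 0" "v \<noteq> 0" using w0 v A0_subset nonzero by auto
  moreover have "0 < s"
    using 0 s \<open>v \<noteq> 0\<close> by (cases "s = 0") auto
  ultimately have "- v = w0" using scaleR_eq_iff[of "- v" w0 "1 - s" s] eq w0(1) s by simp
  with \<open>- v \<in> A0\<close> w0(2) show False by simp
qed

lemma cone_in: "v \<in> A0 \<Longrightarrow> 0 \<le> s \<Longrightarrow> s \<le> 1 \<Longrightarrow> cone v s \<in> M"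
  unfolding cone_def by (intro proj_in segment_nonzero)

lemma cone_0: "v \<in> A0 \<Longrightarrow> cone v 0 = v"
  using A0_subset by (auto simp: cone_def intro: proj_id)

lemma cone_1: "cone v 1 = w0"
  using w0(1) by (simp add: cone_def proj_id)

lemma continuous_on_cone: "continuous_on ({0..1} \<times> A0) (\<lambda>(s, v). cone v s)"
  unfolding cone_def case_prod_beta
  by (rule continuous_on_compose2[OF continuous_on_proj])
    (auto intro!: continuous_intros dest: segment_nonzero)

text \<open>A0 is moved inside X along the rays from level b to level c, and then contracted there
  along the cone to \<open>c *\<^sub>R w0\<close>.\<close>

lemma reduced_coboundary_cone:
  assumes \<phi>: "cocycle q (top_of_set X) \<phi>"
    and seg: "\<And>t v. v \<in> A0 \<Longrightarrow> t \<in> closed_segment b c \<Longrightarrow> t *\<^sub>R v \<in> X"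
    and cone: "\<And>s v. v \<in> A0 \<Longrightarrow> 0 \<le> s \<Longrightarrow> s \<le> 1 \<Longrightarrow> c *\<^sub>R cone v s \<in> X"
  shows "reduced_coboundary q (top_of_set A0) (\<lambda>vs. \<phi> (map (\<lambda>v. b *\<^sub>R v) vs))"
proof (cases "A0 = {}")
  case True
  then have "locally_zero q (top_of_set A0) (\<lambda>vs. \<phi> (map (\<lambda>v. b *\<^sub>R v) vs))"
    by (simp add: locally_zero_def)
  then show ?thesis by (intro coboundary_imp_reduced locally_zero_imp_coboundary)
next
  case False
  let ?h = "\<lambda>(t, v). ((1 - t) * b + t * c) *\<^sub>R v"
  let ?k = "\<lambda>(s, v). c *\<^sub>R cone v s"
  have "continuous_on ({0..1} \<times> A0) ?k"
    using continuous_on_cone unfolding case_prod_beta by (intro continuous_intros)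
  then have k: "continuous_map (prod_topology (top_of_set {0..1}) (top_of_set A0)) (top_of_set X) ?k"
    using cone by (auto simp: prod_top_of_set)
  have "((1 - t) * b + t * c) *\<^sub>R v \<in> X" if "0 \<le> t" "t \<le> 1" "v \<in> A0" for t v
    using that by (intro seg) (auto simp: closed_segment_def)
  moreover have "continuous_on ({0..1} \<times> A0) ?h"
    unfolding case_prod_beta by (intro continuous_intros)
  ultimately have h: "continuous_map (prod_topology (top_of_set {0..1}) (top_of_set A0)) (top_of_set X) ?h"
    by (auto simp: prod_top_of_set)
  obtain v0 where "v0 \<in> A0" using False by blast
  from cone[OF this, of 1] have "c *\<^sub>R w0 \<in> topspace (top_of_set X)" by (simp add: cone_1)
  with \<phi> have "reduced_coboundary q (top_of_set A0) (\<lambda>vs. \<phi> (map (\<lambda>v. ?k (1, v)) vs))"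
    by (simp add: cone_1 constant_map_reduced_coboundary)
  then have "reduced_coboundary q (top_of_set A0) (\<lambda>vs. \<phi> (map (\<lambda>v. ?k (0, v)) vs))"
    by (rule homotopy_reduced_coboundary[OF k \<phi>])
  then have "reduced_coboundary q (top_of_set A0) (\<lambda>vs. \<phi> (map (\<lambda>v. ?h (1, v)) vs))"
  proof (rule reduced_coboundary_cong)
    fix vs assume "set vs \<subseteq> topspace (top_of_set A0)"
    then have "map (\<lambda>v. ?h (1, v)) vs = map (\<lambda>v. ?k (0, v)) vs" by (auto simp: cone_0)
    then show "\<phi> (map (\<lambda>v. ?h (1, v)) vs) = \<phi> (map (\<lambda>v. ?k (0, v)) vs)" by (simp only:)
  qed
  then have "reduced_coboundary q (top_of_set A0) (\<lambda>vs. \<phi> (map (\<lambda>v. ?h (0, v)) vs))"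
    by (rule homotopy_reduced_coboundary[OF h \<phi>])
  then show ?thesis by simp
qed

end

section \<open>Linking\<close>

lemma symmetric_set_Diff: "symmetric_set A \<Longrightarrow> symmetric_set B \<Longrightarrow> symmetric_set (A - B)"
  by (simp add: symmetric_set_def image_set_diff)

text \<open>The Gysin sequence turns the drop of the index to \<open>Suc m\<close> into a class of \<open>U\<close> in degree \<open>m\<close>
  that survives on \<open>A\<close>.\<close>

lemma ex_cocycle_nontrivial_on_subset:
  assumes U: "0 \<notin> U" "symmetric_set U" "cohomological_index U = enat (Suc m)"
    and A: "A \<subseteq> U" "symmetric_set A" "cohomological_index A = enat (Suc m)"
  obtains \<alpha> where "cocycle m (top_of_set U) \<alpha>" "\<not> reduced_coboundary m (top_of_set A) \<alpha>"
proof -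
  obtain w \<sigma> where w: "double_cover (top_of_set U) uminus w \<sigma>" using ex_double_cover[OF U(1,2)] by blast
  interpret U: double_cover "top_of_set U" uminus w \<sigma> by fact
  have A0: "0 \<notin> A" using A(1) U(1) by blast
  \<comment> \<open>The same w and \<sigma> serve for A, so the lifted cochain of A is literally the
    restriction of that of U.\<close>
  have "double_cover (top_of_set A) uminus (\<lambda>ys. w (map id ys)) (\<lambda>x. \<sigma> (id x))"
  proof (rule double_cover_pullback[OF w])
    show "continuous_map (top_of_set A) (top_of_set A) uminus"
      using A(2) by (auto simp: symmetric_set_def intro!: continuous_intros)
  qed (use A(1) in auto)
  then have wA: "double_cover (top_of_set A) uminus w \<sigma>" by simp
  interpret A: double_cover "top_of_set A" uminus w \<sigma> by fact
  have "coboundary (Suc m) U.P (cup m (cup_power w m) w)"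
    using cohomological_index_SucD(2)[OF U(1,2) w U(3)] by (simp add: sym_quotient_def)
  then obtain \<eta> where \<eta>: "cocycle m (top_of_set U)
      (\<lambda>vs. U.lift_cochain m (cup_power w m) vs + \<eta> (map U.p vs))"
    using U.gysin_lift[OF cocycle_cup_power[OF U.cocycle_w]] by metis
  moreover have "\<not> reduced_coboundary m (top_of_set A)
      (\<lambda>vs. U.lift_cochain m (cup_power w m) vs + \<eta> (map U.p vs))"
    using A.gysin_descend cohomological_index_SucD(1)[OF A0 A(2) wA A(3)]
    unfolding sym_quotient_def by blast
  ultimately show thesis by (rule that)
qed

locale linking = radial_cone +
  fixes B0 :: "'a set" and r \<rho> R e :: real
  assumes B0_subset: "B0 \<subseteq> M" and B0_closed: "closed B0" and disj: "A0 \<inter> B0 = {}"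
    and r: "0 \<le> r" "r < \<rho>" and R: "\<rho> < R"
    and e: "0 < e" "\<And>b. b \<in> B0 \<Longrightarrow> e \<le> norm b"
begin

section \<open>The level function and the complement of \<open>B\<close>\<close>

definition B :: "'a set" where "B = {\<rho> *\<^sub>R w |w. w \<in> B0}"

definition Y :: "'a set" where "Y = {u. u \<noteq> 0 \<and> proj u \<notin> B0}"

text \<open>The points below level \<open>\<rho>\<close>. Since \<open>M\<close> need not be bounded away from \<open>0\<close>, they need not form a
  neighbourhood of \<open>0\<close>, so a small ball is added.\<close>

definition \<chi>\<^sub>0 :: "'a \<Rightarrow> bit" where
  "\<chi>\<^sub>0 u = (if norm u < \<rho> * e \<or> (u \<noteq> 0 \<and> norm u \<le> \<rho> * norm (proj u)) then 1 else 0)"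

lemma rho_pos: "0 < \<rho>" using r by simp

lemma continuous_on_norm_proj: "continuous_on (UNIV - {0}) (\<lambda>u. norm (proj u))"
  by (intro continuous_intros continuous_on_proj)

lemma open_Y: "open Y"
proof -
  have "open ((UNIV - {0}) \<inter> proj -` (- B0))"
    by (rule continuous_open_preimage[OF continuous_on_proj]) (use B0_closed in auto)
  moreover have "(UNIV - {0}) \<inter> proj -` (- B0) = Y" by (auto simp: Y_def)
  ultimately show ?thesis by simp
qed

lemma low_nbhd:
  assumes "x = 0 \<or> norm x < \<rho> * norm (proj x)"
  shows "\<exists>N. open N \<and> x \<in> N \<and> (\<forall>u\<in>N. \<chi>\<^sub>0 u = 1)"
proof (cases "x = 0")
  case True
  then show ?thesis using rho_pos e by (intro exI[of _ "ball 0 (\<rho> * e)"]) (auto simp: \<chi>\<^sub>0_def)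
next
  case False
  have "continuous_on (UNIV - {0}) (\<lambda>u. \<rho> * norm (proj u) - norm u)"
    by (intro continuous_intros continuous_on_norm_proj)
  then have "open ((UNIV - {0}) \<inter> (\<lambda>u. \<rho> * norm (proj u) - norm u) -` {0<..})"
    by (rule continuous_open_preimage) auto
  with False assms show ?thesis
    by (intro exI[of _ "(UNIV - {0}) \<inter> (\<lambda>u. \<rho> * norm (proj u) - norm u) -` {0<..}"])
      (auto simp: \<chi>\<^sub>0_def)
qed

text \<open>As \<open>proj x\<close> lies in B0 its norm is at least e, so x is outside the closure
  of the ball added in \<open>\<chi>\<^sub>0\<close>.\<close>

lemma high_nbhd:
  assumes x: "x \<noteq> 0" "\<rho> * norm (proj x) < norm x" "proj x \<in> B0"
  shows "\<exists>N. open N \<and> x \<in> N \<and> (\<forall>u\<in>N. \<chi>\<^sub>0 u = 0)"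
proof -
  have "continuous_on (UNIV - {0}) (\<lambda>u. \<rho> * norm (proj u) - norm u)"
    by (intro continuous_intros continuous_on_norm_proj)
  then have "open ((UNIV - {0}) \<inter> (\<lambda>u. \<rho> * norm (proj u) - norm u) -` {..<0})"
    by (rule continuous_open_preimage) auto
  moreover have "open {u. \<rho> * e < norm u}" by (intro open_Collect_less continuous_intros)
  ultimately have "open ((UNIV - {0}) \<inter> (\<lambda>u. \<rho> * norm (proj u) - norm u) -` {..<0} \<inter> {u. \<rho> * e < norm u})"
    by (rule open_Int)
  moreover have "\<rho> * e \<le> \<rho> * norm (proj x)" using e(2)[OF x(3)] rho_pos by simp
  ultimately show ?thesis using x
    by (intro exI[of _ "(UNIV - {0}) \<inter> (\<lambda>u. \<rho> * norm (proj u) - norm u) -` {..<0} \<inter> {u. \<rho> * e < norm u}"])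
      (auto simp: \<chi>\<^sub>0_def)
qed

text \<open>A nonzero point outside Y lies on a ray through B0, and the point of this ray at level
  \<rho> belongs to B; all others are strictly below or above.\<close>

lemma constant_nbhd:
  assumes x: "x \<notin> Y" "x \<notin> B"
  shows "\<exists>N s. open N \<and> x \<in> N \<and> (\<forall>u\<in>N. \<chi>\<^sub>0 u = s)"
proof (cases "x = 0 \<or> norm x < \<rho> * norm (proj x)")
  case True
  from low_nbhd[OF this] obtain N where "open N" "x \<in> N" "\<forall>u\<in>N. \<chi>\<^sub>0 u = 1" by (elim exE conjE)
  then show ?thesis by (intro exI conjI)
next
  case False
  then have "x \<noteq> 0" by simp
  then have "proj x \<in> B0" using x(1) by (simp add: Y_def)
  have "norm x \<noteq> \<rho> * norm (proj x)"
  proof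
    assume eq: "norm x = \<rho> * norm (proj x)"
    have "proj x \<noteq> 0" using proj_in[OF \<open>x \<noteq> 0\<close>] nonzero by auto
    then have "norm x / norm (proj x) = \<rho>" using eq by simp
    with scaleR_proj[OF \<open>x \<noteq> 0\<close>] have "x = \<rho> *\<^sub>R proj x" by (simp only:)
    with \<open>proj x \<in> B0\<close> x(2) show False unfolding B_def by blast
  qed
  then have "\<rho> * norm (proj x) < norm x" using False by linarith
  from high_nbhd[OF \<open>x \<noteq> 0\<close> this \<open>proj x \<in> B0\<close>]
  obtain N where "open N" "x \<in> N" "\<forall>u\<in>N. \<chi>\<^sub>0 u = 0" by (elim exE conjE)
  then show ?thesis by (intro exI conjI)
qed

section \<open>The Mayer--Vietoris class for k > 0\<close>

context
  fixes m :: nat and \<alpha> :: "'a list \<Rightarrow> bit"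
  assumes \<alpha>: "cocycle m (top_of_set (M - B0)) \<alpha>"
begin

text \<open>Mayer--Vietoris: \<open>\<beta>\<close> represents the image of the class of \<open>\<alpha>'\<close> under the connecting homomorphism,
  and \<open>a 0\<close> and \<open>a 1\<close> are its primitives over the parts of the space where \<open>\<chi>\<^sub>0\<close> is locally equal to \<open>0\<close> and
  to \<open>1\<close>, respectively, outside \<open>Y\<close>.\<close>

definition \<alpha>' :: "'a list \<Rightarrow> bit" where "\<alpha>' xs = \<alpha> (map proj xs)"

text \<open>Where \<alpha>' is locally closed, this is the coboundary of \<alpha>' cut off by
  \<open>\<chi>\<^sub>0\<close>; the jump of \<open>\<chi>\<^sub>0\<close> is harmless for
  Alexander--Spanier cochains.\<close>

definition b :: "'a list \<Rightarrow> bit" where "b = cup 1 (delta (\<lambda>xs. \<chi>\<^sub>0 (hd xs))) \<alpha>'"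

definition \<beta> :: "'a list \<Rightarrow> bit" where "\<beta> xs = (if set xs \<subseteq> Y then b xs else 0)"

text \<open>The factor vanishes where \<open>\<chi>\<^sub>0\<close> equals s, so extension by 0 is
  harmless there. On Y the two cochains add up to \<alpha>'.\<close>

definition a :: "bit \<Rightarrow> 'a list \<Rightarrow> bit" where
  "a s xs = (if set xs \<subseteq> Y then cup 0 (\<lambda>xs. s + \<chi>\<^sub>0 (hd xs)) \<alpha>' xs else 0)"

lemma cocycle_\<alpha>': "cocycle m (top_of_set Y) \<alpha>'"
  unfolding \<alpha>'_def[abs_def]
proof (rule cocycle_pullback[OF _ \<alpha>])
  have "continuous_on Y proj" by (rule continuous_on_subset[OF continuous_on_proj]) (auto simp: Y_def)
  then show "continuous_map (top_of_set Y) (top_of_set (M - B0)) proj"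
    by (auto simp: Y_def proj_in)
qed

lemma Y_nbhd:
  assumes "locally_zero q (top_of_set Y) \<phi>" "x \<in> Y"
  obtains V where "open V" "x \<in> V" "V \<subseteq> Y" "\<forall>xs. length xs = Suc q \<longrightarrow> set xs \<subseteq> V \<longrightarrow> \<phi> xs = 0"
proof -
  have "x \<in> topspace (top_of_set Y)" using assms(2) by simp
  with assms(1) obtain V where V: "openin (top_of_set Y) V" "x \<in> V"
    "\<forall>xs. length xs = Suc q \<longrightarrow> set xs \<subseteq> V \<longrightarrow> \<phi> xs = 0"
    unfolding locally_zero_def by blast
  then have "open V" "V \<subseteq> Y" using open_Y openin_open_eq by blast+
  with V show thesis by (intro that)
qed

lemma b_eq_0:
  assumes "\<forall>u\<in>N. \<chi>\<^sub>0 u = s" "length xs = Suc (Suc m)" "set xs \<subseteq> N" shows "b xs = 0"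
proof -
  obtain x y zs where "xs = x # y # zs" using assms(2) by (metis length_Suc_conv)
  with assms show ?thesis by (simp add: b_def cup_def)
qed

text \<open>On the open set Y this is a product of cocycles; near the remaining points off B,
  \<open>\<chi>\<^sub>0\<close> is constant, so b and its extension by 0 both vanish.\<close>

lemma cocycle_\<beta>: "cocycle (Suc m) (top_of_set (UNIV - B)) \<beta>"
  unfolding cocycle_def
proof (rule locally_zeroI)
  fix x assume "x \<in> topspace (top_of_set (UNIV - B))"
  then have x: "x \<notin> B" by simp
  have "\<exists>V. open V \<and> x \<in> V \<and> (\<forall>xs. length xs = Suc (Suc (Suc m)) \<longrightarrow> set xs \<subseteq> V \<longrightarrow> delta \<beta> xs = 0)"
  proof (cases "x \<in> Y")
    case True
    have "cocycle (1 + m) (top_of_set Y) b"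
      unfolding b_def by (intro cocycle_cup cocycle_delta cocycle_\<alpha>')
    then have "locally_zero (Suc (Suc m)) (top_of_set Y) (delta b)" by (simp add: cocycle_def)
    then obtain V where V: "open V" "x \<in> V" "V \<subseteq> Y"
      "\<forall>xs. length xs = Suc (Suc (Suc m)) \<longrightarrow> set xs \<subseteq> V \<longrightarrow> delta b xs = 0"
      using True by (rule Y_nbhd)
    have "delta \<beta> xs = 0" if "length xs = Suc (Suc (Suc m))" "set xs \<subseteq> V" for xs
    proof -
      have "delta \<beta> xs = delta b xs" by (rule delta_cong) (use that V(3) in \<open>auto simp: \<beta>_def\<close>)
      with V(4) that show ?thesis by simp
    qed
    with V show ?thesis by blast
  next
    case False
    then obtain N s where N: "open N" "x \<in> N" "\<forall>u\<in>N. \<chi>\<^sub>0 u = s" using constant_nbhd x by blast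
    have "delta \<beta> xs = 0" if "length xs = Suc (Suc (Suc m))" "set xs \<subseteq> N" for xs
    proof -
      have "delta \<beta> xs = delta (\<lambda>_. 0) xs"
        by (rule delta_cong) (use that b_eq_0[OF N(3)] in \<open>auto simp: \<beta>_def\<close>)
      then show ?thesis by simp
    qed
    with N show ?thesis by blast
  qed
  then obtain V where "open V" "x \<in> V"
    "\<forall>xs. length xs = Suc (Suc (Suc m)) \<longrightarrow> set xs \<subseteq> V \<longrightarrow> delta \<beta> xs = 0" by blast
  with x show "\<exists>V. openin (top_of_set (UNIV - B)) V \<and> x \<in> V \<and>
      (\<forall>xs. length xs = Suc (Suc (Suc m)) \<longrightarrow> set xs \<subseteq> V \<longrightarrow> delta \<beta> xs = 0)"
    by (intro exI[of _ "(UNIV - B) \<inter> V"]) (auto simp: openin_open)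
qed

text \<open>Both \<gamma> and \<open>a s\<close> are local primitives of \<beta> on Z: on Y by the
  Leibniz rule, and off Y because \<beta> and \<open>a s\<close> vanish there locally.\<close>

lemma cocycle_primitive:
  assumes \<gamma>: "locally_zero (Suc m) (top_of_set Z) (\<lambda>xs. \<beta> xs + delta \<gamma> xs)"
    and Z: "\<And>x. x \<in> Z - Y \<Longrightarrow> \<exists>N. open N \<and> x \<in> N \<and> (\<forall>u\<in>N. \<chi>\<^sub>0 u = s)"
  shows "cocycle m (top_of_set Z) (\<lambda>xs. \<gamma> xs + a s xs)"
proof -
  have "locally_zero (Suc m) (top_of_set Z) (\<lambda>xs. \<beta> xs + delta (a s) xs)"
  proof (rule locally_zeroI)
    fix x assume "x \<in> topspace (top_of_set Z)"
    then have x: "x \<in> Z" by simp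
    have "\<exists>V. open V \<and> x \<in> V \<and> (\<forall>xs. length xs = Suc (Suc m) \<longrightarrow> set xs \<subseteq> V \<longrightarrow> \<beta> xs + delta (a s) xs = 0)"
    proof (cases "x \<in> Y")
      case True
      from cocycle_\<alpha>' have "locally_zero (Suc m) (top_of_set Y) (delta \<alpha>')" by (simp add: cocycle_def)
      then obtain V where V: "open V" "x \<in> V" "V \<subseteq> Y"
        "\<forall>xs. length xs = Suc (Suc m) \<longrightarrow> set xs \<subseteq> V \<longrightarrow> delta \<alpha>' xs = 0"
        using True by (rule Y_nbhd)
      have "\<beta> xs + delta (a s) xs = 0" if xs: "length xs = Suc (Suc m)" "set xs \<subseteq> V" for xs
      proof -
        have "delta (a s) xs = delta (cup 0 (\<lambda>xs. s + \<chi>\<^sub>0 (hd xs)) \<alpha>') xs"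
          by (rule delta_cong) (use xs V(3) in \<open>auto simp: a_def\<close>)
        also have "\<dots> = cup 1 (delta (\<lambda>xs. s + \<chi>\<^sub>0 (hd xs))) \<alpha>' xs
            + cup 0 (\<lambda>xs. s + \<chi>\<^sub>0 (hd xs)) (delta \<alpha>') xs"
          using delta_cup[of xs 0 m] xs(1) by simp
        also have "cup 0 (\<lambda>xs. s + \<chi>\<^sub>0 (hd xs)) (delta \<alpha>') xs = 0"
          using V(4) xs by (simp add: cup_def)
        also have "cup 1 (delta (\<lambda>xs. s + \<chi>\<^sub>0 (hd xs))) \<alpha>' xs = b xs"
        proof -
          obtain x y zs where "xs = x # y # zs" using xs(1) by (metis length_Suc_conv)
          then show ?thesis by (simp add: b_def cup_def ac_simps)
        qed
        also have "b xs = \<beta> xs" using xs(2) V(3) by (auto simp: \<beta>_def)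
        finally show ?thesis by simp
      qed
      with V show ?thesis by blast
    next
      case False
      then obtain N where N: "open N" "x \<in> N" "\<forall>u\<in>N. \<chi>\<^sub>0 u = s" using Z x by blast
      have "\<beta> xs + delta (a s) xs = 0" if xs: "length xs = Suc (Suc m)" "set xs \<subseteq> N" for xs
      proof -
        have "a s ys = 0" if ys: "Suc (length ys) = length xs" "set ys \<subseteq> set xs" for ys
        proof -
          obtain y zs where "ys = y # zs" using ys(1) xs(1) by (cases ys) auto
          then show ?thesis using ys(2) xs(2) N(3) by (auto simp: a_def cup_def)
        qed
        then have "delta (a s) xs = delta (\<lambda>_. 0) xs" by (intro delta_cong) simp
        moreover have "\<beta> xs = 0" using b_eq_0[OF N(3) xs] by (simp add: \<beta>_def)
        ultimately show ?thesis by simp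
      qed
      with N show ?thesis by blast
    qed
    then obtain V where "open V" "x \<in> V"
      "\<forall>xs. length xs = Suc (Suc m) \<longrightarrow> set xs \<subseteq> V \<longrightarrow> \<beta> xs + delta (a s) xs = 0" by blast
    with x show "\<exists>V. openin (top_of_set Z) V \<and> x \<in> V \<and>
        (\<forall>xs. length xs = Suc (Suc m) \<longrightarrow> set xs \<subseteq> V \<longrightarrow> \<beta> xs + delta (a s) xs = 0)"
      by (intro exI[of _ "Z \<inter> V"]) (auto simp: openin_open)
  qed
  from locally_zero_add[OF \<gamma> this] show ?thesis
    unfolding cocycle_def by (rule locally_zero_cong) (simp add: delta_add ac_simps)
qed

lemma \<beta>_nontrivial:
  assumes nt: "\<not> reduced_coboundary m (top_of_set A0) \<alpha>"
    and A: "\<And>t v. v \<in> A0 \<Longrightarrow> r \<le> t \<Longrightarrow> t \<le> R \<Longrightarrow> t *\<^sub>R v \<in> A"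
      "\<And>v s. v \<in> A0 \<Longrightarrow> 0 \<le> s \<Longrightarrow> s \<le> 1 \<Longrightarrow> r *\<^sub>R cone v s \<in> A \<and> R *\<^sub>R cone v s \<in> A"
    and A': "\<And>x. x \<in> A \<Longrightarrow> (\<exists>u\<in>M. x = r *\<^sub>R u) \<or> (\<exists>v\<in>A0. \<exists>t\<ge>0. x = t *\<^sub>R v) \<or> (\<exists>u\<in>M. x = R *\<^sub>R u)"
  shows "\<not> reduced_coboundary (Suc m) (top_of_set A) \<beta>"
proof
  assume "reduced_coboundary (Suc m) (top_of_set A) \<beta>"
  then obtain \<gamma> where \<gamma>: "locally_zero (Suc m) (top_of_set A) (\<lambda>xs. \<beta> xs + delta \<gamma> xs)"
    unfolding reduced_coboundary_def by blast
  have \<gamma>Z: "locally_zero (Suc m) (top_of_set Z) (\<lambda>xs. \<beta> xs + delta \<gamma> xs)" if "Z \<subseteq> A" for Z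
  proof -
    have "continuous_map (top_of_set Z) (top_of_set A) id" using that by auto
    from locally_zero_pullback[OF this \<gamma>] show ?thesis by simp
  qed
  have R_pos: "0 < R" using r R by simp
  have B0M: "b \<in> M" "b \<noteq> 0" "b \<notin> A0" if "b \<in> B0" for b using that B0_subset nonzero disj by auto
  have A0M: "v \<in> M" "v \<noteq> 0" "v \<notin> B0" if "v \<in> A0" for v using that A0_subset nonzero disj by auto
  have A_cases: "x = 0 \<or> x \<in> Y \<or> x = r *\<^sub>R proj x \<and> 0 < r \<and> proj x \<in> B0 \<or> x = R *\<^sub>R proj x \<and> proj x \<in> B0"
    if x: "x \<in> A" for x
  proof (cases "x = 0")
    case False
    consider u where "u \<in> M" "x = r *\<^sub>R u" | v t where "v \<in> A0" "0 \<le> t" "x = t *\<^sub>R v" | u where "u \<in> M" "x = R *\<^sub>R u"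
      using A'[OF x] by blast
    then show ?thesis
    proof cases
      case 1
      then have "0 < r" using False r by (cases "r = 0") auto
      with 1 have "proj x = u" by (simp add: proj_scaleR_id)
      with 1 \<open>0 < r\<close> False show ?thesis by (auto simp: Y_def)
    next
      case 2
      then have "0 < t" using False by (cases "t = 0") auto
      with 2 A0M have "proj x = v" by (simp add: proj_scaleR_id)
      with 2 A0M False show ?thesis by (auto simp: Y_def)
    next
      case 3
      with R_pos have "proj x = u" by (simp add: proj_scaleR_id)
      with 3 False show ?thesis by (auto simp: Y_def)
    qed
  qed simp
  \<comment> \<open>Off Y a point of A is 0 or lies over B0 at level r or R. Without level R only
    points with \<open>\<chi>\<^sub>0\<close> locally 1 are left; without level r and 0 only those
    with \<open>\<chi>\<^sub>0\<close> locally 0. The point 0 is removed explicitly since it occurs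
    in A when r = 0.\<close>
  define Z1 where "Z1 = A - {R *\<^sub>R b |b. b \<in> B0}"
  define Z0 where "Z0 = A - ({r *\<^sub>R b |b. b \<in> B0} \<union> {0})"
  have "cocycle m (top_of_set Z1) (\<lambda>xs. \<gamma> xs + a 1 xs)"
  proof (rule cocycle_primitive[OF \<gamma>Z])
    fix x assume x: "x \<in> Z1 - Y"
    then have "x = 0 \<or> x = r *\<^sub>R proj x \<and> proj x \<in> B0" using A_cases[of x] by (auto simp: Z1_def)
    then have "x = 0 \<or> norm x < \<rho> * norm (proj x)"
    proof
      assume "x = r *\<^sub>R proj x \<and> proj x \<in> B0"
      then have "norm x = r * norm (proj x)" "0 < norm (proj x)"
        using r B0M by (metis abs_of_nonneg norm_scaleR, simp)
      then show ?thesis using r by simp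
    qed simp
    then show "\<exists>N. open N \<and> x \<in> N \<and> (\<forall>u\<in>N. \<chi>\<^sub>0 u = 1)" by (rule low_nbhd)
  qed (simp add: Z1_def)
  then have 1: "reduced_coboundary m (top_of_set A0)
      (\<lambda>vs. \<gamma> (map (\<lambda>v. \<rho> *\<^sub>R v) vs) + a 1 (map (\<lambda>v. \<rho> *\<^sub>R v) vs))"
  proof (rule reduced_coboundary_cone[where c = r])
    fix t v assume v: "v \<in> A0" and "t \<in> closed_segment \<rho> r"
    then have t: "r \<le> t" "t \<le> \<rho>" using r by (auto simp: closed_segment_eq_real_ivl split: if_splits)
    have "t *\<^sub>R v \<noteq> R *\<^sub>R b" if "b \<in> B0" for b
      using scaleR_eq_iff[of v b t R] A0M[OF v] B0M[OF that] that t r R_pos by auto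
    then show "t *\<^sub>R v \<in> Z1" using A(1)[OF v] t R by (auto simp: Z1_def)
  next
    fix s v assume v: "v \<in> A0" and s: "0 \<le> s" "s \<le> (1::real)"
    have "r *\<^sub>R cone v s \<noteq> R *\<^sub>R b" if "b \<in> B0" for b
      using scaleR_eq_iff[of "cone v s" b r R] cone_in[OF v s] B0M[OF that] r R R_pos by auto
    then show "r *\<^sub>R cone v s \<in> Z1" using A(2)[OF v s] by (auto simp: Z1_def)
  qed
  have "cocycle m (top_of_set Z0) (\<lambda>xs. \<gamma> xs + a 0 xs)"
  proof (rule cocycle_primitive[OF \<gamma>Z])
    fix x assume x: "x \<in> Z0 - Y"
    then have xR: "x \<noteq> 0" "x = R *\<^sub>R proj x" "proj x \<in> B0" using A_cases[of x] by (auto simp: Z0_def)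
    then have "norm x = R * norm (proj x)" "0 < norm (proj x)"
      using R_pos B0M by (metis abs_of_pos norm_scaleR, simp)
    then have "\<rho> * norm (proj x) < norm x" using R by simp
    with xR show "\<exists>N. open N \<and> x \<in> N \<and> (\<forall>u\<in>N. \<chi>\<^sub>0 u = 0)" by (intro high_nbhd)
  qed (simp add: Z0_def)
  then have 0: "reduced_coboundary m (top_of_set A0)
      (\<lambda>vs. \<gamma> (map (\<lambda>v. \<rho> *\<^sub>R v) vs) + a 0 (map (\<lambda>v. \<rho> *\<^sub>R v) vs))"
  proof (rule reduced_coboundary_cone[where c = R])
    fix t v assume v: "v \<in> A0" and "t \<in> closed_segment \<rho> R"
    then have t: "\<rho> \<le> t" "t \<le> R" using R by (auto simp: closed_segment_eq_real_ivl split: if_splits)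
    have "r *\<^sub>R b \<noteq> t *\<^sub>R v" if "b \<in> B0" for b
      using scaleR_eq_iff[of b v r t] A0M[OF v] B0M[OF that] t r by auto
    moreover have "t *\<^sub>R v \<noteq> 0" using A0M[OF v] t r by auto
    ultimately show "t *\<^sub>R v \<in> Z0" using A(1)[OF v] t r by (auto simp: Z0_def dest: sym)
  next
    fix s v assume v: "v \<in> A0" and s: "0 \<le> s" "s \<le> (1::real)"
    have "r *\<^sub>R b \<noteq> R *\<^sub>R cone v s" if "b \<in> B0" for b
      using scaleR_eq_iff[of b "cone v s" r R] cone_in[OF v s] B0M[OF that] r R by auto
    moreover have "R *\<^sub>R cone v s \<noteq> 0" using cone_in[OF v s] nonzero R_pos by auto
    ultimately show "R *\<^sub>R cone v s \<in> Z0" using A(2)[OF v s] by (auto simp: Z0_def dest: sym)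
  qed
  have "reduced_coboundary m (top_of_set A0) \<alpha>"
  \<comment> \<open>In the sum of the two cocycles \<gamma> cancels, and at level \<rho>
    \<open>a 1\<close> and \<open>a 0\<close> add up to \<alpha>.\<close>
  proof (rule reduced_coboundary_cong[OF reduced_coboundary_add[OF 1 0]])
    fix vs assume len: "length vs = Suc m" and "set vs \<subseteq> topspace (top_of_set A0)"
    then have vs: "set vs \<subseteq> A0" by simp
    have proj_eq: "proj (\<rho> *\<^sub>R v) = v" if "v \<in> A0" for v
      using A0M[OF that] rho_pos by (simp add: proj_scaleR_id)
    then have "\<rho> *\<^sub>R v \<in> Y" if "v \<in> A0" for v
      using A0M[OF that] rho_pos that by (simp add: Y_def)
    then have Y: "set (map (\<lambda>v. \<rho> *\<^sub>R v) vs) \<subseteq> Y" using vs by auto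
    have "map proj (map (\<lambda>v. \<rho> *\<^sub>R v) vs) = vs"
      using vs proj_eq unfolding map_map by (intro map_idI) auto
    then have "\<alpha>' (map (\<lambda>v. \<rho> *\<^sub>R v) vs) = \<alpha> vs" by (simp only: \<alpha>'_def)
    moreover have "a 1 (map (\<lambda>v. \<rho> *\<^sub>R v) vs) + a 0 (map (\<lambda>v. \<rho> *\<^sub>R v) vs) = \<alpha>' (map (\<lambda>v. \<rho> *\<^sub>R v) vs)"
      unfolding a_def if_P[OF Y] cup_def by (simp flip: distrib_right add: add.assoc)
    ultimately have "a 1 (map (\<lambda>v. \<rho> *\<^sub>R v) vs) + a 0 (map (\<lambda>v. \<rho> *\<^sub>R v) vs) = \<alpha> vs" by simp
    then show "\<alpha> vs = (\<gamma> (map (\<lambda>v. \<rho> *\<^sub>R v) vs) + a 1 (map (\<lambda>v. \<rho> *\<^sub>R v) vs)) +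
        (\<gamma> (map (\<lambda>v. \<rho> *\<^sub>R v) vs) + a 0 (map (\<lambda>v. \<rho> *\<^sub>R v) vs))"
      by (metis add.assoc add.left_commute bit_add_self_left)
  qed
  with nt show False ..
qed

end

section \<open>The case k = 0\<close>

lemma cocycle_\<chi>\<^sub>0:
  assumes "B0 = M" shows "cocycle 0 (top_of_set (UNIV - B)) (\<lambda>xs. \<chi>\<^sub>0 (hd xs))"
  unfolding cocycle_def
proof (rule locally_zeroI)
  fix x assume "x \<in> topspace (top_of_set (UNIV - B))"
  then have x: "x \<notin> B" by simp
  \<comment> \<open>Every ray passes through B0 = M, so Y is empty and \<open>\<chi>\<^sub>0\<close>
    is locally constant off B.\<close>
  have "x \<notin> Y" using proj_in[of x] unfolding Y_def unfolding assms by blast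
  then obtain N s where N: "open N" "x \<in> N" "\<forall>u\<in>N. \<chi>\<^sub>0 u = s" using constant_nbhd x by blast
  have "delta (\<lambda>xs. \<chi>\<^sub>0 (hd xs)) xs = 0" if "length xs = Suc (Suc 0)" "set xs \<subseteq> N" for xs
  proof -
    obtain u v where "xs = [u, v]" using \<open>length xs = Suc (Suc 0)\<close> by (auto simp: length_Suc_conv)
    with that N(3) show ?thesis by simp
  qed
  with N x show "\<exists>V. openin (top_of_set (UNIV - B)) V \<and> x \<in> V \<and>
      (\<forall>xs. length xs = Suc (Suc 0) \<longrightarrow> set xs \<subseteq> V \<longrightarrow> delta (\<lambda>xs. \<chi>\<^sub>0 (hd xs)) xs = 0)"
    by (intro exI[of _ "(UNIV - B) \<inter> N"]) (auto simp: openin_open)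
qed

text \<open>A reduced coboundary of degree 0 is constant, but the two points of A on the ray of w0
  lie on different sides of B.\<close>

lemma \<chi>\<^sub>0_nontrivial:
  assumes "B0 = M" "r *\<^sub>R w0 \<in> A" "R *\<^sub>R w0 \<in> A"
  shows "\<not> reduced_coboundary 0 (top_of_set A) (\<lambda>xs. \<chi>\<^sub>0 (hd xs))"
proof
  assume "reduced_coboundary 0 (top_of_set A) (\<lambda>xs. \<chi>\<^sub>0 (hd xs))"
  then obtain \<theta> where \<theta>: "locally_zero 0 (top_of_set A) (\<lambda>xs. \<chi>\<^sub>0 (hd xs) + delta \<theta> xs)"
    unfolding reduced_coboundary_def by blast
  have *: "\<chi>\<^sub>0 x + \<theta> [] = 0" if "x \<in> A" for x
  proof -
    have "x \<in> topspace (top_of_set A)" using that by simp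
    with \<theta> obtain V where "x \<in> V" "\<forall>xs. length xs = Suc 0 \<longrightarrow> set xs \<subseteq> V \<longrightarrow> \<chi>\<^sub>0 (hd xs) + delta \<theta> xs = 0"
      unfolding locally_zero_def by blast
    then have "\<chi>\<^sub>0 (hd [x]) + delta \<theta> [x] = 0" by (elim allE[of _ "[x]"]) simp
    then show ?thesis by simp
  qed
  \<comment> \<open>Here w0 belongs to B0, so the upper point is outside the ball of radius \<rho>
    e.\<close>
  have w0_pos: "0 < norm w0" "e \<le> norm w0" using w0(1) nonzero e(2)[of w0] assms(1) by auto
  have "\<chi>\<^sub>0 (r *\<^sub>R w0) = 1"
  proof (cases "r = 0")
    case True
    then show ?thesis using rho_pos e by (simp add: \<chi>\<^sub>0_def)
  next
    case False
    then show ?thesis using r w0(1) w0_pos by (simp add: \<chi>\<^sub>0_def proj_scaleR_id mult_right_mono)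
  qed
  moreover have "\<rho> * e < R * norm w0" "\<rho> * norm w0 < R * norm w0"
    using R rho_pos e(1) w0_pos by (auto intro: mult_less_le_imp_less)
  then have "\<chi>\<^sub>0 (R *\<^sub>R w0) = 0"
    using R rho_pos w0(1) by (simp add: \<chi>\<^sub>0_def proj_scaleR_id)
  ultimately show False using *[OF assms(2)] *[OF assms(3)] by simp
qed

end

theorem theorem2p6:
  fixes M A0 B0 A1 A B :: "'a::banach set"
    and w0 :: 'a
    and r \<rho> R :: real
    and k :: nat
  assumes "bounded M" and "symmetric_set M" and "M \<subseteq> UNIV - {0}"
    and "radially_homeomorphic_to_sphere M"
    and "A0 \<subseteq> M" and "closed A0" and "symmetric_set A0"
    and "B0 \<subseteq> M" and "closed B0" and "symmetric_set B0"
    and "A0 \<inter> B0 = {}"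
    and "cohomological_index A0 = enat k"
    and "cohomological_index (M - B0) = enat k"
    and "w0 \<in> M - A0"
    and "0 \<le> r" and "r < \<rho>" and "\<rho> < R"
    and "A1 = (if A0 = {} then {w0}
               else {radial_proj M ((1 - s) *\<^sub>R v + s *\<^sub>R w0) |v s. v \<in> A0 \<and> 0 \<le> s \<and> s \<le> 1})"
    and "A = {r *\<^sub>R u |u. u \<in> A1} \<union> {t *\<^sub>R v |t v. v \<in> A0 \<and> r \<le> t \<and> t \<le> R} \<union> {R *\<^sub>R u |u. u \<in> A1}"
    and "B = {\<rho> *\<^sub>R w |w. w \<in> B0}"
  shows "links_cohomologically k A B"
proof -
  \<comment> \<open>The bound e of the locale exists because B0 is closed and misses 0.\<close>
  have "open (- B0)" "0 \<in> - B0" using assms by auto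
  then obtain e where e: "e > 0" "ball 0 e \<subseteq> - B0" by (meson openE)
  have "e \<le> norm b" if "b \<in> B0" for b
  proof (rule ccontr)
    assume "\<not> ?thesis"
    then have "b \<in> ball 0 e" by simp
    with e(2) that show False by blast
  qed
  then interpret linking M A0 w0 B0 r \<rho> R e
    by unfold_locales (use assms e(1) in auto)
  have A1: "A1 = (if A0 = {} then {w0} else {cone v s |v s. v \<in> A0 \<and> 0 \<le> s \<and> s \<le> 1})"
    using assms(18) by (simp add: cone_def)
  have w0A1: "w0 \<in> A1"
  proof (cases "A0 = {}")
    case False
    then obtain v where "v \<in> A0" by blast
    with False show ?thesis unfolding A1 by (auto intro!: exI[of _ v] exI[of _ 1] simp: cone_1)
  qed (simp add: A1)
  have A1M: "A1 \<subseteq> M" using w0(1) cone_in by (auto simp: A1)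
  have B_eq: "linking.B B0 \<rho> = B"
    using assms(20) by (simp add: B_def)
  have R_pos: "0 < R" using assms by simp
  have disjoint: "A \<inter> B = {}"
  proof -
    have "r *\<^sub>R u \<noteq> \<rho> *\<^sub>R b" "R *\<^sub>R u \<noteq> \<rho> *\<^sub>R b" if "u \<in> M" "b \<in> B0" for u b
      using scaleR_eq_iff[of u b r \<rho>] scaleR_eq_iff[of u b R \<rho>] that B0_subset r R R_pos rho_pos by auto
    moreover have "t *\<^sub>R v \<noteq> \<rho> *\<^sub>R b" if "v \<in> A0" "r \<le> t" "b \<in> B0" for t v b
      using scaleR_eq_iff[of v b t \<rho>] that A0_subset B0_subset disj r rho_pos by auto
    ultimately show ?thesis using A1M unfolding assms(19,20) by blast
  qed
  have incl: "continuous_map (top_of_set A) (top_of_set (UNIV - B)) id"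
    using disjoint by auto
  have sym: "symmetric_set (M - B0)" using assms by (intro symmetric_set_Diff)
  have "B0 \<noteq> {} \<and> (\<exists>c. cocycle k (top_of_set (UNIV - B)) c \<and> \<not> reduced_coboundary k (top_of_set A) c)"
  proof (cases k)
    case 0
    \<comment> \<open>Index 0 characterises the empty set, so B0 is all of M and A consists of two
      points on the ray of w0.\<close>
    then have "A0 = {}" "M - B0 = {}"
      using cohomological_index_0D[of A0] cohomological_index_0D[of "M - B0"] sym assms
      by (auto simp: zero_enat_def)
    then have "B0 = M" using B0_subset by blast
    moreover have "r *\<^sub>R w0 \<in> A" "R *\<^sub>R w0 \<in> A" using w0A1 unfolding assms(19) by blast+
    ultimately show ?thesis using cocycle_\<chi>\<^sub>0 \<chi>\<^sub>0_nontrivial w0(1) 0 unfolding B_eq by blast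
  next
    case (Suc m)
    obtain \<alpha> where \<alpha>: "cocycle m (top_of_set (M - B0)) \<alpha>" "\<not> reduced_coboundary m (top_of_set A0) \<alpha>"
      by (rule ex_cocycle_nontrivial_on_subset[of "M - B0" m A0]) (use assms sym Suc in auto)
    have "B0 \<noteq> {}"
    proof
      assume "B0 = {}"
      \<comment> \<open>If B0 were empty, the cone at level 1 would lie in the domain of \<alpha>
        and trivialise it on A0.\<close>
      have "reduced_coboundary m (top_of_set A0) (\<lambda>vs. \<alpha> (map (\<lambda>v. 1 *\<^sub>R v) vs))"
        by (rule reduced_coboundary_cone[OF \<alpha>(1), where c = 1])
          (use \<open>B0 = {}\<close> A0_subset cone_in in auto)
      with \<alpha>(2) show False by simp
    qed
    moreover have "\<not> reduced_coboundary (Suc m) (top_of_set A) (\<beta> \<alpha>)"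
    proof (rule \<beta>_nontrivial[OF \<alpha>])
      show "t *\<^sub>R v \<in> A" if "v \<in> A0" "r \<le> t" "t \<le> R" for t v using that unfolding assms(19) by blast
      show "r *\<^sub>R cone v s \<in> A \<and> R *\<^sub>R cone v s \<in> A" if "v \<in> A0" "0 \<le> s" "s \<le> 1" for v s
      proof -
        have "cone v s \<in> A1" using that unfolding A1 by auto
        then show ?thesis unfolding assms(19) by blast
      qed
      show "(\<exists>u\<in>M. x = r *\<^sub>R u) \<or> (\<exists>v\<in>A0. \<exists>t\<ge>0. x = t *\<^sub>R v) \<or> (\<exists>u\<in>M. x = R *\<^sub>R u)" if "x \<in> A" for x
      proof -
        from \<open>x \<in> A\<close> consider u where "u \<in> A1" "x = r *\<^sub>R u" | t v where "v \<in> A0" "r \<le> t" "x = t *\<^sub>R v"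
          | u where "u \<in> A1" "x = R *\<^sub>R u" unfolding assms(19) by blast
        then show ?thesis
        proof cases
          case 2
          with r have "0 \<le> t" by simp
          with 2 show ?thesis by blast
        qed (use A1M in blast)+
      qed
    qed
    ultimately show ?thesis using cocycle_\<beta>[OF \<alpha>(1)] Suc unfolding B_eq by blast
  qed
  then obtain c where "B0 \<noteq> {}" "cocycle k (top_of_set (UNIV - B)) c" "\<not> reduced_coboundary k (top_of_set A) c"
    by blast
  moreover have "A \<noteq> {}" using w0A1 unfolding assms(19) by blast
  moreover have "B \<noteq> {}" using \<open>B0 \<noteq> {}\<close> unfolding assms(20) by blast
  ultimately show ?thesis
    unfolding links_cohomologically_def
    using disjoint AS_reduced_induced_nontrivial[OF incl, of k c] by simp
qed

end
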